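(* Let $\alpha \geq \gamma$, let $\mathbf u=(u_1,\dots,u_M)$ be a subsolution of the system (HJ$\alpha$), let $\tau$ be a bounded stopping time, let $\Xi$ be a control, and let $\mathbf a \in \mathcal S$ be a probability vector. Then for any initial point $x \in \mathbb T^N$, $$\mathbb E_{\mathbf a}\big[u_{\omega(0)}(x) - u_{\omega(\tau)}(x + \mathcal I(\Xi)(\tau))\big] \leq \mathbb E_{\mathbf a}\left[\int_0^\tau L_{\omega(s)}(x + \mathcal I(\Xi)(s), -\Xi(s)) + \alpha \, ds\right].$$
   Context: **System.** $\mathbb T^N=\mathbb R^N/\mathbb Z^N$ is the flat torus; $+,-$ also denote its group operations, and points of $\mathbb R^N$ are identified with their projections on $\mathbb T^N$ where needed. For $i\in\{1,\dots,M\}$, $H_i:\mathbb T^N\times\mathbb R^N\to\mathbb R$, $(x,p)\mapsto H_i(x,p)$, is continuous in both variables, convex in $p$ and superlinear in $p$. The Lagrangians are $L_i(x,q)=\max_{p\in\mathbb R^N}(p\cdot q-H_i(x,p))$. $\Lambda=(\Lambda_{ij})$ is an $M\times M$ real matrix with rows $\Lambda^1,\dots,\Lambda^M$ such that every non-diagonal entry is nonpositive, every row sums to $0$, and $\Lambda$ is irreducible (for every nonempty $I\subsetneq\{1,\dots,M\}$ there are $i\in I$, $j\notin I$ with $\Lambda_{ij}\neq0$). For $\alpha\in\mathbb R$, (HJ$\alpha$) is the system $H_i(x,Du_i)+\Lambda^i\cdot\mathbf u=\alpha$ on $\mathbb T^N$, $i=1,\dots,M$. A continuous $\mathbf u=(u_1,\dots,u_M):\mathbb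 T^N\to\mathbb R^M$ is a subsolution (resp. supersolution) of (HJ$\alpha$) if $H_i(x,D\psi(x))+\Lambda^i\cdot\mathbf u(x)\le\alpha$ (resp. $\ge\alpha$) for every $x\in\mathbb T^N$, $i$, and $\psi\in C^1(\mathbb T^N)$ such that $u_i-\psi$ attains a maximum (resp. minimum) at $x$; a solution is both. The critical value is $\gamma=\inf\{\alpha\in\mathbb R : \text{(HJ}\alpha)\text{ admits subsolutions}\}$. **Random setting.** $\mathcal D$ is the space of cadlag paths $\omega:[0,+\infty)\to\{1,\dots,M\}$; $\mathcal F$ is the $\sigma$-algebra generated by the evaluations $\omega\mapsto\omega(s)$, $s\ge0$, and $\mathcal F_t$ the one generated by those with $s\le t$. $\mathcal S\subset\mathbb R^M$ is the simplex of probability vectors (regarded as row vectors). For $\mathbf a\in\mathcal S$, $\mathbb P_{\mathbf a}$ is the unique probability measure on $(\mathcal D,\mathcal F)$ with $$\mathbb P_{\mathbf a}(\omega(t_1)=j_1,\dots,\omega(t_k)=j_k)=(\mathbf a e^{-t_1\Lambda})_{j_1}\prod_{l=2}^k\big(e^{-(t_l-t_{l-1})\Lambda}\big)_{j_{l-1}j_l}$$ for all $k\in\mathbb N$, $0\le t_1<\dots<t_k$ and indices $j_1,\dots,j_k$. $\mathbb E_{\mathbf a}$ is the expectation with respect to $\mathbb P_{\mathbf a}$. "Almost surely" (a.s.) means up to a set that is $\mathbb P_{\mathbf a}$-null for some, equivalently all, $\mathbf a\in\mathcal S$ with strictly positive components. A stopping time is a nonnegative random variable $\tau$ on $(\mathcal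 D,\mathcal F)$ with $\{\tau\le t\}\in\mathcal F_t$ for all $t\ge0$. **Controls.** $\mathcal D(0,+\infty;\mathbb R^N)$ is the space of cadlag paths $[0,+\infty)\to\mathbb R^N$ with the Skorohod metric and its Borel $\sigma$-algebra (generated by the evaluations). A control is a measurable map $\Xi:\mathcal D\to\mathcal D(0,+\infty;\mathbb R^N)$ such that (i) for every $t>0$ there is $R>0$ with $\sup_{[0,t]}|\Xi|<R$ a.s.; (ii) $\Xi$ is nonanticipating: for every $t>0$, $\omega_1=\omega_2$ in $[0,t]$ implies $\Xi(\omega_1)=\Xi(\omega_2)$ in $[0,t]$. For $\xi\in\mathcal D(0,+\infty;\mathbb R^N)$, $\mathcal I(\xi)(t)\in\mathbb T^N$ is the projection on $\mathbb T^N$ of $\int_0^t\xi\,ds$; $\mathcal I(\Xi)$ is defined $\omega$ by $\omega$. *)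

theory Defs
  imports "HOL-Probability.Probability"
begin

section \<open>The flat torus\<close>

definition torus_rel :: "real ^ 'n \<Rightarrow> real ^ 'n \<Rightarrow> bool" where
  "torus_rel x y \<longleftrightarrow> (\<forall>i. (x - y) $ i \<in> \<int>)"

lemma equivp_torus_rel: "equivp torus_rel"
proof (rule equivpI)
  show "reflp torus_rel" by (simp add: reflp_def torus_rel_def)
  show "symp torus_rel"
    unfolding symp_def torus_rel_def by (metis Ints_minus minus_diff_eq vector_uminus_component)
  show "transp torus_rel"
  proof (rule transpI)
    fix x y z :: "real ^ 'n"
    assume "torus_rel x y" "torus_rel y z"
    then have "(x - y) $ i + (y - z) $ i \<in> \<int>" for i
      unfolding torus_rel_def by (blast intro: Ints_add)
    then show "torus_rel x z" by (simp add: torus_rel_def)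
  qed
qed

quotient_type 'n torus = "real ^ 'n" / torus_rel
  by (rule equivp_torus_rel)

lift_definition torus_proj :: "real ^ 'n \<Rightarrow> 'n torus" is "\<lambda>x. x" .

instantiation torus :: (finite) ab_group_add
begin

lift_definition zero_torus :: "'a torus" is 0 .

lift_definition plus_torus :: "'a torus \<Rightarrow> 'a torus \<Rightarrow> 'a torus" is "(+)"
proof -
  fix a b c d :: "real ^ 'a"
  assume "torus_rel a b" "torus_rel c d"
  then have "(a - b) $ i + (c - d) $ i \<in> \<int>" for i
    unfolding torus_rel_def by (blast intro: Ints_add)
  then show "torus_rel (a + c) (b + d)"
    by (simp add: torus_rel_def algebra_simps)
qed

lift_definition uminus_torus :: "'a torus \<Rightarrow> 'a torus" is uminus
proof -
  fix a b :: "real ^ 'a"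
  assume "torus_rel a b"
  then have "- ((a - b) $ i) \<in> \<int>" for i
    unfolding torus_rel_def by (blast intro: Ints_minus)
  then show "torus_rel (- a) (- b)"
    by (simp add: torus_rel_def)
qed

definition minus_torus :: "'a torus \<Rightarrow> 'a torus \<Rightarrow> 'a torus" where
  "minus_torus x y = x + (- y)"

instance
proof
  fix a b c :: "'a torus"
  show "a + b + c = a + (b + c)" by transfer (simp add: torus_rel_def algebra_simps)
  show "a + b = b + a" by transfer (simp add: torus_rel_def algebra_simps)
  show "0 + a = a" by transfer (simp add: torus_rel_def)
  show "- a + a = 0" by transfer (simp add: torus_rel_def)
  show "a - b = a + - b" by (rule minus_torus_def)
qed

end

text \<open>The quotient topology.\<close>

instantiation torus :: (finite) topological_space
begin

definition open_torus :: "'a torus set \<Rightarrow> bool" where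
  "open_torus U \<longleftrightarrow> open (torus_proj -` U)"

instance
proof
  show "open (UNIV :: 'a torus set)" by (simp add: open_torus_def)
next
  fix S T :: "'a torus set"
  assume "open S" "open T"
  then show "open (S \<inter> T)" by (simp add: open_torus_def vimage_Int open_Int)
next
  fix K :: "'a torus set set"
  assume "\<forall>S\<in>K. open S"
  then show "open (\<Union>K)" by (auto simp: open_torus_def vimage_Union)
qed

end

definition has_torus_gradient :: "('n::finite torus \<Rightarrow> real) \<Rightarrow> real ^ 'n \<Rightarrow> 'n torus \<Rightarrow> bool" where
  "has_torus_gradient \<psi> p x \<longleftrightarrow>
     ((\<lambda>v. \<psi> (x + torus_proj v)) has_derivative (\<lambda>v. p \<bullet> v)) (at 0)"

definition C1_torus :: "('n::finite torus \<Rightarrow> real) \<Rightarrow> ('n torus \<Rightarrow> real ^ 'n) \<Rightarrow> bool" where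
  "C1_torus \<psi> D\<psi> \<longleftrightarrow> continuous_on UNIV D\<psi> \<and> (\<forall>x. has_torus_gradient \<psi> (D\<psi> x) x)"


section \<open>The system\<close>

text \<open>The index set \<open>{1, \<dots>, M}\<close> is a finite type \<open>'m\<close>; \<open>\<Lambda> $ i\<close> is the \<open>i\<close>-th row of \<open>\<Lambda>\<close>.\<close>

definition superlinear :: "(real ^ 'n \<Rightarrow> real) \<Rightarrow> bool" where
  "superlinear h \<longleftrightarrow> filterlim (\<lambda>p. h p / norm p) at_top at_infinity"

definition hamiltonian :: "('n::finite torus \<Rightarrow> real ^ 'n \<Rightarrow> real) \<Rightarrow> bool" where
  "hamiltonian h \<longleftrightarrow> continuous_on UNIV (\<lambda>(x, p). h x p) \<and>
     (\<forall>x. convex_on UNIV (h x)) \<and> (\<forall>x. superlinear (h x))"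

text \<open>For a Hamiltonian the supremum is finite and attained, i.e. it is a maximum.\<close>

definition lagrangian :: "('n::finite torus \<Rightarrow> real ^ 'n \<Rightarrow> real) \<Rightarrow> 'n torus \<Rightarrow> real ^ 'n \<Rightarrow> real" where
  "lagrangian h x q = (SUP p. p \<bullet> q - h x p)"

definition irreducible_matrix :: "real ^ 'm ^ 'm \<Rightarrow> bool" where
  "irreducible_matrix \<Lambda> \<longleftrightarrow>
     (\<forall>I. I \<noteq> {} \<and> I \<noteq> UNIV \<longrightarrow> (\<exists>i\<in>I. \<exists>j. j \<notin> I \<and> \<Lambda> $ i $ j \<noteq> 0))"

definition coupling_matrix :: "real ^ 'm ^ 'm \<Rightarrow> bool" where
  "coupling_matrix \<Lambda> \<longleftrightarrow> (\<forall>i j. i \<noteq> j \<longrightarrow> \<Lambda> $ i $ j \<le> 0) \<and>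
     (\<forall>i. (\<Sum>j\<in>UNIV. \<Lambda> $ i $ j) = 0) \<and> irreducible_matrix \<Lambda>"

definition subsolution ::
  "('m::finite \<Rightarrow> 'n::finite torus \<Rightarrow> real ^ 'n \<Rightarrow> real) \<Rightarrow> real ^ 'm ^ 'm \<Rightarrow> real \<Rightarrow>
   ('n torus \<Rightarrow> real ^ 'm) \<Rightarrow> bool" where
  "subsolution H \<Lambda> \<alpha> u \<longleftrightarrow> continuous_on UNIV u \<and>
     (\<forall>x i \<psi> D\<psi>. C1_torus \<psi> D\<psi> \<and> (\<forall>y. u y $ i - \<psi> y \<le> u x $ i - \<psi> x) \<longrightarrow>
        H i x (D\<psi> x) + \<Lambda> $ i \<bullet> u x \<le> \<alpha>)"

definition critical_value ::
  "('m::finite \<Rightarrow> 'n::finite torus \<Rightarrow> real ^ 'n \<Rightarrow> real) \<Rightarrow> real ^ 'm ^ 'm \<Rightarrow> real" where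
  "critical_value H \<Lambda> = Inf {\<alpha>. \<exists>u. subsolution H \<Lambda> \<alpha> u}"


section \<open>Cadlag paths\<close>

text \<open>Paths on \<open>[0, \<infinity>)\<close> are functions on the reals that are \<open>undefined\<close> outside \<open>{0..}\<close>,
  so that equal paths are equal functions.\<close>

definition cadlag_paths :: "'a topology \<Rightarrow> (real \<Rightarrow> 'a) set" where
  "cadlag_paths X = {f \<in> extensional {0..}.
     (\<forall>t\<ge>0. limitin X f (f t) (at_right t)) \<and> (\<forall>t>0. \<exists>l. limitin X f l (at_left t))}"

text \<open>The \<open>\<sigma>\<close>-algebra on cadlag paths generated by the evaluations at the times in \<open>T\<close>,
  with the Borel \<open>\<sigma>\<close>-algebra on the state space. For paths in \<open>\<real>\<^sup>N\<close> and \<open>T = {0..}\<close>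
  this is the Borel \<open>\<sigma>\<close>-algebra of the Skorohod metric.\<close>

definition evaluation_algebra :: "'a topology \<Rightarrow> real set \<Rightarrow> (real \<Rightarrow> 'a) measure" where
  "evaluation_algebra X T = sigma (cadlag_paths X)
     {(\<lambda>f. f s) -` U \<inter> cadlag_paths X | s U. s \<in> T \<and> openin X U}"

definition index_paths :: "(real \<Rightarrow> 'm) set" where
  "index_paths = cadlag_paths (discrete_topology UNIV)"

definition index_algebra :: "(real \<Rightarrow> 'm) measure" where
  "index_algebra = evaluation_algebra (discrete_topology UNIV) {0..}"

definition index_filtration :: "real \<Rightarrow> (real \<Rightarrow> 'm) measure" where
  "index_filtration t = evaluation_algebra (discrete_topology UNIV) {0..t}"


section \<open>The random setting\<close>

definition prob_vectors :: "(real ^ 'm) set" where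
  "prob_vectors = {a. (\<forall>i. 0 \<le> a $ i) \<and> (\<Sum>i\<in>UNIV. a $ i) = 1}"

definition matrix_exp :: "real ^ 'm ^ 'm \<Rightarrow> real ^ 'm ^ 'm" where
  "matrix_exp A = (\<Sum>k. (1 / fact k) *\<^sub>R (((**) A ^^ k) (mat 1)))"

text \<open>The characterisation of the law \<open>\<P>\<^sub>a\<close> by its finite-dimensional distributions; the times are
  \<open>t 0 < \<dots> < t k\<close>.\<close>

definition is_path_law :: "real ^ 'm ^ 'm \<Rightarrow> real ^ 'm \<Rightarrow> (real \<Rightarrow> 'm) measure \<Rightarrow> bool" where
  "is_path_law \<Lambda> a P \<longleftrightarrow> prob_space P \<and> sets P = sets index_algebra \<and>
     (\<forall>k (t :: nat \<Rightarrow> real) (j :: nat \<Rightarrow> 'm). 0 \<le> t 0 \<and> (\<forall>l<k. t l < t (Suc l)) \<longrightarrow>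
        measure P {\<omega> \<in> index_paths. \<forall>l\<le>k. \<omega> (t l) = j l} =
          (a v* matrix_exp (- t 0 *\<^sub>R \<Lambda>)) $ j 0 *
          (\<Prod>l<k. matrix_exp (- (t (Suc l) - t l) *\<^sub>R \<Lambda>) $ j l $ j (Suc l)))"

text \<open>\<open>P\<close> is the family \<open>a \<mapsto> \<P>\<^sub>a\<close>; the choice of the strictly positive \<open>b\<close> is immaterial.\<close>

definition almost_surely :: "(real ^ 'm \<Rightarrow> (real \<Rightarrow> 'm) measure) \<Rightarrow> ((real \<Rightarrow> 'm) \<Rightarrow> bool) \<Rightarrow> bool" where
  "almost_surely P Q \<longleftrightarrow> (\<exists>b \<in> prob_vectors. (\<forall>i. 0 < b $ i) \<and> (AE \<omega> in P b. Q \<omega>))"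

definition bounded_stopping_time :: "((real \<Rightarrow> 'm) \<Rightarrow> real) \<Rightarrow> bool" where
  "bounded_stopping_time \<tau> \<longleftrightarrow> \<tau> \<in> borel_measurable index_algebra \<and>
     (\<forall>\<omega>\<in>index_paths. 0 \<le> \<tau> \<omega>) \<and>
     stopping_time index_filtration \<tau> \<and>
     (\<exists>T. \<forall>\<omega>\<in>index_paths. \<tau> \<omega> \<le> T)"

definition control ::
  "(real ^ 'm \<Rightarrow> (real \<Rightarrow> 'm) measure) \<Rightarrow> ((real \<Rightarrow> 'm) \<Rightarrow> real \<Rightarrow> real ^ 'n) \<Rightarrow> bool" where
  "control P \<Xi> \<longleftrightarrow> \<Xi> \<in> measurable index_algebra (evaluation_algebra euclidean {0..}) \<and>
     (\<forall>t>0. \<exists>R>0. almost_surely P (\<lambda>\<omega>. (SUP s\<in>{0..t}. norm (\<Xi> \<omega> s)) < R)) \<and>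
     (\<forall>t>0. \<forall>\<omega>1\<in>index_paths. \<forall>\<omega>2\<in>index_paths.
        (\<forall>s\<in>{0..t}. \<omega>1 s = \<omega>2 s) \<longrightarrow> (\<forall>s\<in>{0..t}. \<Xi> \<omega>1 s = \<Xi> \<omega>2 s))"

definition torus_integral :: "(real \<Rightarrow> real ^ 'n) \<Rightarrow> real \<Rightarrow> 'n torus" where
  "torus_integral \<xi> t = torus_proj (LINT s:{0..t}|lborel. \<xi> s)"

end

theory Submission
  imports Defs
begin

text \<open>
  Let \<open>y(t) = x + \<I>(\<Xi>)(t)\<close>. The statement is the optional stopping inequality \<open>\<E> X(0) \<le> \<E> X(\<tau>)\<close> for the
  process \<open>X(t) = u\<^bsub>\<omega>(t)\<^esub>(y(t)) + \<integral>\<^sub>0\<^sup>t L\<^bsub>\<omega>(s)\<^esub>(y(s), -\<Xi>(s)) + \<alpha> ds\<close>, which is a submartingale for two reasons.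

  While the index stays at \<open>i\<close>, the subsolution property gives
  \<open>u\<^sub>i(y(s)) - u\<^sub>i(y(t)) \<le> \<integral>\<^sub>s\<^sup>t L\<^sub>i(y, -\<Xi>) + \<alpha> - \<Lambda>\<^sup>i \<cdot> u(y) dr\<close>. For smooth \<open>u\<close> this is the chain rule and the
  Fenchel inequality. In the viscosity sense it is proved in \<open>subsolution_along_curve\<close> by penalising the distance
  between a free point and the point of the curve; cadlag velocities are admissible because only right
  derivatives in time occur. The continuity of \<open>L\<close> used there comes from \<open>hamiltonian_uniformly_superlinear\<close>.

  When the index switches, the Markov property (\<open>path_law_markov\<close>) and the expansion
  \<open>e\<^bsup>-h\<Lambda>\<^esup> = 1 - h \<Lambda> + O(h\<^sup>2)\<close> show that \<open>u\<^bsub>\<omega>(t)\<^esub>\<close>, taken at a position known at time \<open>t\<close>, decreases on average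
  by \<open>h \<Lambda>\<^bsup>\<omega>(t)\<^esup> \<cdot> u + O(h\<^sup>2)\<close> during a time \<open>h\<close>. This cancels the coupling term of the first part.

  The two are combined in \<open>one_step\<close>. Over a time step of length \<open>h\<close> one freezes the index in the first part and
  the position in the second. The probability of a jump is \<open>O(h)\<close> and the position moves by \<open>O(h)\<close>, so the
  expected decrease of \<open>X\<close> on an event of the past is at most \<open>h\<close> times a quantity that tends to \<open>0\<close> with
  \<open>h\<close>. Summing over a grid up to the stopping time rounded up to the grid, and letting \<open>h \<rightarrow> 0\<close>, gives the
  inequality (\<open>optional_stopping\<close>): \<open>X\<close> is bounded and right-continuous.

  A control is bounded only almost surely, for strictly positive initial distributions. Every \<open>\<P>\<^sub>a\<close> is
  absolutely continuous with respect to such a law (\<open>path_law_AE_transfer\<close>), so the control may be replaced by its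
  projection on a ball, for which all estimates hold on every path.
\<close>

section \<open>Periodic functions on the covering space\<close>

lemma torus_proj_eq_iff: "torus_proj x = torus_proj y \<longleftrightarrow> (\<forall>i. (x - y) $ i \<in> \<int>)"
  unfolding torus_proj.abs_eq torus_rel_def[symmetric]
  by transfer (use equivp_torus_rel in \<open>auto simp: equivp_def\<close>)

lemma torus_proj_add: "torus_proj (x + y) = torus_proj x + torus_proj y"
  by transfer (simp add: torus_rel_def)

lemma torus_proj_surj: "\<exists>z. torus_proj z = x"
  by transfer (metis diff_self torus_rel_def Ints_0 zero_index)

lemma continuous_torus_proj: "continuous_on UNIV (torus_proj :: real ^ 'n::finite \<Rightarrow> 'n torus)"
  unfolding continuous_on_open_vimage[OF open_UNIV] by (simp add: open_torus_def)

lemma continuous_on_torus_iff: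
  fixes f :: "'n::finite torus \<Rightarrow> 'b::topological_space"
  shows "continuous_on UNIV f \<longleftrightarrow> continuous_on UNIV (\<lambda>z. f (torus_proj z))"
  unfolding continuous_on_open_vimage[OF open_UNIV]
  by (simp add: open_torus_def vimage_def)

text \<open>Invariance under \<open>\<int>\<^sup>N\<close>, so that \<open>periodic f\<close> says that \<open>f\<close> factors through \<open>torus_proj\<close>.\<close>

definition periodic :: "(real ^ 'n \<Rightarrow> 'b) \<Rightarrow> bool" where
  "periodic f \<longleftrightarrow> (\<forall>x y. (\<forall>i. (x - y) $ i \<in> \<int>) \<longrightarrow> f x = f y)"

lemma periodicD: "periodic f \<Longrightarrow> (\<And>i. (x - y) $ i \<in> \<int>) \<Longrightarrow> f x = f y"
  by (auto simp: periodic_def)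

lemma periodic_torus: "periodic (\<lambda>z. f (torus_proj z))"
  unfolding periodic_def torus_proj_eq_iff[symmetric] by simp

text \<open>Every orbit of \<open>\<int>\<^sup>N\<close> meets the unit cube centred at any given point. With centre \<open>0\<close> this gives a
  compact fundamental domain; with centre on a curve it picks the representative closest to it.\<close>

lemma representative_near:
  fixes z y :: "real ^ 'n::finite"
  shows "\<exists>w. (\<forall>i. (w - z) $ i \<in> \<int>) \<and> (\<forall>i. \<bar>(w - y) $ i\<bar> \<le> 1/2)"
proof (intro exI conjI allI)
  define w where "w = (\<chi> i. z $ i - of_int (round (z $ i - y $ i)))"
  show "(w - z) $ i \<in> \<int>" for i by (simp add: w_def)
  show "\<bar>(w - y) $ i\<bar> \<le> 1/2" for i
    using of_int_round_abs_le[of "z $ i - y $ i"] by (simp add: w_def abs_minus_commute algebra_simps)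
qed

abbreviation half_cube :: "(real ^ 'n) set" where
  "half_cube \<equiv> {v. \<forall>i. \<bar>v $ i\<bar> \<le> 1/2}"

lemma compact_half_cube: "compact (half_cube :: (real ^ 'n::finite) set)"
proof -
  have "\<bar>r\<bar> \<le> 1/2 \<longleftrightarrow> -1/2 \<le> r \<and> r \<le> 1/2" for r :: real by linarith
  then have "(half_cube :: (real ^ 'n) set) = cbox (\<chi> i. -1/2) (\<chi> i. 1/2)"
    by (simp add: set_eq_iff mem_box_cart)
  then show ?thesis by simp
qed

lemma compact_torus: "compact (UNIV :: 'n::finite torus set)"
proof -
  have "UNIV = torus_proj ` (half_cube :: (real ^ 'n) set)"
  proof (intro equalityI subsetI)
    fix x :: "'n torus"
    obtain z where z: "torus_proj z = x" using torus_proj_surj by blast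
    obtain w :: "real ^ 'n" where w: "\<And>i. (w - z) $ i \<in> \<int>" "w \<in> half_cube"
      using representative_near[of z 0] by auto
    have "torus_proj w = x" using w(1) z torus_proj_eq_iff by metis
    then show "x \<in> torus_proj ` (half_cube :: (real ^ 'n) set)" using w(2) by auto
  qed auto
  then show ?thesis
    using compact_continuous_image[OF continuous_on_subset[OF continuous_torus_proj] compact_half_cube]
    by (metis subset_UNIV)
qed

text \<open>A perturbation of size less than \<open>1\<close> of a point of the fundamental cube stays in the sum of the cube
  with the closed unit ball, and the product of this compact set with \<open>K\<close> carries uniform continuity.\<close>

lemma periodic_uniformly_continuous:
  fixes f :: "real ^ 'n::finite \<Rightarrow> 'a::metric_space \<Rightarrow> real"
  assumes "continuous_on (UNIV \<times> K) (\<lambda>(z, q). f z q)" "compact K" "\<And>q. periodic (\<lambda>z. f z q)" "e > 0"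
  obtains d where "d > 0" "\<And>z z' q. q \<in> K \<Longrightarrow> norm (z - z') < d \<Longrightarrow> \<bar>f z q - f z' q\<bar> < e"
proof -
  define C where "C = (half_cube :: (real ^ 'n) set)"
  define C' where "C' = {x + y |x y. x \<in> C \<and> y \<in> cball (0::real ^ 'n) 1}"
  have "compact C'" unfolding C'_def C_def by (intro compact_sums compact_half_cube compact_cball)
  then have "compact (C' \<times> K)" using assms by (simp add: compact_Times)
  moreover have "continuous_on (C' \<times> K) (\<lambda>(z, q). f z q)"
    by (rule continuous_on_subset[OF assms(1)]) auto
  ultimately have "uniformly_continuous_on (C' \<times> K) (\<lambda>(z, q). f z q)"
    by (rule compact_uniformly_continuous[rotated])
  then obtain d where d: "d > 0" "\<And>a b. a \<in> C' \<times> K \<Longrightarrow> b \<in> C' \<times> K \<Longrightarrow> dist b a < d \<Longrightarrow>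
      dist (case b of (z, q) \<Rightarrow> f z q) (case a of (z, q) \<Rightarrow> f z q) < e"
    using \<open>e > 0\<close> unfolding uniformly_continuous_on_def by metis
  show ?thesis
  proof
    show "min d 1 > 0" using d by simp
    fix z z' :: "real ^ 'n" and q assume q: "q \<in> K" and zz: "norm (z - z') < min d 1"
    obtain w :: "real ^ 'n" where w: "\<And>i. (w - z) $ i \<in> \<int>" "w \<in> half_cube"
      using representative_near[of z 0] by auto
    define w' where "w' = w + (z' - z)"
    have w': "(w' - z') $ i \<in> \<int>" for i using w(1)[of i] by (simp add: w'_def algebra_simps)
    have "w + 0 \<in> C'" "w' \<in> C'" unfolding C'_def w'_def using w(2) zz
      by (force simp: C_def norm_minus_commute)+
    moreover have "dist (w, q) (w', q) < d"
      using zz by (simp add: dist_Pair_Pair w'_def dist_norm norm_minus_commute)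
    ultimately have "dist (f w q) (f w' q) < e" using d(2)[of "(w', q)" "(w, q)"] q by simp
    moreover have "f w q = f z q" "f w' q = f z' q"
      using periodicD[OF assms(3), of w z q] periodicD[OF assms(3), of w' z' q] w(1) w' by auto
    ultimately show "\<bar>f z q - f z' q\<bar> < e" by (simp add: dist_real_def)
  qed
qed

text \<open>The subsolution property with test functions on \<open>\<real>\<^sup>N\<close>: a periodic \<open>C\<^sup>1\<close> function with periodic
  gradient descends to the torus, because the choice of representatives does not affect its value.\<close>

lemma subsolution_test:
  fixes H :: "'m::finite \<Rightarrow> 'n::finite torus \<Rightarrow> real ^ 'n \<Rightarrow> real"
  assumes "subsolution H \<Lambda> \<alpha> u"
    and per: "periodic \<Phi>" "periodic G" and G: "continuous_on UNIV G"
    and der: "\<And>z. (\<Phi> has_derivative (\<lambda>v. G z \<bullet> v)) (at z)"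
    and max: "\<And>y. u (torus_proj y) $ i - \<Phi> y \<le> u (torus_proj z) $ i - \<Phi> z"
  shows "H i (torus_proj z) (G z) + \<Lambda> $ i \<bullet> u (torus_proj z) \<le> \<alpha>"
proof -
  define rep where "rep x = (SOME y::real ^ 'n. torus_proj y = x)" for x
  have rep: "torus_proj (rep x) = x" for x
    unfolding rep_def by (rule someI_ex) (rule torus_proj_surj)
  define \<psi> where "\<psi> x = \<Phi> (rep x)" for x
  define D where "D x = G (rep x)" for x
  have eq: "\<psi> (torus_proj y) = \<Phi> y" "D (torus_proj y) = G y" for y
    using rep[of "torus_proj y"] periodicD[OF per(1)] periodicD[OF per(2)]
    unfolding \<psi>_def D_def torus_proj_eq_iff by blast+
  have "continuous_on UNIV D" unfolding continuous_on_torus_iff by (simp add: eq G)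
  moreover have "has_torus_gradient \<psi> (D x) x" for x
  proof -
    obtain y where y: "torus_proj y = x" using torus_proj_surj by blast
    have "((\<lambda>v. \<Phi> (y + v)) has_derivative (\<lambda>v. G y \<bullet> v)) (at 0)"
      by (rule has_derivative_eq_rhs[OF has_derivative_compose[of "\<lambda>v. y + v" "\<lambda>v. v" 0 UNIV \<Phi> "\<lambda>v. G y \<bullet> v"]])
         (auto intro!: derivative_eq_intros der)
    then show ?thesis
      by (simp add: has_torus_gradient_def y[symmetric] torus_proj_add[symmetric] eq)
  qed
  ultimately have "C1_torus \<psi> D" by (simp add: C1_torus_def)
  moreover have "u x $ i - \<psi> x \<le> u (torus_proj z) $ i - \<psi> (torus_proj z)" for x
    using max[of "rep x"] by (simp add: rep eq) (simp add: \<psi>_def)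
  ultimately have "H i (torus_proj z) (D (torus_proj z)) + \<Lambda> $ i \<bullet> u (torus_proj z) \<le> \<alpha>"
    using assms(1) unfolding subsolution_def by blast
  then show ?thesis by (simp add: eq)
qed

section \<open>Hamiltonians and Lagrangians\<close>

lemma hamiltonian_lift_continuous:
  assumes "hamiltonian h"
  shows "continuous_on UNIV (\<lambda>(z, p). h (torus_proj z) p)"
proof -
  have "continuous_on UNIV (\<lambda>x. torus_proj (fst x))"
    by (rule continuous_on_compose2[OF continuous_torus_proj]) (auto intro: continuous_intros)
  then have "continuous_on UNIV (\<lambda>x. (torus_proj (fst x), snd x))"
    by (intro continuous_on_Pair continuous_on_snd continuous_on_id)
  then have "continuous_on UNIV (\<lambda>x. (\<lambda>(x, p). h x p) (torus_proj (fst x), snd x))"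
    by (rule continuous_on_compose2[of UNIV "\<lambda>(x, p). h x p", rotated])
       (use assms in \<open>simp_all add: hamiltonian_def\<close>)
  then show ?thesis by (simp add: split_beta)
qed

lemma periodic_bounded:
  fixes f :: "real ^ 'n::finite \<Rightarrow> 'a::topological_space \<Rightarrow> real"
  assumes "continuous_on (UNIV \<times> K) (\<lambda>(z, q). f z q)" "compact K" "\<And>q. periodic (\<lambda>z. f z q)"
  shows "\<exists>B\<ge>0. \<forall>z. \<forall>q\<in>K. \<bar>f z q\<bar> \<le> B"
proof -
  define C where "C = (half_cube :: (real ^ 'n) set)"
  have "compact ((\<lambda>(z, q). f z q) ` (C \<times> K))"
    unfolding C_def using assms compact_half_cube
    by (intro compact_continuous_image compact_Times continuous_on_subset[OF assms(1)]) auto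
  from compact_imp_bounded[OF this] obtain B where B: "\<And>z q. z \<in> C \<Longrightarrow> q \<in> K \<Longrightarrow> \<bar>f z q\<bar> \<le> B"
    unfolding bounded_iff by force
  have "\<bar>f z q\<bar> \<le> max B 0" if q: "q \<in> K" for z q
  proof -
    obtain w where w: "\<And>i. (w - z) $ i \<in> \<int>" "w \<in> C"
      using representative_near[of z 0] by (auto simp: C_def)
    then show ?thesis using B[OF w(2) q] periodicD[OF assms(3), of w z q] by auto
  qed
  then show ?thesis by (intro exI[of _ "max B 0"]) auto
qed

lemma hamiltonian_bounded:
  assumes "hamiltonian h"
  shows "\<exists>B\<ge>0. \<forall>x p. norm p \<le> R \<longrightarrow> \<bar>h x p\<bar> \<le> B"
proof -
  have "\<exists>B\<ge>0. \<forall>z. \<forall>p\<in>cball 0 R. \<bar>h (torus_proj z) p\<bar> \<le> B"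
    by (rule periodic_bounded)
       (auto intro!: periodic_torus continuous_on_subset[OF hamiltonian_lift_continuous[OF assms]])
  then obtain B where "B \<ge> 0" "\<And>z p. norm p \<le> R \<Longrightarrow> \<bar>h (torus_proj z) p\<bar> \<le> B" by auto
  then show ?thesis by (intro exI[of _ B]) (metis torus_proj_surj)
qed

text \<open>Superlinearity is assumed for each point separately; convexity in \<open>p\<close> and compactness of the torus
  make it uniform. If the bound fails along \<open>(x\<^sub>n, p\<^sub>n)\<close>, then \<open>|p\<^sub>n| \<rightarrow> \<infinity>\<close>, and convexity on the segment from
  \<open>0\<close> to \<open>p\<^sub>n\<close> transports the bound down to the sphere of any fixed radius \<open>\<rho>\<close>. In the limit \<open>h\<close> grows at most
  linearly, with slope \<open>K\<close>, in some direction over some point, against superlinearity there.\<close>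

lemma hamiltonian_uniformly_superlinear:
  fixes h :: "'n::finite torus \<Rightarrow> real ^ 'n \<Rightarrow> real"
  assumes h: "hamiltonian h" and K: "K \<ge> 0"
  shows "\<exists>C. \<forall>x p. K * norm p - C \<le> h x p"
proof (rule ccontr)
  assume "\<not> ?thesis"
  then have "\<forall>n::nat. \<exists>x p. h x p < K * norm p - real n" by (meson not_le)
  then obtain X p where "\<And>n. h (X n) (p n) < K * norm (p n) - real n" by metis
  moreover have "\<forall>x. \<exists>w::real^'n. (\<forall>i. \<bar>w $ i\<bar> \<le> 1/2) \<and> torus_proj w = x"
    using representative_near[of _ 0] torus_proj_surj torus_proj_eq_iff by (metis diff_zero)
  then obtain rp :: "'n torus \<Rightarrow> real ^ 'n"
    where rp: "\<And>x. (\<forall>i. \<bar>rp x $ i\<bar> \<le> 1/2) \<and> torus_proj (rp x) = x" by metis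
  define z where "z n = rp (X n)" for n
  ultimately have lt: "h (torus_proj (z n)) (p n) < K * norm (p n) - real n" for n
    using rp by (simp add: z_def)
  define C where "C = (half_cube :: (real ^ 'n) set)"
  define e where "e n = sgn (p n)" for n
  have comp: "compact (C \<times> cball (0::real^'n) 1)" unfolding C_def by (intro compact_Times compact_half_cube compact_cball)
  have mem: "\<forall>n. (z n, e n) \<in> C \<times> cball 0 1"
    using rp by (auto simp: z_def C_def e_def norm_sgn)
  obtain l r where "l \<in> C \<times> cball 0 1" and l: "strict_mono r" "((\<lambda>n. (z n, e n)) \<circ> r) \<longlonglongrightarrow> l"
    by (rule seq_compactE[OF compact_imp_seq_compact[OF comp] mem])
  obtain z0 e0 where [simp]: "l = (z0, e0)" by (cases l)
  have ze: "(\<lambda>n. z (r n)) \<longlonglongrightarrow> z0" "(\<lambda>n. e (r n)) \<longlonglongrightarrow> e0"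
    using tendsto_fst[OF l(2)] tendsto_snd[OF l(2)] by (auto simp: o_def)
  (* On bounded momenta h is bounded below, so the p n cannot stay bounded. *)
  have large: "\<forall>\<^sub>F n in sequentially. \<rho> \<le> norm (p (r n))" if "\<rho> \<ge> 0" for \<rho>
  proof -
    obtain B where B: "\<And>x p. norm p \<le> \<rho> \<Longrightarrow> \<bar>h x p\<bar> \<le> B" using hamiltonian_bounded[OF h] by metis
    have "\<forall>\<^sub>F n in sequentially. n > nat \<lceil>K * \<rho> + B\<rceil>" by (rule eventually_gt_at_top)
    then show ?thesis
    proof eventually_elim
      case (elim n)
      show ?case
      proof (rule ccontr)
        assume *: "\<not> \<rho> \<le> norm (p (r n))"
        then have "- B \<le> h (torus_proj (z (r n))) (p (r n))" using B[of "p (r n)" "torus_proj (z (r n))"] by (simp add: abs_le_iff)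
        also have "\<dots> \<le> K * norm (p (r n)) - real (r n)" using lt[of "r n"] by simp
        also have "\<dots> \<le> K * \<rho> - real n"
          using * K seq_suble[OF l(1), of n] by (intro diff_mono mult_left_mono) auto
        finally show False using elim by linarith
      qed
    qed
  qed
  obtain B where B: "\<And>x. \<bar>h x 0\<bar> \<le> B" using hamiltonian_bounded[OF h, of 0] by (metis norm_zero order_refl)
  have bound: "h (torus_proj z0) (\<rho> *\<^sub>R e0) \<le> B + \<rho> * K" if "\<rho> > 0" for \<rho>
  proof (rule tendsto_upperbound)
    have "isCont (\<lambda>(z, p). h (torus_proj z) p) (z0, \<rho> *\<^sub>R e0)"
      using hamiltonian_lift_continuous[OF h] by (simp add: continuous_on_eq_continuous_at)
    moreover have "(\<lambda>n. (z (r n), \<rho> *\<^sub>R e (r n))) \<longlonglongrightarrow> (z0, \<rho> *\<^sub>R e0)"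
      by (intro tendsto_intros ze)
    ultimately have "(\<lambda>n. (\<lambda>(z, p). h (torus_proj z) p) (z (r n), \<rho> *\<^sub>R e (r n))) \<longlonglongrightarrow> (\<lambda>(z, p). h (torus_proj z) p) (z0, \<rho> *\<^sub>R e0)"
      by (rule isCont_tendsto_compose)
    then     show "(\<lambda>n. h (torus_proj (z (r n))) (\<rho> *\<^sub>R e (r n))) \<longlonglongrightarrow> h (torus_proj z0) (\<rho> *\<^sub>R e0)"
      by simp
    show "\<forall>\<^sub>F n in sequentially. h (torus_proj (z (r n))) (\<rho> *\<^sub>R e (r n)) \<le> B + \<rho> * K"
      using large[OF less_imp_le[OF that]]
    proof eventually_elim
      case (elim n)
      (* The point of the segment from 0 to p n that lies on the sphere of radius \<rho>. *)
      define t where "t = \<rho> / norm (p (r n))"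
      have t: "0 \<le> t" "t \<le> 1" "t * norm (p (r n)) = \<rho>" using elim that by (auto simp: t_def divide_simps)
      let ?h = "h (torus_proj (z (r n)))"
      have cv: "convex_on UNIV ?h" using h by (simp add: hamiltonian_def)
      have "?h (\<rho> *\<^sub>R e (r n)) = ?h ((1 - t) *\<^sub>R 0 + t *\<^sub>R p (r n))"
        by (simp add: e_def sgn_div_norm t_def divide_inverse)
      also have "\<dots> \<le> (1 - t) * ?h 0 + t * ?h (p (r n))"
        using convex_onD[OF cv, of t 0 "p (r n)"] t by simp
      also have "\<dots> \<le> 1 * B + t * (K * norm (p (r n)))"
      proof (intro add_mono mult_left_mono)
        have "(1 - t) * ?h 0 \<le> (1 - t) * B" using B t by (intro mult_left_mono) (auto simp: abs_le_iff)
        also have "\<dots> \<le> 1 * B" using t B[of 0] by (intro mult_right_mono) auto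
        finally show "(1 - t) * ?h 0 \<le> 1 * B" .
      qed (use lt[of "r n"] t in auto)
      also have "t * (K * norm (p (r n))) = \<rho> * K" using t(3)
        by (metis mult.assoc mult.commute)
      finally show ?case by simp
    qed
  qed simp
  have "norm e0 = 1"
  proof -
    have "\<forall>\<^sub>F n in sequentially. norm (e (r n)) = 1"
      using large[OF zero_le_one] by eventually_elim (auto simp: e_def norm_sgn)
    then have "(\<lambda>n. norm (e (r n))) \<longlonglongrightarrow> 1" by (rule tendsto_eventually)
    then show ?thesis using tendsto_norm[OF ze(2)] LIMSEQ_unique by blast
  qed
  have "filterlim (\<lambda>p. h (torus_proj z0) p / norm p) at_top at_infinity"
    using h by (simp add: hamiltonian_def superlinear_def)
  then have "\<forall>\<^sub>F p in at_infinity. K + 1 \<le> h (torus_proj z0) p / norm p"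
    by (simp add: filterlim_at_top)
  then obtain b where b: "\<And>p. b \<le> norm p \<Longrightarrow> K + 1 \<le> h (torus_proj z0) p / norm p"
    unfolding eventually_at_infinity by blast
  (* Beyond radius b the slope is at least K + 1, while bound allows B + K \<rho>: impossible once \<rho> > B. *)
  define \<rho> where "\<rho> = max b 0 + B + 1"
  have "B \<ge> 0" using B[of 0] by linarith
  then have \<rho>: "\<rho> > 0" "b \<le> \<rho>" "\<rho> > B" by (auto simp: \<rho>_def)
  have "K + 1 \<le> h (torus_proj z0) (\<rho> *\<^sub>R e0) / norm (\<rho> *\<^sub>R e0)"
    by (rule b) (use \<rho> \<open>norm e0 = 1\<close> in simp)
  then have "(K + 1) * \<rho> \<le> h (torus_proj z0) (\<rho> *\<^sub>R e0)" using \<rho> \<open>norm e0 = 1\<close> by (simp add: field_simps)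
  with bound[OF \<rho>(1)] \<rho> show False by (simp add: algebra_simps)
qed

lemma lagrangian_bdd_above:
  fixes h :: "'n::finite torus \<Rightarrow> real ^ 'n \<Rightarrow> real"
  assumes "hamiltonian h"
  shows "bdd_above (range (\<lambda>p. p \<bullet> q - h x p))"
proof -
  obtain C where "\<And>x p. norm q * norm p - C \<le> h x p"
    using hamiltonian_uniformly_superlinear[OF assms, of "norm q"] by auto
  then have "p \<bullet> q - h x p \<le> C" for p
    using norm_cauchy_schwarz[of p q] by (simp add: algebra_simps) (metis add.commute add_left_mono order.trans)
  then show ?thesis by (auto intro!: bdd_aboveI)
qed

text \<open>The Fenchel inequality is the only link between \<open>H\<close> and \<open>L\<close> that enters the estimate along curves.\<close>

lemma fenchel: "hamiltonian h \<Longrightarrow> p \<bullet> q \<le> h x p + lagrangian h x q"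
  using cSUP_upper[OF UNIV_I lagrangian_bdd_above, of h p q x] by (simp add: lagrangian_def)

text \<open>For \<open>|q| < R\<close>, uniform superlinearity of rate \<open>R + 1\<close> confines the supremum to momenta in one ball,
  where \<open>H\<close> is uniformly continuous in the base point; a supremum of uniformly close functions varies little.\<close>

lemma lagrangian_lift_continuous:
  fixes h :: "'n::finite torus \<Rightarrow> real ^ 'n \<Rightarrow> real"
  assumes h: "hamiltonian h"
  shows "continuous_on UNIV (\<lambda>(z, q). lagrangian h (torus_proj z) q)"
proof -
  let ?L = "\<lambda>(z, q). lagrangian h (torus_proj z) q"
  have loc: "continuous_on (UNIV \<times> ball 0 R) ?L" for R :: real
  proof (cases "R > 0")
    case True
    obtain C where C: "\<And>x p. (R + 1) * norm p - C \<le> h x p"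
      using hamiltonian_uniformly_superlinear[OF h, of "R + 1"] True by auto
    obtain B where B: "\<And>x. \<bar>h x 0\<bar> \<le> B" using hamiltonian_bounded[OF h, of 0] by (metis norm_zero order_refl)
    (* Outside this radius a momentum does no better than p = 0. *)
    define \<rho> where "\<rho> = \<bar>C + B\<bar>"
    have far: "p \<bullet> q - h x p \<le> - h x 0" if "norm q \<le> R" "norm p \<ge> \<rho>" for p q x
    proof -
      have "p \<bullet> q \<le> R * norm p" using norm_cauchy_schwarz[of p q] mult_left_mono[OF that(1), of "norm p"]
        by (simp add: mult.commute)
      then show ?thesis using C[of p x] that(2) B[of x] by (simp add: \<rho>_def algebra_simps)
    qed
    have le: "lagrangian h x q \<le> M" if "norm q \<le> R" "\<And>p. norm p \<le> \<rho> \<Longrightarrow> p \<bullet> q - h x p \<le> M" for x q M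
      unfolding lagrangian_def
    proof (rule cSUP_least)
      fix p show "p \<bullet> q - h x p \<le> M"
      proof (cases "norm p \<le> \<rho>")
        case False
        then show ?thesis using far[OF that(1), of p x] that(2)[of 0] by (simp add: \<rho>_def)
      qed (use that in auto)
    qed simp
    have key: "lagrangian h (torus_proj z) q \<le> lagrangian h (torus_proj z') q' + (\<rho> * norm (q - q') + e)"
      if "norm q \<le> R" and "\<And>p. norm p \<le> \<rho> \<Longrightarrow> \<bar>h (torus_proj z) p - h (torus_proj z') p\<bar> < e" for z z' q q' e
    proof (rule le[OF that(1)])
      fix p :: "real ^ 'n" assume p: "norm p \<le> \<rho>"
      have "p \<bullet> q - h (torus_proj z) p \<le> p \<bullet> q' - h (torus_proj z') p + (p \<bullet> (q - q') + e)"
        using that(2)[OF p] by (simp add: inner_diff_right)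
      also have "\<dots> \<le> lagrangian h (torus_proj z') q' + (\<rho> * norm (q - q') + e)"
        using fenchel[OF h, of p q' "torus_proj z'"] norm_cauchy_schwarz[of p "q - q'"] p
          mult_right_mono[OF p, of "norm (q - q')"] by fastforce
      finally show "p \<bullet> q - h (torus_proj z) p \<le> \<dots>" .
    qed
    show ?thesis
      unfolding continuous_on_iff
    proof (intro ballI allI impI)
      fix zq :: "(real ^ 'n) \<times> (real ^ 'n)" and e :: real
      assume "zq \<in> UNIV \<times> ball 0 R" and e: "e > 0"
      then obtain z q where zq: "zq = (z, q)" and q: "q \<in> ball 0 R" by auto
      obtain d where d: "d > 0" "\<And>z z' p. p \<in> cball 0 \<rho> \<Longrightarrow> norm (z - z') < d \<Longrightarrow>
          \<bar>h (torus_proj z) p - h (torus_proj z') p\<bar> < e/2"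
        by (rule periodic_uniformly_continuous[of "cball 0 \<rho>" "\<lambda>z p. h (torus_proj z) p" "e/2"])
           (use e in \<open>auto intro!: periodic_torus continuous_on_subset[OF hamiltonian_lift_continuous[OF h]]\<close>)
      define d' where "d' = min d (e / (2 * (\<rho> + 1)))"
      have \<rho>0: "\<rho> \<ge> 0" by (simp add: \<rho>_def)
      have "\<bar>lagrangian h (torus_proj z') q' - lagrangian h (torus_proj z) q\<bar> < e"
        if q': "q' \<in> ball 0 R" and dist: "dist (z', q') (z, q) < d'" for z' q'
      proof -
        have "dist z' z < d'" "dist q' q < d'"
          using dist dist_fst_le[of "(z', q')" "(z, q)"] dist_snd_le[of "(z', q')" "(z, q)"] by auto
        then have zz: "norm (z' - z) < d" "norm (z - z') < d" and qq: "norm (q - q') < e / (2 * (\<rho> + 1))" "norm (q' - q) < e / (2 * (\<rho> + 1))"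
          by (auto simp: d'_def dist_norm norm_minus_commute)
        have "\<rho> * norm (q - q') < e/2" "\<rho> * norm (q' - q) < e/2"
        proof -
          have "\<rho> * norm (q - q') \<le> \<rho> * (e / (2 * (\<rho> + 1)))" using qq \<rho>0 by (intro mult_left_mono) auto
          also have "\<dots> < e/2" using e \<rho>0 by (simp add: field_simps)
          finally show "\<rho> * norm (q - q') < e/2" .
          then show "\<rho> * norm (q' - q) < e/2" by (simp add: norm_minus_commute)
        qed
        moreover have "lagrangian h (torus_proj z) q \<le> lagrangian h (torus_proj z') q' + (\<rho> * norm (q - q') + e/2)"
          using key[of q z z' "e/2" q'] d(2)[of _ z z'] zz q by (auto simp: less_imp_le)
        moreover have "lagrangian h (torus_proj z') q' \<le> lagrangian h (torus_proj z) q + (\<rho> * norm (q' - q) + e/2)"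
          using key[of q' z' z "e/2" q] d(2)[of _ z' z] zz q' by (auto simp: less_imp_le)
        ultimately show ?thesis by linarith
      qed
      moreover have "d' > 0" using d e \<rho>0 by (simp add: d'_def)
      ultimately show "\<exists>d>0. \<forall>x'\<in>UNIV \<times> ball 0 R. dist x' zq < d \<longrightarrow> dist (?L x') (?L zq) < e"
        by (intro exI[of _ d']) (auto simp: dist_real_def zq)
    qed
  qed (simp add: ball_empty not_less)
  have "open (UNIV \<times> ball (0::real ^ 'n) R :: ((real ^ 'n) \<times> (real ^ 'n)) set)" for R
    by (intro open_Times) auto
  then have "continuous_on (\<Union>R\<in>UNIV. UNIV \<times> ball (0::real ^ 'n) R) ?L"
    using loc by (intro continuous_on_open_UN) auto
  moreover have "(\<Union>R\<in>UNIV. UNIV \<times> ball (0::real ^ 'n) R) = (UNIV :: ((real ^ 'n) \<times> (real ^ 'n)) set)"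
    using gt_ex by auto
  ultimately show ?thesis by (simp only:)
qed

section \<open>Subsolutions along curves with a frozen index\<close>

text \<open>A smooth periodic stand-in for the squared distance: it vanishes exactly on \<open>\<int>\<^sup>N\<close>.\<close>

definition torus_penalty :: "real ^ 'n::finite \<Rightarrow> real" where
  "torus_penalty w = (\<Sum>i\<in>UNIV. 1 - cos (2 * pi * w $ i))"

definition torus_penalty_grad :: "real ^ 'n::finite \<Rightarrow> real ^ 'n" where
  "torus_penalty_grad w = (\<chi> i. 2 * pi * sin (2 * pi * w $ i))"

lemma torus_penalty_0 [simp]: "torus_penalty 0 = 0"
  by (simp add: torus_penalty_def)

lemma torus_penalty_nonneg: "torus_penalty w \<ge> 0"
  by (simp add: torus_penalty_def sum_nonneg)

lemma continuous_torus_penalty [continuous_intros]: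
  fixes f :: "'a::t2_space \<Rightarrow> real ^ 'n::finite"
  shows "continuous_on S f \<Longrightarrow> continuous_on S (\<lambda>x. torus_penalty (f x))"
  unfolding torus_penalty_def
  by (intro continuous_on_sum continuous_on_diff continuous_on_const continuous_on_cos
      continuous_on_mult continuous_on_component)

lemma continuous_torus_penalty_grad:
  "continuous_on UNIV torus_penalty_grad"
  unfolding torus_penalty_grad_def by (intro continuous_intros)

lemma trig_shift_Ints:
  fixes a b :: real
  assumes "a - b \<in> \<int>"
  shows "cos (2 * pi * a) = cos (2 * pi * b)" "sin (2 * pi * a) = sin (2 * pi * b)"
proof -
  from assms obtain n :: int where n: "a = b + of_int n"
    by (auto elim!: Ints_cases simp: algebra_simps)
  have "2 * pi * a = 2 * pi * b + 2 * pi * of_int n" by (simp add: n algebra_simps)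
  then show "cos (2 * pi * a) = cos (2 * pi * b)" "sin (2 * pi * a) = sin (2 * pi * b)"
    using sin_int_2pin[of n] cos_int_2pin[of n]
    by (simp_all add: cos_add sin_add)
qed

lemma periodic_penalty: "periodic (\<lambda>z. torus_penalty (z - y))"
  unfolding periodic_def torus_penalty_def
  by (intro allI impI sum.cong arg_cong2[where f="(-)"] trig_shift_Ints) (auto simp: algebra_simps)

lemma periodic_penalty_grad: "periodic (\<lambda>z. torus_penalty_grad (z - y))"
  unfolding periodic_def torus_penalty_grad_def vec_eq_iff
  by (auto intro!: trig_shift_Ints)

lemma torus_penalty_has_derivative:
  "(torus_penalty has_derivative (\<lambda>v. torus_penalty_grad w \<bullet> v)) (at w)"
proof -
  have "((\<lambda>w. w $ i) has_derivative (\<lambda>v. v $ i)) (at w)" for i and w :: "real ^ 'n"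
    by (rule bounded_linear.has_derivative[OF bounded_linear_vec_nth has_derivative_ident])
  then show ?thesis
    unfolding torus_penalty_def torus_penalty_grad_def inner_vec_def
    by (auto intro!: derivative_eq_intros sum.cong simp: fun_eq_iff)
qed

lemma torus_penalty_small:
  assumes "d > 0"
  shows "\<exists>m>0. \<forall>w::real ^ 'n::finite. (\<forall>i. \<bar>w $ i\<bar> \<le> 1/2) \<longrightarrow> torus_penalty w < m \<longrightarrow> norm w < d"
proof -
  define K where "K = (half_cube :: (real ^ 'n) set) \<inter> {v. d \<le> norm v}"
  have K: "compact K" unfolding K_def
    by (intro compact_Int_closed compact_half_cube closed_Collect_le continuous_intros)
  show ?thesis
  proof (cases "K = {}")
    case True
    then have "norm w < d" if "\<forall>i. \<bar>w $ i\<bar> \<le> 1/2" for w :: "real ^ 'n"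
      using that by (fastforce simp: K_def)
    then show ?thesis by (intro exI[of _ 1]) auto
  next
    case False
    from continuous_attains_inf[OF K False, of torus_penalty]
    obtain k where k: "k \<in> K" "\<And>w. w \<in> K \<Longrightarrow> torus_penalty k \<le> torus_penalty w"
      using continuous_torus_penalty[OF continuous_on_id] by blast
    have "torus_penalty k \<noteq> 0"
    proof
      assume "torus_penalty k = 0"
      then have "\<forall>i\<in>UNIV. 1 - cos (2 * pi * k $ i) = 0"
        unfolding torus_penalty_def by (subst (asm) sum_nonneg_eq_0_iff) auto
      then have c: "cos (2 * pi * k $ i) = 1" for i by auto
      have "k $ i = 0" for i
      proof -
        obtain n :: int where "2 * pi * k $ i = of_int n * 2 * pi"
          using c[of i] by (auto simp: cos_one_2pi_int)
        then have n: "k $ i = of_int n" by simp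
        moreover have "\<bar>k $ i\<bar> \<le> 1/2" using k(1) by (auto simp: K_def)
        ultimately have "\<bar>of_int n :: real\<bar> < 1" by linarith
        then have "n = 0" by linarith
        then show ?thesis using n by simp
      qed
      then have "k = 0" by (simp add: vec_eq_iff)
      then show False using k(1) assms by (simp add: K_def)
    qed
    then have "torus_penalty k > 0" using torus_penalty_nonneg[of k] by linarith
    moreover have "norm w < d" if "\<forall>i. \<bar>w $ i\<bar> \<le> 1/2" "torus_penalty w < torus_penalty k" for w :: "real ^ 'n"
    proof (rule ccontr)
      assume "\<not> norm w < d"
      then have "w \<in> K" using that(1) by (simp add: K_def)
      then show False using k(2)[of w] that(2) by simp
    qed
    ultimately show ?thesis by (intro exI[of _ "torus_penalty k"]) auto
  qed
qed

text \<open>At a maximum over \<open>{r..t}\<close> only the right derivative exists for a curve with a cadlag velocity, and this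
  one-sided inequality is exactly what is needed below.\<close>

lemma right_derivative_at_max:
  fixes f :: "real \<Rightarrow> real"
  assumes der: "(f has_real_derivative D) (at r within {r..t})" and "r < t"
    and max: "\<And>x. r \<le> x \<Longrightarrow> x \<le> t \<Longrightarrow> f x \<le> f r"
  shows "D \<le> 0"
proof (rule ccontr)
  assume "\<not> D \<le> 0"
  then obtain d where d: "d > 0" "\<And>h. h > 0 \<Longrightarrow> r + h \<in> {r..t} \<Longrightarrow> h < d \<Longrightarrow> f r < f (r + h)"
    using has_real_derivative_pos_inc_right[OF der] by auto
  define h where "h = min (d/2) (t - r)"
  have "f r < f (r + h)" by (rule d(2)) (use \<open>r < t\<close> d(1) in \<open>auto simp: h_def min_def\<close>)
  moreover have "f (r + h) \<le> f r" by (rule max) (use \<open>r < t\<close> d(1) in \<open>auto simp: h_def min_def\<close>)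
  ultimately show False by simp
qed

text \<open>For a smooth subsolution this is the chain rule followed by the Fenchel inequality. A viscosity
  subsolution is compared with the curve through a penalisation instead. Maximise
  \<open>u\<^sub>i(z) + F(r) + \<delta> r - \<phi>(z - y(r)) / \<epsilon>\<close> over \<open>z\<close> and \<open>r \<in> {s..t}\<close>, where \<open>\<phi>\<close> is the periodic penalty.
  Suppose that a maximum point \<open>(z, r)\<close> has \<open>r < t\<close>, and put \<open>p = D\<phi>(z - y(r)) / \<epsilon>\<close>. Testing in \<open>z\<close> gives
  \<open>H\<^sub>i(z, p) + \<Lambda>\<^sup>i \<cdot> u(z) \<le> \<alpha>\<close>; the right derivative in \<open>r\<close> gives \<open>F'(r) + \<delta> + p \<cdot> \<xi>(r) \<le> 0\<close>. With the Fenchel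
  inequality for the velocity \<open>-\<xi>(r)\<close> these contradict each other, since for small \<open>\<epsilon>\<close> the point \<open>z\<close> is close
  to \<open>y(r)\<close>. Hence the maximum is at \<open>r = t\<close>, and comparing it with the value at \<open>(y(s), s)\<close> is the claim.\<close>

lemma subsolution_along_curve:
  fixes H :: "'m::finite \<Rightarrow> 'n::finite torus \<Rightarrow> real ^ 'n \<Rightarrow> real"
  assumes ham: "hamiltonian (H i)" and sub: "subsolution H \<Lambda> \<alpha> u" and "s \<le> t"
    and y: "continuous_on {s..t} y" and F: "continuous_on {s..t} F"
    and dy: "\<And>r. s \<le> r \<Longrightarrow> r < t \<Longrightarrow> (y has_vector_derivative \<xi> r) (at r within {r..t})"
    and dF: "\<And>r. s \<le> r \<Longrightarrow> r < t \<Longrightarrow> (F has_real_derivative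
       (lagrangian (H i) (torus_proj (y r)) (- \<xi> r) + \<alpha> - \<Lambda> $ i \<bullet> u (torus_proj (y r)))) (at r within {r..t})"
    and R: "\<And>r. s \<le> r \<Longrightarrow> r < t \<Longrightarrow> norm (\<xi> r) \<le> R"
  shows "u (torus_proj (y s)) $ i - u (torus_proj (y t)) $ i \<le> F t - F s"
proof (rule field_le_epsilon)
  fix e :: real assume "e > 0"
  define \<delta> where "\<delta> = e / (t - s + 1)"
  have \<delta>: "\<delta> > 0" "\<delta> * (t - s + 1) = e" using \<open>e > 0\<close> \<open>s \<le> t\<close> by (auto simp: \<delta>_def)
  define v where "v z = u (torus_proj z) $ i" for z
  define g where "g z q = lagrangian (H i) (torus_proj z) q - \<Lambda> $ i \<bullet> u (torus_proj z)" for z q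
  have ucont: "continuous_on UNIV (\<lambda>z. u (torus_proj z))"
    using sub by (simp add: subsolution_def continuous_on_torus_iff)
  have vcont: "continuous_on UNIV v" unfolding v_def by (intro continuous_intros ucont)
  have vper: "periodic v" unfolding v_def by (rule periodic_torus)
  have ufst: "continuous_on UNIV (\<lambda>zq. u (torus_proj (fst zq)))"
    by (rule continuous_on_compose2[OF ucont]) (auto intro: continuous_intros)
  have gcont: "continuous_on UNIV (\<lambda>(z, q). g z q)"
    using lagrangian_lift_continuous[OF ham] ufst unfolding g_def split_beta
    by (intro continuous_intros)
  obtain d1 where d1: "d1 > 0" "\<And>z z' q. q \<in> cball 0 R \<Longrightarrow> norm (z - z') < d1 \<Longrightarrow> \<bar>g z q - g z' q\<bar> < \<delta>"
    by (rule periodic_uniformly_continuous[of "cball 0 R" g \<delta>])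
       (use continuous_on_subset[OF gcont] \<delta> in \<open>auto simp: g_def[abs_def] periodic_torus[of "\<lambda>x. lagrangian (H i) x _ - \<Lambda> $ i \<bullet> u x"]\<close>)
  have vcont2: "continuous_on (UNIV \<times> {0::real}) (\<lambda>(z, q). v z)"
    unfolding split_beta by (rule continuous_on_compose2[OF vcont]) (auto intro: continuous_intros)
  obtain d2 where d2: "d2 > 0" "\<And>z z'. norm (z - z') < d2 \<Longrightarrow> \<bar>v z - v z'\<bar> < \<delta>"
    using periodic_uniformly_continuous[OF vcont2 _ vper \<delta>(1)] by (metis compact_sing singletonI)
  obtain B where B: "B \<ge> 0" "\<And>z. \<bar>v z\<bar> \<le> B"
    using periodic_bounded[OF vcont2 _ vper] by auto
  obtain m where m: "m > 0" "\<And>w. (\<forall>i. \<bar>w $ i\<bar> \<le> 1/2) \<Longrightarrow> torus_penalty w < m \<Longrightarrow> norm (w::real^'n) < min d1 d2"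
    using torus_penalty_small[of "min d1 d2"] d1(1) d2(1) by (metis min_less_iff_conj)
  (* The penalty at a maximum is at most 2 B \<epsilon>, and below m it forces z to be close to the curve. *)
  define \<epsilon> where "\<epsilon> = m / (2 * B + 1)"
  have \<epsilon>: "\<epsilon> > 0" "2 * B * \<epsilon> < m" using m(1) B(1) by (auto simp: \<epsilon>_def field_simps)
  define \<Phi> where "\<Phi> z r = v z + F r + \<delta> * r - torus_penalty (z - y r) / \<epsilon>" for z r
  have per: "\<Phi> z r = \<Phi> z' r" if "\<And>i. (z - z') $ i \<in> \<int>" for z z' r
    using periodicD[OF vper, of z z'] periodicD[OF periodic_penalty[of "y r"], of z z'] that
    by (simp add: \<Phi>_def)
  define C where "C = (half_cube :: (real ^ 'n) set)"
  have "continuous_on (C \<times> {s..t}) (\<lambda>zr. \<Phi> (fst zr) (snd zr))"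
    unfolding \<Phi>_def
    by (intro continuous_intros continuous_on_compose2[OF vcont] continuous_on_compose2[OF F] continuous_on_compose2[OF y])
       (use \<epsilon> in auto)
  moreover have "compact (C \<times> {s..t})" unfolding C_def by (intro compact_Times compact_half_cube compact_Icc)
  moreover have "(0, s) \<in> C \<times> {s..t}" using \<open>s \<le> t\<close> by (auto simp: C_def)
  ultimately obtain zr where zr: "zr \<in> C \<times> {s..t}"
     "\<forall>a \<in> C \<times> {s..t}. \<Phi> (fst a) (snd a) \<le> \<Phi> (fst zr) (snd zr)"
    using continuous_attains_sup[of "C \<times> {s..t}" "\<lambda>zr. \<Phi> (fst zr) (snd zr)"] by blast
  obtain z0 r where [simp]: "zr = (z0, r)" by (cases zr)
  have r: "s \<le> r" "r \<le> t" using zr by auto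
  (* Replace the maximiser by its translate nearest to y r, so that a small penalty means a small distance. *)
  obtain z where z: "\<And>i. (z - z0) $ i \<in> \<int>" "\<And>i. \<bar>(z - y r) $ i\<bar> \<le> 1/2"
    using representative_near[of z0 "y r"] by blast
  have max: "\<Phi> z' r' \<le> \<Phi> z r" if "s \<le> r'" "r' \<le> t" for z' r'
  proof -
    obtain w where w: "\<And>i. (w - z') $ i \<in> \<int>" "w \<in> C"
      using representative_near[of z' 0] by (auto simp: C_def)
    have "\<Phi> w r' \<le> \<Phi> z0 r" using zr(2) w(2) that by auto
    then show ?thesis using per[of w z' r'] per[of z z0 r] w(1) z(1) by simp
  qed
  have "torus_penalty (z - y r) / \<epsilon> \<le> 2 * B"
    using max[OF r, of "y r"] B(2)[of z] B(2)[of "y r"] by (simp add: \<Phi>_def abs_le_iff)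
  then have "torus_penalty (z - y r) \<le> 2 * B * \<epsilon>" using \<epsilon>(1) by (simp add: field_simps)
  then have near: "norm (z - y r) < d1" "norm (z - y r) < d2"
    using m(2)[of "z - y r"] z(2) \<epsilon>(2) by auto
  have "r = t"
  proof (rule ccontr)
    assume "r \<noteq> t"
    then have rt: "r < t" using r by simp
    define p where "p = (1 / \<epsilon>) *\<^sub>R torus_penalty_grad (z - y r)"
    have "H i (torus_proj z) p + \<Lambda> $ i \<bullet> u (torus_proj z) \<le> \<alpha>"
      unfolding p_def
    proof (rule subsolution_test[OF sub, where \<Phi> = "\<lambda>z. torus_penalty (z - y r) / \<epsilon>"
           and G = "\<lambda>z. (1 / \<epsilon>) *\<^sub>R torus_penalty_grad (z - y r)"])
      show "periodic (\<lambda>z. torus_penalty (z - y r) / \<epsilon>)"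
        using periodic_penalty[of "y r"] unfolding periodic_def by metis
      show "periodic (\<lambda>z. (1 / \<epsilon>) *\<^sub>R torus_penalty_grad (z - y r))"
        using periodic_penalty_grad[of "y r"] unfolding periodic_def by metis
      show "continuous_on UNIV (\<lambda>z. (1 / \<epsilon>) *\<^sub>R torus_penalty_grad (z - y r))"
        by (intro continuous_intros continuous_on_compose2[OF continuous_torus_penalty_grad]) auto
      show "((\<lambda>z. torus_penalty (z - y r) / \<epsilon>) has_derivative
              (\<lambda>v. ((1 / \<epsilon>) *\<^sub>R torus_penalty_grad (w - y r)) \<bullet> v)) (at w)" for w
      proof -
        have "((\<lambda>z. torus_penalty (z - y r)) has_derivative (\<lambda>v. torus_penalty_grad (w - y r) \<bullet> v)) (at w)"
          by (rule has_derivative_compose[OF _ torus_penalty_has_derivative, of "\<lambda>z. z - y r" "\<lambda>v. v" w UNIV])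
             (auto intro!: derivative_eq_intros)
        from has_derivative_scaleR_right[OF this, of "1/\<epsilon>"] show ?thesis by (simp add: divide_inverse mult.commute)
      qed
      show "u (torus_proj w) $ i - torus_penalty (w - y r) / \<epsilon> \<le> u (torus_proj z) $ i - torus_penalty (z - y r) / \<epsilon>" for w
        using max[OF r, of w] by (simp add: \<Phi>_def v_def)
    qed
    moreover have "p \<bullet> (- \<xi> r) \<le> H i (torus_proj z) p + lagrangian (H i) (torus_proj z) (- \<xi> r)"
      by (rule fenchel[OF ham])
    ultimately have up: "- (p \<bullet> \<xi> r) \<le> g z (- \<xi> r) + \<alpha>" by (simp add: g_def)
    have "((\<lambda>x. F x + \<delta> * x - torus_penalty (z - y x) / \<epsilon>) has_real_derivative
        (lagrangian (H i) (torus_proj (y r)) (- \<xi> r) + \<alpha> - \<Lambda> $ i \<bullet> u (torus_proj (y r)) + \<delta> + p \<bullet> \<xi> r)) (at r within {r..t})"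
    proof -
      have "((\<lambda>x. z - y x) has_derivative (\<lambda>h. - (h *\<^sub>R \<xi> r))) (at r within {r..t})"
        using dy[OF r(1) rt] unfolding has_vector_derivative_def
        by (auto intro!: derivative_eq_intros)
      from has_derivative_compose[OF this torus_penalty_has_derivative]
      have "((\<lambda>x. torus_penalty (z - y x)) has_real_derivative - (torus_penalty_grad (z - y r) \<bullet> \<xi> r)) (at r within {r..t})"
        unfolding has_field_derivative_def by (rule has_derivative_eq_rhs) (simp add: fun_eq_iff mult.commute)
      then show ?thesis
        by (auto intro!: derivative_eq_intros dF[OF r(1) rt] simp: p_def divide_inverse mult.commute)
    qed
    then have "lagrangian (H i) (torus_proj (y r)) (- \<xi> r) + \<alpha> - \<Lambda> $ i \<bullet> u (torus_proj (y r)) + \<delta> + p \<bullet> \<xi> r \<le> 0"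
    proof (rule right_derivative_at_max[OF _ rt])
      fix x assume "r \<le> x" "x \<le> t"
      then show "F x + \<delta> * x - torus_penalty (z - y x) / \<epsilon> \<le> F r + \<delta> * r - torus_penalty (z - y r) / \<epsilon>"
        using max[of x z] r by (simp add: \<Phi>_def)
    qed
    then have "g (y r) (- \<xi> r) + \<alpha> + \<delta> \<le> - (p \<bullet> \<xi> r)" by (simp add: g_def)
    with up have "g (y r) (- \<xi> r) + \<delta> \<le> g z (- \<xi> r)" by simp
    moreover have "\<bar>g z (- \<xi> r) - g (y r) (- \<xi> r)\<bar> < \<delta>"
      by (rule d1(2)) (use R[OF r(1) rt] near in auto)
    ultimately show False by linarith
  qed
  have "v (y s) + F s + \<delta> * s \<le> \<Phi> z t"
    using max[of s "y s"] \<open>s \<le> t\<close> \<open>r = t\<close> by (simp add: \<Phi>_def)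
  also have "\<dots> \<le> v z + F t + \<delta> * t" using torus_penalty_nonneg[of "z - y t"] \<epsilon> by (simp add: \<Phi>_def)
  also have "v z \<le> v (y t) + \<delta>" using d2(2)[of z "y t"] near \<open>r = t\<close> by simp
  finally show "u (torus_proj (y s)) $ i - u (torus_proj (y t)) $ i \<le> F t - F s + e"
    using \<delta>(2) by (simp add: v_def algebra_simps)
qed

section \<open>Cadlag paths and adaptedness\<close>

lemma space_evaluation_algebra: "space (evaluation_algebra X T) = cadlag_paths X"
  unfolding evaluation_algebra_def by (rule space_measure_of) auto

lemma sets_evaluation_algebra: "sets (evaluation_algebra X T) =
   sigma_sets (cadlag_paths X) {(\<lambda>f. f s) -` U \<inter> cadlag_paths X | s U. s \<in> T \<and> openin X U}"
  unfolding evaluation_algebra_def by (rule sets_measure_of) auto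

lemma space_index_algebra: "space index_algebra = index_paths"
  by (simp add: index_algebra_def index_paths_def space_evaluation_algebra)

lemma space_index_filtration: "space (index_filtration t) = index_paths"
  by (simp add: index_filtration_def index_paths_def space_evaluation_algebra)

lemma subalgebra_index_filtration: "subalgebra index_algebra (index_filtration t)"
  unfolding subalgebra_def space_index_algebra space_index_filtration
  by (auto simp: index_algebra_def index_filtration_def sets_evaluation_algebra intro!: sigma_sets_mono')

lemma measurable_index_evaluation:
  assumes "s \<in> T"
  shows "(\<lambda>\<omega>. \<omega> s) \<in> measurable (evaluation_algebra (discrete_topology UNIV) T) (count_space UNIV)"
proof (rule measurableI)
  fix A :: "'a set"
  show "(\<lambda>\<omega>. \<omega> s) -` A \<inter> space (evaluation_algebra (discrete_topology UNIV) T)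
      \<in> sets (evaluation_algebra (discrete_topology UNIV) T)"
    unfolding space_evaluation_algebra sets_evaluation_algebra
    using assms by (intro sigma_sets.Basic) auto
qed simp

lemma measurable_euclidean_evaluation:
  assumes "s \<in> T"
  shows "(\<lambda>\<xi>. \<xi> s) \<in> borel_measurable (evaluation_algebra euclidean T)"
  unfolding borel_def
proof (rule measurable_measure_of)
  fix U :: "'a set" assume "U \<in> {S. open S}"
  then show "(\<lambda>\<xi>. \<xi> s) -` U \<inter> space (evaluation_algebra euclidean T) \<in> sets (evaluation_algebra euclidean T)"
    unfolding space_evaluation_algebra sets_evaluation_algebra
    using assms by (intro sigma_sets.Basic) auto
qed auto

lemma measurable_into_evaluation_algebra:
  assumes "\<And>\<omega>. \<omega> \<in> space M \<Longrightarrow> f \<omega> \<in> cadlag_paths X"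
    and "\<And>s U. s \<in> T \<Longrightarrow> openin X U \<Longrightarrow> (\<lambda>\<omega>. f \<omega> s) -` U \<inter> space M \<in> sets M"
  shows "f \<in> measurable M (evaluation_algebra X T)"
  unfolding evaluation_algebra_def
proof (rule measurable_measure_of)
  fix A assume "A \<in> {(\<lambda>f. f s) -` U \<inter> cadlag_paths X | s U. s \<in> T \<and> openin X U}"
  then obtain s U where A: "A = (\<lambda>f. f s) -` U \<inter> cadlag_paths X" "s \<in> T" "openin X U" by auto
  have "f -` A \<inter> space M = (\<lambda>\<omega>. f \<omega> s) -` U \<inter> space M" using assms(1) by (auto simp: A)
  then show "f -` A \<inter> space M \<in> sets M" using assms(2) A by simp
qed (use assms(1) in auto)

lemma limitin_discrete_iff: "limitin (discrete_topology UNIV) f l F \<longleftrightarrow> eventually (\<lambda>x. f x = l) F"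
proof
  assume "limitin (discrete_topology UNIV) f l F"
  then show "eventually (\<lambda>x. f x = l) F"
    unfolding limitin_def by (elim conjE allE[of _ "{l}"]) simp
next
  assume *: "eventually (\<lambda>x. f x = l) F"
  have "eventually (\<lambda>x. f x \<in> U) F" if "l \<in> U" for U
    using * by (rule eventually_mono) (use that in simp)
  then show "limitin (discrete_topology UNIV) f l F" by (simp add: limitin_def)
qed

lemma index_paths_iff: "\<omega> \<in> index_paths \<longleftrightarrow> \<omega> \<in> extensional {0..} \<and>
   (\<forall>t\<ge>0. \<forall>\<^sub>F s in at_right t. \<omega> s = \<omega> t) \<and> (\<forall>t>0. \<exists>l. \<forall>\<^sub>F s in at_left t. \<omega> s = l)"
  by (simp add: index_paths_def cadlag_paths_def limitin_discrete_iff)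

text \<open>Freezing a path at time \<open>t\<close> maps \<open>(\<D>, \<F>\<^sub>t)\<close> measurably into \<open>(\<D>, \<F>)\<close>. This turns the pathwise
  notion of nonanticipation into measurability with respect to \<open>\<F>\<^sub>t\<close>.\<close>

definition stopped_path :: "real \<Rightarrow> (real \<Rightarrow> 'm) \<Rightarrow> real \<Rightarrow> 'm" where
  "stopped_path t \<omega> r = (if r < 0 then undefined else \<omega> (min r t))"

lemma stopped_path_in:
  assumes "\<omega> \<in> index_paths" "t \<ge> 0"
  shows "stopped_path t \<omega> \<in> index_paths"
  unfolding index_paths_iff
proof (intro conjI allI impI)
  show "stopped_path t \<omega> \<in> extensional {0..}" by (simp add: extensional_def stopped_path_def)
next
  fix r :: real assume r: "0 \<le> r"
  show "\<forall>\<^sub>F s in at_right r. stopped_path t \<omega> s = stopped_path t \<omega> r"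
  proof (cases "r < t")
    case True
    have "\<forall>\<^sub>F s in at_right r. \<omega> s = \<omega> r" using assms(1) r by (simp add: index_paths_iff)
    moreover have "\<forall>\<^sub>F s in at_right r. s < t" using True eventually_at_right by blast
    moreover have "\<forall>\<^sub>F s in at_right r. r < s" by (simp add: eventually_at_right_less)
    ultimately show ?thesis
      by eventually_elim (use r True in \<open>auto simp: stopped_path_def min_def\<close>)
  next
    case False
    have "\<forall>\<^sub>F s in at_right r. r < s" by (simp add: eventually_at_right_less)
    then show ?thesis
      by eventually_elim (use r False in \<open>auto simp: stopped_path_def min_def\<close>)
  qed
next
  fix r :: real assume r: "0 < r"
  have pos: "\<forall>\<^sub>F s in at_left r. 0 < s" using r eventually_at_left by blast
  show "\<exists>l. \<forall>\<^sub>F s in at_left r. stopped_path t \<omega> s = l"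
  proof (cases "r \<le> t")
    case True
    obtain l where "\<forall>\<^sub>F s in at_left r. \<omega> s = l" using assms(1) r by (auto simp: index_paths_iff)
    moreover have "\<forall>\<^sub>F s in at_left r. s < r" by (simp add: eventually_at_filter)
    ultimately have "\<forall>\<^sub>F s in at_left r. stopped_path t \<omega> s = l" using pos
      by eventually_elim (use True in \<open>auto simp: stopped_path_def min_def\<close>)
    then show ?thesis by blast
  next
    case False
    then have "\<forall>\<^sub>F s in at_left r. t < s" by (intro eventually_at_leftI[of t]) auto
    then have "\<forall>\<^sub>F s in at_left r. stopped_path t \<omega> s = \<omega> t" using pos
      by eventually_elim (auto simp: stopped_path_def min_def)
    then show ?thesis by blast
  qed
qed

lemma measurable_stopped_path:
  assumes "t \<ge> 0"
  shows "stopped_path t \<in> measurable (index_filtration t) index_algebra"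
  unfolding index_algebra_def
proof (rule measurable_into_evaluation_algebra)
  fix \<omega> :: "real \<Rightarrow> 'a" assume "\<omega> \<in> space (index_filtration t)"
  then show "stopped_path t \<omega> \<in> cadlag_paths (discrete_topology UNIV)"
    using stopped_path_in[OF _ assms] by (simp add: space_index_filtration index_paths_def)
next
  fix s :: real and U :: "'a set" assume s: "s \<in> {0..}"
  have "(\<lambda>\<omega>::real\<Rightarrow>'a. \<omega> (min s t)) \<in> measurable (index_filtration t) (count_space UNIV)"
    unfolding index_filtration_def by (rule measurable_index_evaluation) (use s assms in auto)
  from measurable_sets[OF this, of U]
  show "(\<lambda>\<omega>. stopped_path t \<omega> s) -` U \<inter> space (index_filtration t) \<in> sets (index_filtration t)"
    using s by (simp add: stopped_path_def)
qed

text \<open>A functional that depends only on the path up to time \<open>t\<close> does not change when the path is stopped at \<open>t\<close>.\<close>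

lemma adapted_if_nonanticipating:
  assumes X: "X \<in> measurable index_algebra N" and "t \<ge> 0"
    and na: "\<And>\<omega>1 \<omega>2. \<omega>1 \<in> index_paths \<Longrightarrow> \<omega>2 \<in> index_paths \<Longrightarrow> (\<And>s. 0 \<le> s \<Longrightarrow> s \<le> t \<Longrightarrow> \<omega>1 s = \<omega>2 s) \<Longrightarrow> X \<omega>1 = X \<omega>2"
  shows "X \<in> measurable (index_filtration t) N"
proof -
  have "(\<lambda>\<omega>. X (stopped_path t \<omega>)) \<in> measurable (index_filtration t) N"
    by (rule measurable_compose[OF measurable_stopped_path X]) fact
  moreover have "X (stopped_path t \<omega>) = X \<omega>" if "\<omega> \<in> space (index_filtration t)" for \<omega>
    using that \<open>t \<ge> 0\<close> unfolding space_index_filtration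
    by (intro na stopped_path_in) (auto simp: stopped_path_def)
  ultimately show ?thesis by (subst measurable_cong[of _ X "\<lambda>\<omega>. X (stopped_path t \<omega>)"]) auto
qed

text \<open>A right-continuous process is the limit of its values at grid times strictly to the right of \<open>s\<close>, and
  the discretised processes are measurable because they select among countably many variables.\<close>

lemma right_continuous_jointly_measurable:
  fixes f :: "'a \<Rightarrow> real \<Rightarrow> 'b::{metric_space}"
  assumes meas: "\<And>s. s \<ge> 0 \<Longrightarrow> (\<lambda>\<omega>. f \<omega> s) \<in> borel_measurable M"
    and rc: "\<And>\<omega> s. \<omega> \<in> space M \<Longrightarrow> s \<ge> 0 \<Longrightarrow> (f \<omega> \<longlongrightarrow> f \<omega> s) (at_right s)"
  shows "(\<lambda>(\<omega>, s). f \<omega> (max 0 s)) \<in> borel_measurable (M \<Otimes>\<^sub>M borel)"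
proof -
  (* The grid time a n s = k n s / (n + 1) lies strictly to the right of max 0 s, by at most 1 / (n + 1). *)
  define k where "k n s = (\<lfloor>max 0 s * real (Suc n)\<rfloor> + 1)" for n and s :: real
  define a where "a n s = of_int (k n s) / real (Suc n)" for n s
  have meas_a: "(\<lambda>(\<omega>, s). f \<omega> (a n s)) \<in> borel_measurable (M \<Otimes>\<^sub>M borel)" for n
  proof -
    have "(\<lambda>x. (\<lambda>i x. f (fst x) (of_int \<bar>i\<bar> / real (Suc n))) (k n (snd x)) x) \<in> borel_measurable (M \<Otimes>\<^sub>M borel)"
    proof (rule measurable_compose_countable[where f = "\<lambda>i x. f (fst x) (of_int \<bar>i\<bar> / real (Suc n))"
          and g = "\<lambda>x. k n (snd x)"])
      show "(\<lambda>x. f (fst x) (of_int \<bar>i\<bar> / real (Suc n))) \<in> borel_measurable (M \<Otimes>\<^sub>M borel)" for i :: int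
        using measurable_compose[OF measurable_fst meas, of "of_int \<bar>i\<bar> / real (Suc n)" borel] by simp
      show "(\<lambda>x. k n (snd x)) \<in> measurable (M \<Otimes>\<^sub>M borel) (count_space UNIV)"
        unfolding k_def by measurable
    qed
    moreover have "\<bar>k n s\<bar> = k n s" for s by (simp add: k_def)
    ultimately show ?thesis by (simp add: a_def split_beta)
  qed
  show ?thesis
  proof (rule borel_measurable_LIMSEQ_metric[OF meas_a])
  fix x assume "x \<in> space (M \<Otimes>\<^sub>M borel :: ('a \<times> real) measure)"
  then obtain \<omega> s where x: "x = (\<omega>, s)" "\<omega> \<in> space M" by (auto simp: space_pair_measure)
  define s' where "s' = max 0 s"
  have a: "s' < a n s" "a n s \<le> s' + 1 / real (Suc n)" for n
  proof -
    have k: "s' * real (Suc n) < of_int (k n s)" "of_int (k n s) \<le> s' * real (Suc n) + 1"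
      unfolding k_def s'_def by linarith+
    show "s' < a n s" unfolding a_def by (subst pos_less_divide_eq) (use k in auto)
    have "of_int (k n s) / real (Suc n) \<le> (s' * real (Suc n) + 1) / real (Suc n)"
      by (rule divide_right_mono) (use k in auto)
    also have "\<dots> = s' + 1 / real (Suc n)" by (simp add: add_divide_distrib)
    finally show "a n s \<le> s' + 1 / real (Suc n)" by (simp add: a_def)
  qed
  have "(\<lambda>n. a n s) \<longlonglongrightarrow> s'"
  proof (rule tendsto_sandwich[of "\<lambda>n. s'" _ _ "\<lambda>n. s' + 1 / real (Suc n)"])
    show "(\<lambda>n. s' + 1 / real (Suc n)) \<longlonglongrightarrow> s'"
      using tendsto_add[OF tendsto_const LIMSEQ_inverse_real_of_nat, of s'] by (simp add: divide_inverse)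
    show "\<forall>\<^sub>F n in sequentially. s' \<le> a n s" using a(1) by (intro always_eventually allI less_imp_le)
    show "\<forall>\<^sub>F n in sequentially. a n s \<le> s' + 1 / real (Suc n)" using a(2) by (intro always_eventually allI)
  qed simp
  then have "filterlim (\<lambda>n. a n s) (at_right s') sequentially"
    using a(1) unfolding filterlim_at
    by (intro conjI always_eventually allI) (auto simp: greaterThan_iff less_imp_neq[symmetric])
  moreover have "(f \<omega> \<longlongrightarrow> f \<omega> s') (at_right s')" by (rule rc[OF x(2)]) (simp add: s'_def)
  ultimately have "(\<lambda>n. f \<omega> (a n s)) \<longlonglongrightarrow> f \<omega> s'" by (rule filterlim_compose[rotated])
  then show "(\<lambda>n. case x of (\<omega>, s) \<Rightarrow> f \<omega> (a n s)) \<longlonglongrightarrow> (case x of (\<omega>, s) \<Rightarrow> f \<omega> (max 0 s))"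
    by (simp add: x s'_def)
  qed
qed

abbreviation path_time_space :: "((real \<Rightarrow> 'm) \<times> real) measure" where
  "path_time_space \<equiv> index_algebra \<Otimes>\<^sub>M borel"

lemma index_process_jointly_measurable:
  "(\<lambda>(\<omega>, s). \<omega> (max 0 s)) \<in> measurable path_time_space (count_space (UNIV :: 'm::finite set))"
proof -
  have "(\<lambda>(\<omega>, s). if \<omega> (max 0 s) = j then 1 else 0 :: real) \<in> borel_measurable path_time_space" for j :: 'm
  proof (rule right_continuous_jointly_measurable)
    fix s :: real assume "s \<ge> 0"
    have "(\<lambda>\<omega>::real\<Rightarrow>'m. \<omega> s) \<in> measurable index_algebra (count_space UNIV)"
      unfolding index_algebra_def by (rule measurable_index_evaluation) (use \<open>s \<ge> 0\<close> in auto)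
    from measurable_compose[OF this, of "\<lambda>i. if i = j then 1 else 0 :: real"]
    show "(\<lambda>\<omega>. if \<omega> s = j then 1 else 0 :: real) \<in> borel_measurable index_algebra" by simp
  next
    fix \<omega> :: "real \<Rightarrow> 'm" and s :: real assume "\<omega> \<in> space index_algebra" "s \<ge> 0"
    then have "\<forall>\<^sub>F r in at_right s. \<omega> r = \<omega> s" by (simp add: space_index_algebra index_paths_iff)
    then show "((\<lambda>s. if \<omega> s = j then 1 else 0 :: real) \<longlongrightarrow> (if \<omega> s = j then 1 else 0)) (at_right s)"
      by (intro tendsto_eventually) (auto elim: eventually_mono)
  qed
  then have "{x \<in> space path_time_space. (case x of (\<omega>, s) \<Rightarrow> if \<omega> (max 0 s) = j then 1 else (0 :: real)) = 1}
      \<in> sets path_time_space" for j :: 'm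
    by measurable
  then have "(\<lambda>(\<omega>, s). \<omega> (max 0 s)) -` {j} \<inter> space path_time_space \<in> sets path_time_space" for j :: 'm
    by (rule back_subst[of "\<lambda>A. A \<in> sets path_time_space"]) (auto split: if_splits)
  then show ?thesis
    by (subst measurable_count_space_eq2_countable) (auto simp: countable_finite)
qed

text \<open>One-sided limits bound the path near each time, and the bisection principle makes this global. It
  ensures that the supremum in the definition of a control is a genuine one.\<close>

lemma bounded_cadlag:
  fixes \<xi> :: "real \<Rightarrow> 'b::real_normed_vector"
  assumes "\<xi> \<in> cadlag_paths euclidean"
  shows "bounded (\<xi> ` {0..T})"
proof (cases "0 \<le> T")
  case True
  define Q where "Q a b \<longleftrightarrow> bounded (\<xi> ` ({a..b} \<inter> {0..T}))" for a b
  have "Q 0 T"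
  proof (rule Bolzano[of 0 T Q])
    fix a b c assume "Q a b" "Q b c" "a \<le> b" "b \<le> c"
    then have "bounded (\<xi> ` (({a..b} \<inter> {0..T}) \<union> ({b..c} \<inter> {0..T})))"
      unfolding Q_def image_Un by simp
    then show "Q a c" unfolding Q_def by (rule bounded_subset) auto
  next
    fix x assume x: "0 \<le> x" "x \<le> T"
    have near: "\<exists>B d. d > 0 \<and> (\<forall>s. s \<in> S \<longrightarrow> s \<noteq> x \<longrightarrow> dist s x < d \<longrightarrow> norm (\<xi> s) \<le> B)"
      if "(\<xi> \<longlongrightarrow> l) (at x within S)" for l S
    proof -
      have "\<forall>\<^sub>F s in at x within S. dist (\<xi> s) l < 1" using that tendstoD zero_less_one by blast
      then obtain d where d: "d > 0" "\<And>s. s \<in> S \<Longrightarrow> s \<noteq> x \<Longrightarrow> dist s x < d \<Longrightarrow> dist (\<xi> s) l < 1"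
        unfolding eventually_at by blast
      have "norm (\<xi> s) \<le> norm l + 1" if "dist (\<xi> s) l < 1" for s
        using that norm_triangle_ineq2[of "\<xi> s" l] by (simp add: dist_norm)
      then show ?thesis using d by blast
    qed
    have "(\<xi> \<longlongrightarrow> \<xi> x) (at_right x)" using assms x by (simp add: cadlag_paths_def)
    from near[OF this] obtain B d where R: "d > 0" "\<And>s. s > x \<Longrightarrow> dist s x < d \<Longrightarrow> norm (\<xi> s) \<le> B"
      by (metis greaterThan_iff less_irrefl)
    have "\<exists>B' d'. d' > 0 \<and> (\<forall>s. 0 \<le> s \<longrightarrow> s < x \<longrightarrow> dist s x < d' \<longrightarrow> norm (\<xi> s) \<le> B')"
    proof (cases "x = 0")
      case False
      then have "x > 0" using x by simp
      then obtain l where "(\<xi> \<longlongrightarrow> l) (at_left x)"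
        using assms unfolding cadlag_paths_def limitin_canonical_iff by blast
      from near[OF this] show ?thesis by (metis lessThan_iff less_irrefl)
    qed (auto intro: exI[of _ 1])
    then obtain B' d' where L: "d' > 0" "\<And>s. 0 \<le> s \<Longrightarrow> s < x \<Longrightarrow> dist s x < d' \<Longrightarrow> norm (\<xi> s) \<le> B'"
      by blast
    show "\<exists>d>0. \<forall>a b. a \<le> x \<and> x \<le> b \<and> b - a < d \<longrightarrow> Q a b"
    proof (intro exI[of _ "min d d'"] conjI allI impI)
      fix a b assume ab: "a \<le> x \<and> x \<le> b \<and> b - a < min d d'"
      have "norm (\<xi> s) \<le> max (norm (\<xi> x)) (max B B')" if "s \<in> {a..b} \<inter> {0..T}" for s
      proof -
        consider "s = x" | "s > x" | "s < x" by linarith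
        then show ?thesis
        proof cases
          case 2 then have "norm (\<xi> s) \<le> B" using that ab by (intro R) (auto simp: dist_real_def)
          then show ?thesis by simp
        next
          case 3 then have "norm (\<xi> s) \<le> B'" using that ab by (intro L) (auto simp: dist_real_def)
          then show ?thesis by simp
        qed simp
      qed
      then show "Q a b" unfolding Q_def by (intro boundedI[of _ "max (norm (\<xi> x)) (max B B')"]) blast
    qed (use R L in auto)
  qed (use True in auto)
  then show ?thesis by (simp add: Q_def)
qed simp

section \<open>Transition probabilities and the Markov property\<close>

lemma matrix_power_entry_bound:
  fixes A :: "real ^ 'm::finite ^ 'm"
  shows "\<bar>(((**) A ^^ k) (mat 1)) $ i $ j\<bar> \<le> (\<Sum>i\<in>UNIV. \<Sum>j\<in>UNIV. \<bar>A $ i $ j\<bar>) ^ k"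
proof (induction k arbitrary: i j)
  case 0
  then show ?case by (simp add: mat_def)
next
  case (Suc k)
  let ?c = "\<Sum>i\<in>UNIV. \<Sum>j\<in>UNIV. \<bar>A $ i $ j\<bar>"
  have c: "0 \<le> ?c" by (intro sum_nonneg) auto
  have "\<bar>(((**) A ^^ Suc k) (mat 1)) $ i $ j\<bar> = \<bar>\<Sum>l\<in>UNIV. A $ i $ l * (((**) A ^^ k) (mat 1)) $ l $ j\<bar>"
    by (simp add: matrix_matrix_mult_def)
  also have "\<dots> \<le> (\<Sum>l\<in>UNIV. \<bar>A $ i $ l\<bar> * ?c ^ k)"
    by (rule order.trans[OF sum_abs]) (auto simp: abs_mult intro!: sum_mono mult_left_mono Suc.IH)
  also have "\<dots> = (\<Sum>l\<in>UNIV. \<bar>A $ i $ l\<bar>) * ?c ^ k" by (simp add: sum_distrib_right)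
  also have "\<dots> \<le> ?c * ?c ^ k"
    using c by (intro mult_right_mono member_le_sum[of i UNIV "\<lambda>i. \<Sum>j\<in>UNIV. \<bar>A $ i $ j\<bar>"]) (auto intro: sum_nonneg)
  finally show ?case by simp
qed

lemma matrix_exp_entry:
  fixes A :: "real ^ 'm::finite ^ 'm"
  shows "(\<lambda>k. (1 / fact k) * (((**) A ^^ k) (mat 1)) $ i $ j) sums (matrix_exp A $ i $ j)"
proof -
  let ?c = "\<Sum>i\<in>UNIV. \<Sum>j\<in>UNIV. \<bar>A $ i $ j\<bar>"
  let ?f = "\<lambda>i j k. (1 / fact k) * (((**) A ^^ k) (mat 1)) $ i $ j"
  have summ: "summable (?f i j)" for i j
  proof (rule summable_comparison_test)
    show "summable (\<lambda>k. inverse (fact k) * ?c ^ k)" by (rule summable_exp)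
    show "\<exists>N. \<forall>k\<ge>N. norm (?f i j k) \<le> inverse (fact k) * ?c ^ k"
      using matrix_power_entry_bound[where A = A and i = i and j = j]
      by (intro exI[of _ 0] allI impI) (auto simp: abs_mult divide_inverse intro!: mult_left_mono)
  qed
  define E where "E = (\<chi> i j. suminf (?f i j))"
  have "(\<lambda>k. (1 / fact k) *\<^sub>R (((**) A ^^ k) (mat 1))) sums E"
    unfolding sums_def
    by (intro vec_tendstoI) (use summable_sums[OF summ] in \<open>simp add: sums_def E_def\<close>)
  then have "matrix_exp A = E" unfolding matrix_exp_def by (rule sums_unique[symmetric])
  then show ?thesis using summable_sums[OF summ, of i j] by (simp add: E_def)
qed

text \<open>The remainder is dominated by that of the scalar exponential of the sum of the absolute entries, which is at
  most the square of this sum as long as the sum is at most \<open>1\<close>.\<close>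

lemma matrix_exp_expansion:
  fixes A :: "real ^ 'm::finite ^ 'm"
  assumes "(\<Sum>i\<in>UNIV. \<Sum>j\<in>UNIV. \<bar>A $ i $ j\<bar>) \<le> 1"
  shows "\<bar>matrix_exp A $ i $ j - mat 1 $ i $ j - A $ i $ j\<bar> \<le> (\<Sum>i\<in>UNIV. \<Sum>j\<in>UNIV. \<bar>A $ i $ j\<bar>)\<^sup>2"
proof -
  let ?c = "\<Sum>i\<in>UNIV. \<Sum>j\<in>UNIV. \<bar>A $ i $ j\<bar>"
  let ?f = "\<lambda>k. (1 / fact k) * (((**) A ^^ k) (mat 1)) $ i $ j"
  have "(\<lambda>k. ?f (k + 2)) sums (matrix_exp A $ i $ j - sum ?f {..<2})"
    by (rule sums_split_initial_segment[OF matrix_exp_entry])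
  moreover have "sum ?f {..<2} = mat 1 $ i $ j + A $ i $ j"
    by (simp add: numeral_2_eq_2 matrix_mul_rid)
  ultimately have f: "(\<lambda>k. ?f (k + 2)) sums (matrix_exp A $ i $ j - mat 1 $ i $ j - A $ i $ j)"
    by (simp add: algebra_simps)
  have "(\<lambda>k. ?c ^ k /\<^sub>R fact k) sums exp ?c" by (rule exp_converges)
  from sums_split_initial_segment[OF this, of 2]
  have g: "(\<lambda>k. ?c ^ (k + 2) /\<^sub>R fact (k + 2)) sums (exp ?c - 1 - ?c)"
    by (simp add: numeral_2_eq_2 algebra_simps)
  have "norm (?f (k + 2)) \<le> ?c ^ (k + 2) /\<^sub>R fact (k + 2)" for k
    using matrix_power_entry_bound[where A = A and k = "k + 2" and i = i and j = j]
    by (auto simp: abs_mult divide_inverse simp del: fact_Suc funpow.simps power_Suc intro!: mult_left_mono)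
  then have "\<bar>matrix_exp A $ i $ j - mat 1 $ i $ j - A $ i $ j\<bar> \<le> exp ?c - 1 - ?c"
    using norm_suminf_le[of "\<lambda>k. ?f (k + 2)", OF _ sums_summable[OF g]] f g
    by (simp add: sums_iff)
  also have "\<dots> \<le> ?c\<^sup>2"
    using exp_bound[of ?c] assms by (simp add: sum_nonneg)
  finally show ?thesis .
qed

definition cylinder :: "real set \<Rightarrow> (real \<Rightarrow> 'm) \<Rightarrow> (real \<Rightarrow> 'm) set" where
  "cylinder F g = {\<omega> \<in> index_paths. \<forall>r\<in>F. \<omega> r = g r}"

text \<open>The empty set is the intersection of two cylinders with incompatible prescriptions.\<close>

definition cylinders :: "real set \<Rightarrow> (real \<Rightarrow> 'm) set set" where
  "cylinders T = insert {} {cylinder F g | F g. finite F \<and> F \<subseteq> T}"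

lemma Int_stable_cylinders: "Int_stable (cylinders T)"
proof (rule Int_stableI)
  fix A B :: "(real \<Rightarrow> 'a) set" assume "A \<in> cylinders T" "B \<in> cylinders T"
  then consider "A = {} \<or> B = {}" | F g F' g' where "A = cylinder F g" "B = cylinder F' g'"
      "finite F" "F \<subseteq> T" "finite F'" "F' \<subseteq> T"
    by (auto simp: cylinders_def)
  then show "A \<inter> B \<in> cylinders T"
  proof cases
    case 2
    show ?thesis
    proof (cases "\<exists>r\<in>F \<inter> F'. g r \<noteq> g' r")
      case True
      then have "A \<inter> B = {}" by (auto simp: 2 cylinder_def)
      then show ?thesis by (simp add: cylinders_def)
    next
      case False
      then have "A \<inter> B = cylinder (F \<union> F') (\<lambda>r. if r \<in> F then g r else g' r)"
        by (auto simp: 2 cylinder_def)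
      then show ?thesis unfolding cylinders_def using 2 by blast
    qed
  qed (auto simp: cylinders_def)
qed

lemma sets_evaluation_subset_cylinders:
  "sets (evaluation_algebra (discrete_topology (UNIV :: 'm::finite set)) T) \<subseteq> sigma_sets index_paths (cylinders T)"
  unfolding sets_evaluation_algebra index_paths_def[symmetric]
proof (rule sigma_sets_mono, safe)
  fix s and U :: "'m set" assume s: "s \<in> T"
  interpret sigma_algebra index_paths "sigma_sets index_paths (cylinders T :: (real \<Rightarrow> 'm) set set)"
    by (rule sigma_algebra_sigma_sets) (auto simp: cylinders_def cylinder_def)
  have "(\<lambda>f. f s) -` U \<inter> index_paths = (\<Union>j\<in>U. cylinder {s} (\<lambda>_. j))"
    by (auto simp: cylinder_def)
  moreover have "cylinder {s} (\<lambda>_. j) \<in> sigma_sets index_paths (cylinders T)" for j :: 'm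
    using s by (intro sigma_sets.Basic) (auto simp: cylinders_def)
  then have "(\<Union>j\<in>U. cylinder {s} (\<lambda>_. j)) \<in> sigma_sets index_paths (cylinders T)"
    by (intro finite_UN) auto
  ultimately show "(\<lambda>f. f s) -` U \<inter> index_paths \<in> sigma_sets index_paths (cylinders T :: (real \<Rightarrow> 'm) set set)" by simp
qed

lemma cylinders_in_evaluation:
  assumes "A \<in> cylinders T"
  shows "A \<in> sets (evaluation_algebra (discrete_topology (UNIV :: 'm set)) T)"
proof -
  let ?E = "evaluation_algebra (discrete_topology (UNIV :: 'm set)) T"
  have "cylinder F g \<in> sets ?E" if "finite F" "F \<subseteq> T" for F and g :: "real \<Rightarrow> 'm"
  proof -
    have sp: "space ?E = index_paths" by (simp add: space_evaluation_algebra index_paths_def)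
    have "{\<omega> \<in> space ?E. \<omega> r = g r} \<in> sets ?E" if "r \<in> F" for r
      using measurable_sets[OF measurable_index_evaluation[of r T], of "{g r}"] that \<open>F \<subseteq> T\<close>
      by (auto simp: vimage_def Int_def conj_commute)
    then have "{\<omega> \<in> space ?E. \<forall>r\<in>F. \<omega> r = g r} \<in> sets ?E"
      using \<open>finite F\<close> by (intro sets.sets_Collect_finite_All) auto
    then show ?thesis by (simp add: cylinder_def sp)
  qed
  then show ?thesis using assms by (auto simp: cylinders_def)
qed

text \<open>Two instances are used: \<open>d = 0\<close> for the Markov property, and \<open>c + d = 1\<close> for mixtures of initial laws.\<close>

lemma pi_system_uniqueness:
  assumes fin: "finite_measure P" "finite_measure Q" "finite_measure R"
    and sets: "sets Q = sets P" "sets R = sets P"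
    and G: "Int_stable G" "G \<subseteq> Pow (space P)" "G \<subseteq> sets P"
    and BCD: "B \<in> sets P" "C \<in> sets P" "D \<in> sets P"
    and eq: "\<And>A. A \<in> insert (space P) G \<Longrightarrow> measure P (A \<inter> B) = c * measure Q (A \<inter> C) + d * measure R (A \<inter> D)"
    and A: "A \<in> sigma_sets (space P) G"
  shows "measure P (A \<inter> B) = c * measure Q (A \<inter> C) + d * measure R (A \<inter> D)"
proof -
  interpret P: finite_measure P by fact
  interpret Q: finite_measure Q by fact
  interpret R: finite_measure R by fact
  have sub: "A \<in> sets P" if "A \<in> sigma_sets (space P) G" for A
    using that sets.sigma_sets_subset[OF G(3)] by blast
  show ?thesis
    using G(1,2) A
  proof (induction rule: sigma_sets_induct_disjoint)
    case (compl A)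
    have A: "A \<in> sets P" using sub compl by blast
    have m: "measure M ((space P - A) \<inter> B) = measure M (space P \<inter> B) - measure M (A \<inter> B)"
      if "finite_measure M" "sets M = sets P" "B \<in> sets P" for M B
    proof -
      interpret M: finite_measure M by fact
      have "(space P - A) \<inter> B = (space P \<inter> B) - (A \<inter> B)" by blast
      moreover have "measure M ((space P \<inter> B) - (A \<inter> B)) = measure M (space P \<inter> B) - measure M (A \<inter> B)"
        by (rule M.finite_measure_Diff) (use that A sets.sets_into_space[OF A] in auto)
      ultimately show ?thesis by simp
    qed
    show ?case
      using eq[of "space P"] compl.IH
      unfolding m[OF fin(1) refl BCD(1)] m[OF fin(2) sets(1) BCD(2)] m[OF fin(3) sets(2) BCD(3)]
      by (simp add: right_diff_distrib)
  next
    case (union A)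
    have A: "A i \<in> sets P" for i using sub union(2) by blast
    have s: "(\<lambda>i. measure M (A i \<inter> B)) sums measure M (\<Union> (range A) \<inter> B)"
      if "finite_measure M" "sets M = sets P" "B \<in> sets P" for M B
    proof -
      interpret M: finite_measure M by fact
      have "(\<lambda>i. measure M (A i \<inter> B)) sums measure M (\<Union>i. A i \<inter> B)"
        by (rule M.finite_measure_UNION)
           (use that A in \<open>auto intro!: disjoint_family_subset[OF union(1)]\<close>)
      then show ?thesis by simp
    qed
    have "(\<lambda>i. c * measure Q (A i \<inter> C) + d * measure R (A i \<inter> D)) sums
        (c * measure Q (\<Union> (range A) \<inter> C) + d * measure R (\<Union> (range A) \<inter> D))"
      by (intro sums_add sums_mult s fin sets BCD)
    then show ?case
      using s[OF fin(1) refl BCD(1)] union.IH sums_unique2 by fastforce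
  qed (use eq in auto)
qed

lemma path_law_sets:
  assumes "is_path_law \<Lambda> a P"
  shows "prob_space P" "sets P = sets index_algebra" "space P = index_paths"
  using assms sets_eq_imp_space_eq[of P index_algebra] by (auto simp: is_path_law_def space_index_algebra)

lemma path_law_times:
  assumes "is_path_law \<Lambda> a P" "0 \<le> t 0" "\<And>l. l < k \<Longrightarrow> t l < t (Suc l)"
  shows "measure P {\<omega> \<in> index_paths. \<forall>l\<le>k. \<omega> (t l) = j l} =
          (a v* matrix_exp (- t 0 *\<^sub>R \<Lambda>)) $ j 0 *
          (\<Prod>l<k. matrix_exp (- (t (Suc l) - t l) *\<^sub>R \<Lambda>) $ j l $ j (Suc l))"
  using assms unfolding is_path_law_def by blast

text \<open>Converts a finite set of times into the increasing sequence required by the finite-dimensional laws.\<close>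

lemma finite_set_enumeration:
  fixes F :: "real set"
  assumes "finite F" "F \<noteq> {}"
  obtains k t where "F = t ` {..k::nat}" "\<And>l. l < k \<Longrightarrow> t l < t (Suc l)" "t k = Max F" "t 0 = Min F"
proof -
  define xs where "xs = sorted_list_of_set F"
  have xs: "sorted_wrt (<) xs" "set xs = F" "xs \<noteq> []"
    using assms by (auto simp: xs_def)
  define k where "k = length xs - 1"
  have k: "length xs = Suc k" using xs(3) by (cases xs) (auto simp: k_def)
  have F: "F = (\<lambda>l. xs ! l) ` {..k}"
    using xs(2) k by (auto simp: set_conv_nth less_Suc_eq_le)
  have lt: "xs ! l < xs ! l'" if "l < l'" "l' \<le> k" for l l'
    using sorted_wrt_nth_less[OF xs(1)] that k by simp
  have "xs ! k = Max F"
  proof (rule Max_eqI[symmetric])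
    fix y assume "y \<in> F" then obtain l where "l \<le> k" "y = xs ! l" using F by auto
    then show "y \<le> xs ! k" using lt[of l k] by (cases "l = k") auto
  qed (use F assms in auto)
  moreover have "xs ! 0 = Min F"
  proof (rule Min_eqI[symmetric])
    fix y assume "y \<in> F" then obtain l where "l \<le> k" "y = xs ! l" using F by auto
    then show "xs ! 0 \<le> y" using lt[of 0 l] by (cases "l = 0") auto
  qed (use F assms in auto)
  ultimately show ?thesis using that[of "\<lambda>l. xs ! l" k] F lt by simp
qed

text \<open>Appending one later time multiplies the product formula by one transition factor. The prescribed
  times have to contain \<open>s\<close> as their last element, which fixes the state from which the transition starts.\<close>

lemma path_law_cylinder_extend:
  assumes law: "is_path_law \<Lambda> a P" and F: "finite F" "F \<subseteq> {0..s}" "s \<in> F" and "s < t"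
  shows "measure P (cylinder F g \<inter> {\<omega> \<in> index_paths. \<omega> t = j}) =
    matrix_exp (- (t - s) *\<^sub>R \<Lambda>) $ g s $ j * measure P (cylinder F g)"
proof -
  have "F \<noteq> {}" using F by auto
  from finite_set_enumeration[OF F(1) this] obtain k T
    where T: "F = T ` {..k::nat}" "\<And>l. l < k \<Longrightarrow> T l < T (Suc l)" "T k = Max F" "T 0 = Min F" by blast
  have "Max F = s" by (rule Max_eqI) (use F in auto)
  have T0: "0 \<le> T 0" using T(4) Min_in[OF F(1) \<open>F \<noteq> {}\<close>] F(2) by auto
  define T' where "T' l = (if l \<le> k then T l else t)" for l
  define J where "J l = (if l \<le> k then g (T l) else j)" for l
  have "cylinder F g = {\<omega> \<in> index_paths. \<forall>l\<le>k. \<omega> (T l) = g (T l)}"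
    unfolding cylinder_def T(1) by auto
  then have 1: "measure P (cylinder F g) = (a v* matrix_exp (- T 0 *\<^sub>R \<Lambda>)) $ g (T 0) *
          (\<Prod>l<k. matrix_exp (- (T (Suc l) - T l) *\<^sub>R \<Lambda>) $ g (T l) $ g (T (Suc l)))"
    using path_law_times[OF law T0 T(2), of k "\<lambda>l. g (T l)"] by simp
  have "cylinder F g \<inter> {\<omega> \<in> index_paths. \<omega> t = j} = {\<omega> \<in> index_paths. \<forall>l\<le>Suc k. \<omega> (T' l) = J l}"
    unfolding cylinder_def T(1) T'_def J_def by (auto simp: le_Suc_eq)
  moreover have "measure P {\<omega> \<in> index_paths. \<forall>l\<le>Suc k. \<omega> (T' l) = J l} =
     (a v* matrix_exp (- T' 0 *\<^sub>R \<Lambda>)) $ J 0 *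
          (\<Prod>l<Suc k. matrix_exp (- (T' (Suc l) - T' l) *\<^sub>R \<Lambda>) $ J l $ J (Suc l))"
  proof (rule path_law_times[OF law])
    fix l assume "l < Suc k"
    then show "T' l < T' (Suc l)"
      using T(2)[of l] \<open>s < t\<close> \<open>Max F = s\<close> T(3) by (cases "l = k") (auto simp: T'_def)
  qed (simp add: T'_def T0)
  moreover have "(\<Prod>l<k. matrix_exp (- (T' (Suc l) - T' l) *\<^sub>R \<Lambda>) $ J l $ J (Suc l)) =
       (\<Prod>l<k. matrix_exp (- (T (Suc l) - T l) *\<^sub>R \<Lambda>) $ g (T l) $ g (T (Suc l)))"
    by (intro prod.cong) (auto simp: T'_def J_def)
  ultimately show ?thesis
    using 1 T(3) \<open>Max F = s\<close> by (simp add: T'_def J_def)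
qed

text \<open>The Markov property on events of the past. On cylinders it is the product formula, after adding the
  time \<open>s\<close> to the prescribed ones or noticing that both sides vanish; both sides are measures in \<open>A\<close>.\<close>

lemma path_law_markov_sets:
  assumes law: "is_path_law \<Lambda> a P" and "0 \<le> s" "s < t" and A: "A \<in> sets (index_filtration s)"
  shows "measure P (A \<inter> {\<omega> \<in> index_paths. \<omega> s = i \<and> \<omega> t = j}) =
    matrix_exp (- (t - s) *\<^sub>R \<Lambda>) $ i $ (j::'m::finite) * measure P (A \<inter> {\<omega> \<in> index_paths. \<omega> s = i})"
proof -
  note P = path_law_sets[OF law]
  interpret prob_space P by (rule P)
  have ev: "cylinder F g \<in> sets P" if "finite F" "F \<subseteq> {0..}" for F and g :: "real \<Rightarrow> 'm"
    unfolding P(2) index_algebra_def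
    by (rule cylinders_in_evaluation) (use that in \<open>auto simp: cylinders_def\<close>)
  let ?B = "{\<omega> \<in> index_paths. \<omega> s = i \<and> \<omega> t = j}" and ?C = "{\<omega> \<in> index_paths. \<omega> s = i}"
  have C: "?C = cylinder {s} (\<lambda>_. i)" by (auto simp: cylinder_def)
  have B: "?B = cylinder {s} (\<lambda>_. i) \<inter> cylinder {t} (\<lambda>_. j)" by (auto simp: cylinder_def)
  have "measure P (A \<inter> ?B) = matrix_exp (- (t - s) *\<^sub>R \<Lambda>) $ i $ j * measure P (A \<inter> ?C) + 0 * measure P (A \<inter> ?C)"
  proof (rule pi_system_uniqueness[of P P P "cylinders {0..s}"])
    show "finite_measure P" "finite_measure P" "finite_measure P" by unfold_locales
    show "cylinders {0..s} \<subseteq> Pow (space P)" by (auto simp: cylinders_def cylinder_def P)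
    show "cylinders {0..s} \<subseteq> sets P" using ev by (force simp: cylinders_def)
    show "?B \<in> sets P" "?C \<in> sets P" "?C \<in> sets P" unfolding B C using assms by (auto intro!: ev sets.Int)
    show "A \<in> sigma_sets (space P) (cylinders {0..s})"
      using A sets_evaluation_subset_cylinders unfolding index_filtration_def P(3) by blast
  next
    fix A :: "(real \<Rightarrow> 'm) set" assume "A \<in> insert (space P) (cylinders {0..s})"
    moreover have "space P = cylinder {} (\<lambda>_. undefined)" by (simp add: cylinder_def P)
    ultimately consider "A = {}" | F g where "A = cylinder F g" "finite F" "F \<subseteq> {0..s}"
      unfolding cylinders_def by blast
    then show "measure P (A \<inter> ?B) = matrix_exp (- (t - s) *\<^sub>R \<Lambda>) $ i $ j * measure P (A \<inter> ?C) + 0 * measure P (A \<inter> ?C)"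
    proof cases
      case 2
      show ?thesis
      proof (cases "s \<in> F \<and> g s \<noteq> i")
        case True
        then have "A \<inter> ?B = {}" "A \<inter> ?C = {}" by (auto simp: 2 cylinder_def)
        then show ?thesis by simp
      next
        case False
        have "(\<forall>r\<in>F. \<omega> r = g r) \<and> \<omega> s = i \<longleftrightarrow> (\<forall>r\<in>insert s F. \<omega> r = (g(s := i)) r)" for \<omega>
        proof (cases "s \<in> F")
          case True
          then have "g(s := i) = g" using False by auto
          then show ?thesis using True False by auto
        qed auto
        then have "A \<inter> ?C = cylinder (insert s F) (g(s := i))"
          unfolding 2 cylinder_def by blast
        moreover from this have "A \<inter> ?B = cylinder (insert s F) (g(s := i)) \<inter> {\<omega> \<in> index_paths. \<omega> t = j}"
          by blast
        ultimately show ?thesis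
          using path_law_cylinder_extend[OF law, of "insert s F" s t "g(s := i)" j] 2 assms by simp
      qed
    qed simp
  qed (simp_all add: Int_stable_cylinders)
  then show ?thesis by simp
qed

text \<open>The finite-dimensional laws are linear in the initial distribution.\<close>

lemma path_law_mixture:
  assumes laws: "\<And>b. b \<in> prob_vectors \<Longrightarrow> is_path_law \<Lambda> b (P b)"
    and ab: "a \<in> prob_vectors" "a' \<in> prob_vectors" and c: "0 \<le> c" "0 \<le> d" "c + d = 1"
    and A: "A \<in> sets index_algebra"
  shows "measure (P (c *\<^sub>R a + d *\<^sub>R a')) A = c * measure (P a) A + d * measure (P (a' :: real ^ 'm::finite)) A"
proof -
  define b where "b = c *\<^sub>R a + d *\<^sub>R a'"
  have b: "b \<in> prob_vectors"
    using ab c by (auto simp: b_def prob_vectors_def sum.distrib sum_distrib_left[symmetric])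
  note L = path_law_sets[OF laws[OF b]] path_law_sets[OF laws[OF ab(1)]] path_law_sets[OF laws[OF ab(2)]]
  interpret b: prob_space "P b" by (rule L)
  interpret a: prob_space "P a" by (rule L)
  interpret a': prob_space "P a'" by (rule L)
  have "measure (P b) (A \<inter> index_paths) = c * measure (P a) (A \<inter> index_paths) + d * measure (P a') (A \<inter> index_paths)"
  proof (rule pi_system_uniqueness[of _ _ _ "cylinders {0..}"])
    show "finite_measure (P b)" "finite_measure (P a)" "finite_measure (P a')" by unfold_locales
    show "cylinders {0..} \<subseteq> Pow (space (P b))" by (auto simp: cylinders_def cylinder_def L)
    show "cylinders {0..} \<subseteq> sets (P b)"
      using cylinders_in_evaluation by (auto simp: L index_algebra_def)
    show "index_paths \<in> sets (P b)" "index_paths \<in> sets (P b)" "index_paths \<in> sets (P b)"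
      using sets.top[of "P b"] by (simp_all add: L)
    show "A \<in> sigma_sets (space (P b)) (cylinders {0..})"
      using A sets_evaluation_subset_cylinders unfolding index_algebra_def L by blast
  next
    fix A :: "(real \<Rightarrow> 'm) set" assume A: "A \<in> insert (space (P b)) (cylinders {0..})"
    have space: "cylinder {} g = space (P b)" for g :: "real \<Rightarrow> 'm" by (simp add: cylinder_def L)
    have one: "measure (P b) index_paths = 1" "measure (P a) index_paths = 1" "measure (P a') index_paths = 1"
      using b.prob_space a.prob_space a'.prob_space by (simp_all add: L)
    from A consider "A = {}" | "A = index_paths" | F g where "A = cylinder F g" "finite F" "F \<subseteq> {0..}" "F \<noteq> {}"
      unfolding cylinders_def using space by (auto simp: L) blast
    then show "measure (P b) (A \<inter> index_paths) = c * measure (P a) (A \<inter> index_paths) + d * measure (P a') (A \<inter> index_paths)"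
    proof cases
      case 3
      from finite_set_enumeration[OF 3(2,4)] obtain k T
        where T: "F = T ` {..k::nat}" "\<And>l. l < k \<Longrightarrow> T l < T (Suc l)" "T 0 = Min F" by metis
      have T0: "0 \<le> T 0" using T(3) Min_in[OF 3(2,4)] 3(3) by auto
      have A: "A \<inter> index_paths = {\<omega> \<in> index_paths. \<forall>l\<le>k. \<omega> (T l) = g (T l)}"
        unfolding cylinder_def T(1) 3(1) by auto
      have lin: "(b v* M) $ j = c * (a v* M) $ j + d * (a' v* M) $ j" for M :: "real ^ 'm ^ 'm" and j
        by (simp add: b_def vector_matrix_mult_def sum.distrib sum_distrib_left algebra_simps)
      show ?thesis
        unfolding A using path_law_times[OF laws[OF b] T0 T(2), of k "\<lambda>l. g (T l)"]
          path_law_times[OF laws[OF ab(1)] T0 T(2), of k "\<lambda>l. g (T l)"]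
          path_law_times[OF laws[OF ab(2)] T0 T(2), of k "\<lambda>l. g (T l)"]
        by (simp add: lin algebra_simps)
    qed (use one c in auto)
  qed (simp_all add: Int_stable_cylinders L)
  moreover have "A \<inter> index_paths = A" using sets.sets_into_space[OF A] by (auto simp: space_index_algebra)
  ultimately show ?thesis by (simp add: b_def)
qed

text \<open>If \<open>b\<close> is strictly positive, then \<open>b = c a + (1 - c) a'\<close> for a small \<open>c > 0\<close> and a probability vector \<open>a'\<close>, so
  that \<open>c \<P>\<^sub>a \<le> \<P>\<^sub>b\<close>.\<close>

lemma path_law_AE_transfer:
  assumes laws: "\<And>b. b \<in> prob_vectors \<Longrightarrow> is_path_law \<Lambda> b (P b)"
    and a: "a \<in> prob_vectors" and b: "b \<in> prob_vectors" "\<And>i. 0 < b $ (i::'m::finite)"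
    and ae: "AE \<omega> in P b. Q \<omega>"
  shows "AE \<omega> in P a. Q \<omega>"
proof -
  define c where "c = Min (range (\<lambda>i. b $ i)) / 2"
  have c: "0 < c" "\<And>i. 2 * c \<le> b $ i" using b(2) by (auto simp: c_def)
  have b1: "b $ i \<le> 1" for i
    using b(1) member_le_sum[of i UNIV "\<lambda>i. b $ i"] by (auto simp: prob_vectors_def)
  have c1: "c < 1" using b1[of undefined] c(2)[of undefined] c(1) by linarith
  define a' where "a' = (1 / (1 - c)) *\<^sub>R (b - c *\<^sub>R a)"
  have a1: "a $ i \<le> 1" for i
    using a member_le_sum[of i UNIV "\<lambda>i. a $ i"] by (auto simp: prob_vectors_def)
  have "c * a $ i \<le> b $ i" for i
    using c(2)[of i] mult_left_mono[OF a1, of c i] c(1) by linarith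
  then have a': "a' \<in> prob_vectors"
    using a b(1) c1 by (auto simp: a'_def prob_vectors_def sum_subtractf sum_distrib_left[symmetric] sum_divide_distrib[symmetric] right_diff_distrib[symmetric])
  have beq: "b = c *\<^sub>R a + (1 - c) *\<^sub>R a'" using c1 by (simp add: a'_def)
  note L = path_law_sets[OF laws[OF b(1)]] path_law_sets[OF laws[OF a]]
  interpret b: prob_space "P b" by (rule L)
  interpret a: prob_space "P a" by (rule L)
  obtain N where N: "{\<omega> \<in> space (P b). \<not> Q \<omega>} \<subseteq> N" "emeasure (P b) N = 0" "N \<in> sets (P b)"
    by (rule AE_E[OF ae])
  have "measure (P b) N = c * measure (P a) N + (1 - c) * measure (P a') N"
    using path_law_mixture[OF laws a a', of c "1 - c" N] c(1) c1 N(3) L(2) beq by simp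
  moreover have "measure (P b) N = 0" using N(2) by (simp add: measure_def)
  moreover have "c * measure (P a) N \<ge> 0" "(1 - c) * measure (P a') N \<ge> 0" using c(1) c1 by auto
  ultimately have "c * measure (P a) N = 0" by linarith
  then have "measure (P a) N = 0" using c(1) by simp
  then have "N \<in> null_sets (P a)" using N(3) L by (auto simp: a.emeasure_eq_measure)
  then show ?thesis using N(1) L by (intro AE_I'[of N]) auto
qed

text \<open>The Markov property for functions of the past, obtained by identifying the conditional expectation of
  the event \<open>\<omega>(s) = i, \<omega>(t) = j\<close> given \<open>\<F>\<^sub>s\<close>.\<close>

lemma path_law_markov:
  fixes X :: "(real \<Rightarrow> 'm::finite) \<Rightarrow> real"
  assumes law: "is_path_law \<Lambda> a P" and st: "0 \<le> s" "s < t"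
    and X: "X \<in> borel_measurable (index_filtration s)" and bd: "\<And>\<omega>. \<omega> \<in> index_paths \<Longrightarrow> \<bar>X \<omega>\<bar> \<le> K"
  shows "(LINT \<omega>|P. X \<omega> * (if \<omega> s = i \<and> \<omega> t = j then 1 else 0)) =
    matrix_exp (- (t - s) *\<^sub>R \<Lambda>) $ i $ j * (LINT \<omega>|P. X \<omega> * (if \<omega> s = i then 1 else 0))"
proof -
  note P = path_law_sets[OF law]
  interpret prob_space P by (rule P)
  have sa: "subalgebra P (index_filtration s)"
    using subalgebra_index_filtration[of s] P space_index_algebra by (auto simp: subalgebra_def)
  interpret finite_measure_subalgebra P "index_filtration s"
    by unfold_locales (rule sa)
  let ?e = "matrix_exp (- (t - s) *\<^sub>R \<Lambda>) $ i $ j"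
  let ?f = "\<lambda>\<omega>::real\<Rightarrow>'m. if \<omega> s = i \<and> \<omega> t = j then 1 else (0::real)"
  let ?g = "\<lambda>\<omega>::real\<Rightarrow>'m. if \<omega> s = i then 1 else (0::real)"
  have evP: "(\<lambda>\<omega>. \<omega> r) \<in> measurable P (count_space UNIV)" if "r \<ge> 0" for r
    using measurable_index_evaluation[of r "{0..}"] that
    unfolding measurable_cong_sets[OF P(2) refl] index_algebra_def by auto
  have evF: "(\<lambda>\<omega>. \<omega> s) \<in> measurable (index_filtration s) (count_space (UNIV::'m set))"
    unfolding index_filtration_def by (rule measurable_index_evaluation) (use st in auto)
  have gF: "?g \<in> borel_measurable (index_filtration s)"
    using measurable_compose[OF evF, of "\<lambda>x. if x = i then 1 else (0::real)" borel] by simp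
  have [measurable]: "(\<lambda>\<omega>. \<omega> s) \<in> measurable P (count_space UNIV)" "(\<lambda>\<omega>. \<omega> t) \<in> measurable P (count_space UNIV)"
    using evP st by auto
  have fM [measurable]: "?f \<in> borel_measurable P" by measurable
  have gM [measurable]: "?g \<in> borel_measurable P" by measurable
  have XM [measurable]: "X \<in> borel_measurable P" by (rule measurable_from_subalg[OF sa X])
  have int: "integrable P ?f" "integrable P ?g"
    by (auto intro!: integrable_const_bound[where B = 1])
  have "AE \<omega> in P. real_cond_exp P (index_filtration s) ?f \<omega> = ?e * ?g \<omega>"
  proof (rule real_cond_exp_charact)
    fix A :: "(real \<Rightarrow> 'm) set" assume A: "A \<in> sets (index_filtration s)"
    have AP: "A \<in> sets P" using A sa by (auto simp: subalgebra_def)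
    have sub: "A \<subseteq> index_paths" using sets.sets_into_space[OF AP] P by simp
    have Int_paths: "A \<inter> {\<omega> \<in> index_paths. Q \<omega>} \<inter> index_paths = A \<inter> {\<omega> \<in> index_paths. Q \<omega>}" for Q
      by auto
    have 1: "set_lebesgue_integral P A ?f = measure P (A \<inter> {\<omega> \<in> index_paths. \<omega> s = i \<and> \<omega> t = j})"
    proof -
      have "set_lebesgue_integral P A ?f = (LINT \<omega>|P. indicator (A \<inter> {\<omega> \<in> space P. \<omega> s = i \<and> \<omega> t = j}) \<omega>)"
        unfolding set_lebesgue_integral_def by (intro Bochner_Integration.integral_cong) (auto simp: indicator_def)
      then show ?thesis by (simp add: P(3) Int_paths)
    qed
    have 2: "set_lebesgue_integral P A ?g = measure P (A \<inter> {\<omega> \<in> index_paths. \<omega> s = i})"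
    proof -
      have "set_lebesgue_integral P A ?g = (LINT \<omega>|P. indicator (A \<inter> {\<omega> \<in> space P. \<omega> s = i}) \<omega>)"
        unfolding set_lebesgue_integral_def by (intro Bochner_Integration.integral_cong) (auto simp: indicator_def)
      then show ?thesis by (simp add: P(3) Int_paths)
    qed
    show "set_lebesgue_integral P A ?f = set_lebesgue_integral P A (\<lambda>\<omega>. ?e * ?g \<omega>)"
      using path_law_markov_sets[OF law st A, of i j] by (simp only: 1 2 set_integral_mult_right)
  qed (use int gF in auto)
  then have "(LINT \<omega>|P. X \<omega> * real_cond_exp P (index_filtration s) ?f \<omega>) = (LINT \<omega>|P. X \<omega> * (?e * ?g \<omega>))"
    by (intro integral_cong_AE) (auto elim: AE_mp)
  moreover have "(LINT \<omega>|P. X \<omega> * real_cond_exp P (index_filtration s) ?f \<omega>) = (LINT \<omega>|P. X \<omega> * ?f \<omega>)"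
  proof (rule real_cond_exp_intg(2)[OF _ X fM])
    have "\<bar>X \<omega>\<bar> \<le> \<bar>K\<bar>" if "\<omega> \<in> space P" for \<omega> using bd[of \<omega>] that P by simp
    then show "integrable P (\<lambda>\<omega>. X \<omega> * ?f \<omega>)"
      by (intro integrable_const_bound[where B = "\<bar>K\<bar>"] AE_I2) auto
  qed
  moreover have "(LINT \<omega>|P. X \<omega> * (?e * ?g \<omega>)) = (LINT \<omega>|P. ?e * (X \<omega> * ?g \<omega>))"
    by (rule Bochner_Integration.integral_cong) (simp_all only: mult.left_commute)
  ultimately show ?thesis by (simp only: integral_mult_right_zero)
qed

section \<open>Integrals along paths and uniform bounds\<close>

lemma index_process_measurable:
  "(\<lambda>(\<omega>, s). \<omega> s) \<in> measurable path_time_space (count_space (UNIV :: 'm::finite set))"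
proof -
  have 1: "(\<lambda>(\<omega>, s). if s < 0 then undefined else \<omega> (max 0 s))
      \<in> measurable path_time_space (count_space (UNIV :: 'm set))"
    using index_process_jointly_measurable[where 'm = 'm] by (auto simp: split_beta intro!: measurable_If)
  have 2: "(case x of (\<omega>, s) \<Rightarrow> if s < 0 then undefined else \<omega> (max 0 s)) = (case x of (\<omega>, s) \<Rightarrow> \<omega> s)"
    if "x \<in> space path_time_space" for x :: "(real \<Rightarrow> 'm) \<times> real"
    using that by (auto simp: space_pair_measure space_index_algebra index_paths_iff extensional_def)
  show ?thesis by (rule measurable_cong[THEN iffD1, OF 2 1])
qed

lemma path_section_measurable:
  assumes "(\<lambda>(\<omega>, s). f \<omega> s) \<in> measurable path_time_space N" "\<omega> \<in> index_paths"
  shows "f \<omega> \<in> measurable borel N"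
proof -
  have "(\<lambda>s. (\<omega>, s)) \<in> measurable borel path_time_space"
    using assms(2) by (intro measurable_Pair1') (simp add: space_index_algebra)
  from measurable_compose[OF this assms(1)] show ?thesis by simp
qed

lemma set_integrable_bounded_Icc:
  fixes f :: "real \<Rightarrow> 'b::euclidean_space"
  assumes "f \<in> borel_measurable borel" "\<And>r. norm (f r) \<le> K"
  shows "set_integrable lborel {a..b} f"
  unfolding set_integrable_def
  by (rule integrableI_bounded_set_indicator[where B = K])
     (use assms in \<open>auto simp: emeasure_lborel_Icc_eq\<close>)

lemma integrable_bounded_Icc:
  fixes f :: "real \<Rightarrow> 'b::euclidean_space"
  assumes "f \<in> borel_measurable borel" "\<And>r. norm (f r) \<le> K"
  shows "f integrable_on {a..b}" "(LINT r:{a..b}|lborel. f r) = integral {a..b} f"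
  using set_borel_integral_eq_integral[OF set_integrable_bounded_Icc[OF assms]] by auto

lemma set_integral_bounded_norm:
  fixes f :: "real \<Rightarrow> 'b::euclidean_space"
  assumes "f \<in> borel_measurable borel" "\<And>r. norm (f r) \<le> K" "a \<le> b"
  shows "norm (LINT r:{a..b}|lborel. f r) \<le> K * (b - a)"
proof -
  have "0 \<le> K" using assms(2)[of 0] norm_ge_zero order.trans by blast
  then have "norm (integral {a..b} f) \<le> K * measure lborel {a..b}"
    by (rule has_integral_bound_real[OF _ finite.emptyI integrable_integral[OF integrable_bounded_Icc(1)[OF assms(1,2)]]])
       (use assms in auto)
  then have "norm (integral {a..b} f) \<le> K * (b - a)" using assms(3) by simp
  then show ?thesis using integrable_bounded_Icc(2)[OF assms(1,2)] by simp
qed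

lemma set_integral_increment:
  fixes f :: "real \<Rightarrow> 'b::euclidean_space"
  assumes "f \<in> borel_measurable borel" "\<And>r. norm (f r) \<le> K" "a \<le> s" "s \<le> t"
  shows "(LINT r:{a..t}|lborel. f r) - (LINT r:{a..s}|lborel. f r) = (LINT r:{s..t}|lborel. f r)"
  using Henstock_Kurzweil_Integration.integral_combine[OF assms(3,4) integrable_bounded_Icc(1)[OF assms(1,2)]]
  by (simp add: integrable_bounded_Icc(2)[OF assms(1,2)] algebra_simps)

text \<open>Where the integrand is right-continuous, its primitive has a right derivative. For cadlag velocities
  this holds at every time, so no exceptional null set has to be carried along.\<close>

lemma set_integral_right_derivative:
  fixes f :: "real \<Rightarrow> 'b::euclidean_space"
  assumes f: "f \<in> borel_measurable borel" "\<And>r. norm (f r) \<le> K" and r: "a \<le> r" "r < t"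
    and rc: "(f \<longlongrightarrow> f r) (at_right r)"
  shows "((\<lambda>x. LINT s:{a..x}|lborel. f s) has_vector_derivative f r) (at r within {r..t})"
proof -
  have "continuous (at r within {r..t}) f"
    unfolding continuous_within
    by (rule tendsto_mono[OF at_le rc[folded at_within_Ici_at_right]]) auto
  then have "((\<lambda>x. integral {r..x} f) has_vector_derivative f r) (at r within {r..t})"
    using integral_has_vector_derivative_continuous_at[of f r t r "{}"] integrable_bounded_Icc(1)[OF f] r by simp
  then have 1: "((\<lambda>x. (LINT s:{a..r}|lborel. f s) + integral {r..x} f) has_vector_derivative f r) (at r within {r..t})"
    by (auto intro!: derivative_eq_intros)
  have 2: "(LINT s:{a..x}|lborel. f s) = (LINT s:{a..r}|lborel. f s) + integral {r..x} f" if "x \<in> {r..t}" for x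
    using set_integral_increment[OF f r(1), of x] that integrable_bounded_Icc(2)[OF f] by (simp add: algebra_simps)
  show ?thesis by (rule has_vector_derivative_transform[OF _ 2 1]) (use r in auto)
qed

lemma set_integral_continuous:
  fixes f :: "real \<Rightarrow> 'b::euclidean_space"
  assumes f: "f \<in> borel_measurable borel" "\<And>r. norm (f r) \<le> K"
  shows "continuous_on {a..} (\<lambda>x. LINT s:{a..x}|lborel. f s)"
proof -
  have K: "0 \<le> K" using f(2)[of 0] norm_ge_zero order.trans by blast
  have "K-lipschitz_on {a..} (\<lambda>x. LINT s:{a..x}|lborel. f s)"
  proof (rule lipschitz_on_leI)
    fix s t :: real assume "s \<in> {a..}" "t \<in> {a..}" "s \<le> t"
    then show "dist (LINT r:{a..s}|lborel. f r) (LINT r:{a..t}|lborel. f r) \<le> K * dist s t"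
      using set_integral_increment[OF f, of a s t] set_integral_bounded_norm[OF f, of s t]
      by (simp add: dist_norm norm_minus_commute[of "LINT r:{a..s}|lborel. f r"])
  qed (rule K)
  then show ?thesis by (rule lipschitz_on_continuous_on)
qed

lemma subsolution_components_bounded:
  assumes "subsolution H \<Lambda> \<alpha> (u :: 'n::finite torus \<Rightarrow> real ^ 'm::finite)"
  shows "\<exists>B\<ge>0. \<forall>i z. \<bar>u z $ i\<bar> \<le> B"
proof -
  have "compact (u ` UNIV)"
    using assms compact_torus unfolding subsolution_def by (intro compact_continuous_image) auto
  then obtain B where B: "\<And>z. norm (u z) \<le> B" using compact_imp_bounded bounded_iff by (metis rangeI)
  then have "\<bar>u z $ i\<bar> \<le> B" for i z using component_le_norm_cart[of "u z" i] order.trans by blast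
  moreover have "B \<ge> 0" using B norm_ge_zero order.trans by blast
  ultimately show ?thesis by blast
qed

lemma subsolution_components_modulus:
  assumes "subsolution H \<Lambda> \<alpha> (u :: 'n::finite torus \<Rightarrow> real ^ 'm::finite)" and "e > 0"
  shows "\<exists>d>0. \<forall>i z z'. norm (z - z') < d \<longrightarrow> \<bar>u (torus_proj z) $ i - u (torus_proj z') $ i\<bar> < e"
proof -
  have ucont: "continuous_on UNIV (\<lambda>z. u (torus_proj z))"
    using assms(1) by (simp add: subsolution_def continuous_on_torus_iff)
  have "\<exists>d>0. \<forall>z z'. norm (z - z') < d \<longrightarrow> \<bar>u (torus_proj z) $ i - u (torus_proj z') $ i\<bar> < e" for i
  proof -
    have "continuous_on (UNIV \<times> {0::real}) (\<lambda>(z, q). u (torus_proj z) $ i)"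
      unfolding split_beta
      by (intro continuous_intros continuous_on_compose2[OF ucont]) auto
    from periodic_uniformly_continuous[OF this _ periodic_torus[of "\<lambda>x. u x $ i"] assms(2)]
    show ?thesis by (metis compact_sing singletonI)
  qed
  then obtain d where d: "\<And>i. d i > 0"
      "\<And>i z z'. norm (z - z') < d i \<Longrightarrow> \<bar>u (torus_proj z) $ i - u (torus_proj z') $ i\<bar> < e"
    by metis
  show ?thesis
    by (rule exI[of _ "Min (range d)"]) (use d in \<open>auto simp: Min_gr_iff\<close>)
qed

lemma lagrangians_bounded:
  assumes "\<And>i::'m::finite. hamiltonian (H i :: 'n::finite torus \<Rightarrow> real ^ 'n \<Rightarrow> real)"
  shows "\<exists>B\<ge>0. \<forall>i x q. norm q \<le> R \<longrightarrow> \<bar>lagrangian (H i) x q\<bar> \<le> B"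
proof -
  have "\<exists>B\<ge>0. \<forall>x q. norm q \<le> R \<longrightarrow> \<bar>lagrangian (H i) x q\<bar> \<le> B" for i
  proof -
    have "\<exists>B\<ge>0. \<forall>z. \<forall>q\<in>cball 0 R. \<bar>lagrangian (H i) (torus_proj z) q\<bar> \<le> B"
      by (rule periodic_bounded)
         (auto intro!: periodic_torus[of "\<lambda>x. lagrangian (H i) x _"] continuous_on_subset[OF lagrangian_lift_continuous[OF assms]])
    then obtain B where "B \<ge> 0" "\<And>z q. norm q \<le> R \<Longrightarrow> \<bar>lagrangian (H i) (torus_proj z) q\<bar> \<le> B" by auto
    then show ?thesis by (intro exI[of _ B]) (metis torus_proj_surj)
  qed
  then obtain B where B: "\<And>i. B i \<ge> 0" "\<And>i x q. norm q \<le> R \<Longrightarrow> \<bar>lagrangian (H i) x q\<bar> \<le> B i" by metis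
  have "\<bar>lagrangian (H i) x q\<bar> \<le> (\<Sum>i\<in>UNIV. B i)" if "norm q \<le> R" for i x q
    using B(2)[OF that, of i x] member_le_sum[of i UNIV B] B(1) by fastforce
  then show ?thesis by (intro exI[of _ "\<Sum>i\<in>UNIV. B i"]) (auto intro: sum_nonneg B)
qed

section \<open>The controlled process\<close>

text \<open>The objects attached to a controlled trajectory \<open>y\<close>, lifted to \<open>\<real>\<^sup>N\<close>, and their joint measurability in path
  and time. The locale has two instances: the original control, bounded only almost surely, and its truncation.\<close>

locale controlled_path =
  fixes H :: "'m::finite \<Rightarrow> 'n::finite torus \<Rightarrow> real ^ 'n \<Rightarrow> real"
    and \<Lambda> :: "real ^ 'm ^ 'm" and \<alpha> :: real and u :: "'n torus \<Rightarrow> real ^ 'm"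
    and \<xi> :: "(real \<Rightarrow> 'm) \<Rightarrow> real \<Rightarrow> real ^ 'n" and z0 :: "real ^ 'n"
  assumes ham: "\<And>i. hamiltonian (H i)"
    and sub: "subsolution H \<Lambda> \<alpha> u"
    and control_measurable [measurable]: "(\<lambda>(\<omega>, s). \<xi> \<omega> s) \<in> borel_measurable path_time_space"
begin

definition traj :: "(real \<Rightarrow> 'm) \<Rightarrow> real \<Rightarrow> real ^ 'n" where
  "traj \<omega> t = z0 + (LINT s:{0..t}|lborel. \<xi> \<omega> s)"

definition U :: "'m \<Rightarrow> real ^ 'n \<Rightarrow> real" where
  "U i z = u (torus_proj z) $ i"

definition running :: "'m \<Rightarrow> (real \<Rightarrow> 'm) \<Rightarrow> real \<Rightarrow> real" where
  "running i \<omega> s = lagrangian (H i) (torus_proj (traj \<omega> s)) (- \<xi> \<omega> s) + \<alpha>"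

definition action :: "(real \<Rightarrow> 'm) \<Rightarrow> real \<Rightarrow> real" where
  "action \<omega> t = (LINT s:{0..t}|lborel. running (\<omega> s) \<omega> s)"

text \<open>
  The value at the current position plus the cost accumulated so far. The theorem is the optional stopping
  inequality for this process, which is a submartingale.
\<close>

definition payoff :: "(real \<Rightarrow> 'm) \<Rightarrow> real \<Rightarrow> real" where
  "payoff \<omega> t = U (\<omega> t) (traj \<omega> t) + action \<omega> t"

lemma process_meas [measurable]: "(\<lambda>(\<omega>, s). \<omega> s) \<in> measurable path_time_space (count_space (UNIV :: 'm set))"
  by (rule index_process_measurable)

lemma traj_measurable [measurable]: "(\<lambda>(\<omega>, t). traj \<omega> t) \<in> borel_measurable path_time_space"
proof -
  have "(\<lambda>x. z0 + (\<integral>s. (if 0 \<le> s \<and> s \<le> snd x then 1 else 0) *\<^sub>R \<xi> (fst x) s \<partial>lborel))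
     \<in> borel_measurable path_time_space"
    by measurable
  moreover have "indicator {0..t} s = (if 0 \<le> s \<and> s \<le> t then 1 else 0 :: real)" for s t :: real
    by (auto simp: indicator_def)
  ultimately show ?thesis by (simp add: traj_def set_lebesgue_integral_def split_beta)
qed

lemma running_measurable [measurable]:
  "(\<lambda>(\<omega>, s). running i \<omega> s) \<in> borel_measurable path_time_space"
proof -
  have "continuous_on UNIV (\<lambda>x. lagrangian (H i) (torus_proj (fst x)) (snd x))"
    using lagrangian_lift_continuous[OF ham, of i] by (simp add: split_beta)
  then have "(\<lambda>x. lagrangian (H i) (torus_proj (traj (fst x) (snd x))) (- \<xi> (fst x) (snd x)))
      \<in> borel_measurable path_time_space"
    using traj_measurable control_measurable
    by (intro borel_measurable_continuous_Pair[where H = "\<lambda>z q. lagrangian (H i) (torus_proj z) q"])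
       (auto simp: split_beta)
  then show ?thesis by (simp add: running_def split_beta)
qed

lemma running_cost_measurable [measurable]:
  "(\<lambda>(\<omega>, s). running (\<omega> s) \<omega> s) \<in> borel_measurable path_time_space"
  unfolding split_beta
  by (rule measurable_compose_countable[where f = "\<lambda>i x. running i (fst x) (snd x)" and g = "\<lambda>x. fst x (snd x)"])
     (use running_measurable process_meas in \<open>auto simp: split_beta\<close>)

lemma action_measurable [measurable]: "(\<lambda>(\<omega>, t). action \<omega> t) \<in> borel_measurable path_time_space"
proof -
  have "(\<lambda>x. (\<integral>s. (if 0 \<le> s \<and> s \<le> snd x then 1 else 0) *\<^sub>R running (fst x s) (fst x) s \<partial>lborel))
     \<in> borel_measurable path_time_space"
    by measurable
  moreover have "indicator {0..t} s = (if 0 \<le> s \<and> s \<le> t then 1 else 0 :: real)" for s t :: real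
    by (auto simp: indicator_def)
  ultimately show ?thesis by (simp add: action_def set_lebesgue_integral_def split_beta)
qed

lemma U_continuous: "continuous_on UNIV (U i)"
  using sub unfolding U_def subsolution_def continuous_on_torus_iff by (auto intro: continuous_intros)

lemma U_borel [measurable]: "U i \<in> borel_measurable borel"
  by (rule borel_measurable_continuous_onI[OF U_continuous])

lemma U_traj_measurable [measurable]:
  "(\<lambda>(\<omega>, t). U (\<omega> t) (traj \<omega> t)) \<in> borel_measurable path_time_space"
  unfolding split_beta
  by (rule measurable_compose_countable[where f = "\<lambda>i x. U i (traj (fst x) (snd x))" and g = "\<lambda>x. fst x (snd x)"])
     (use process_meas in \<open>auto simp: split_beta\<close>)

lemma payoff_measurable [measurable]: "(\<lambda>(\<omega>, t). payoff \<omega> t) \<in> borel_measurable path_time_space"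
  unfolding payoff_def by measurable

lemmas running_borel = path_section_measurable[OF running_measurable] path_section_measurable[OF running_cost_measurable]

end

text \<open>The setting of the estimates: the truncated control, for which all bounds hold on every path.\<close>

locale controlled_system = controlled_path H \<Lambda> \<alpha> u \<xi> z0
  for H :: "'m::finite \<Rightarrow> 'n::finite torus \<Rightarrow> real ^ 'n \<Rightarrow> real"
    and \<Lambda> :: "real ^ 'm ^ 'm" and \<alpha> :: real and u :: "'n torus \<Rightarrow> real ^ 'm"
    and \<xi> :: "(real \<Rightarrow> 'm) \<Rightarrow> real \<Rightarrow> real ^ 'n" and z0 :: "real ^ 'n" +
  fixes a :: "real ^ 'm" and P :: "(real \<Rightarrow> 'm) measure" and R :: real
  assumes row_sums: "\<And>i. (\<Sum>j\<in>UNIV. \<Lambda> $ i $ j) = 0"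
    and law: "is_path_law \<Lambda> a P"
    and control_right_continuous: "\<And>\<omega> s. \<omega> \<in> index_paths \<Longrightarrow> 0 \<le> s \<Longrightarrow> (\<xi> \<omega> \<longlongrightarrow> \<xi> \<omega> s) (at_right s)"
    and control_bounded: "\<And>\<omega> s. \<omega> \<in> index_paths \<Longrightarrow> norm (\<xi> \<omega> s) \<le> R"
    and control_nonanticipating: "\<And>t \<omega>1 \<omega>2 s. 0 < t \<Longrightarrow> \<omega>1 \<in> index_paths \<Longrightarrow> \<omega>2 \<in> index_paths \<Longrightarrow>
       (\<And>s. 0 \<le> s \<Longrightarrow> s \<le> t \<Longrightarrow> \<omega>1 s = \<omega>2 s) \<Longrightarrow> 0 \<le> s \<Longrightarrow> s \<le> t \<Longrightarrow> \<xi> \<omega>1 s = \<xi> \<omega>2 s"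
begin

text \<open>Uniform bounds for the components of \<open>u\<close> and for the running cost, chosen once for the whole argument.\<close>

definition u_bound :: real where "u_bound = (SOME B. B \<ge> 0 \<and> (\<forall>i z. \<bar>u z $ i\<bar> \<le> B))"
definition cost_bound :: real where "cost_bound = (SOME B. B \<ge> 0 \<and> (\<forall>i x q. norm q \<le> R \<longrightarrow> \<bar>lagrangian (H i) x q\<bar> \<le> B)) + \<bar>\<alpha>\<bar>"

lemma u_bounded: "u_bound \<ge> 0" "\<bar>U i z\<bar> \<le> u_bound"
proof -
  have *: "(SOME B. B \<ge> 0 \<and> (\<forall>i z. \<bar>u z $ i\<bar> \<le> B)) \<ge> 0 \<and>
    (\<forall>i z. \<bar>u z $ i\<bar> \<le> (SOME B. B \<ge> 0 \<and> (\<forall>i z. \<bar>u z $ i\<bar> \<le> B)))"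
    by (rule someI_ex) (rule subsolution_components_bounded[OF sub])
  show "u_bound \<ge> 0" unfolding u_bound_def by (rule conjunct1[OF *])
  show "\<bar>U i z\<bar> \<le> u_bound" unfolding u_bound_def U_def by (rule spec[OF spec[OF conjunct2[OF *]]])
qed

lemma cost_bounded: "cost_bound \<ge> 0" "\<omega> \<in> index_paths \<Longrightarrow> \<bar>running i \<omega> s\<bar> \<le> cost_bound"
proof -
  have *: "(SOME B. B \<ge> 0 \<and> (\<forall>i x q. norm q \<le> R \<longrightarrow> \<bar>lagrangian (H i) x q\<bar> \<le> B)) \<ge> 0 \<and>
    (\<forall>i x q. norm q \<le> R \<longrightarrow> \<bar>lagrangian (H i) x q\<bar> \<le> (SOME B. B \<ge> 0 \<and> (\<forall>i x q. norm q \<le> R \<longrightarrow> \<bar>lagrangian (H i) x q\<bar> \<le> B)))"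
    by (rule someI_ex) (rule lagrangians_bounded[OF ham])
  then show "cost_bound \<ge> 0" unfolding cost_bound_def by linarith
  assume "\<omega> \<in> index_paths"
  then have "norm (- \<xi> \<omega> s) \<le> R" using control_bounded by simp
  then show "\<bar>running i \<omega> s\<bar> \<le> cost_bound"
    using * unfolding cost_bound_def running_def by (meson abs_triangle_ineq add_right_mono order.trans)
qed

lemma sets_P [measurable_cong]: "sets P = sets index_algebra"
  and space_P: "space P = index_paths"
  using path_law_sets[OF law] by auto

sublocale prob_space P
  using path_law_sets[OF law] by auto

context
  fixes \<omega> :: "real \<Rightarrow> 'm"
  assumes \<omega>: "\<omega> \<in> index_paths"
begin

lemma traj_increment: "0 \<le> s \<Longrightarrow> s \<le> t \<Longrightarrow> norm (traj \<omega> t - traj \<omega> s) \<le> R * (t - s)"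
  using set_integral_increment[OF path_section_measurable[OF control_measurable \<omega>] control_bounded[OF \<omega>], of 0 s t]
    set_integral_bounded_norm[OF path_section_measurable[OF control_measurable \<omega>] control_bounded[OF \<omega>], of s t]
  by (simp add: traj_def)

lemma traj_continuous: "continuous_on {0..} (traj \<omega>)"
  unfolding traj_def
  by (intro continuous_intros set_integral_continuous[OF path_section_measurable[OF control_measurable \<omega>] control_bounded[OF \<omega>]])

lemma traj_right_derivative:
  "0 \<le> r \<Longrightarrow> r < t \<Longrightarrow> (traj \<omega> has_vector_derivative \<xi> \<omega> r) (at r within {r..t})"
  unfolding traj_def
  using set_integral_right_derivative[OF path_section_measurable[OF control_measurable \<omega>] control_bounded[OF \<omega>] _ _ control_right_continuous[OF \<omega>]]
  by (auto intro!: derivative_eq_intros)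

lemma traj_right_limit: "0 \<le> r \<Longrightarrow> (traj \<omega> \<longlongrightarrow> traj \<omega> r) (at_right r)"
proof -
  assume "0 \<le> r"
  then have "(traj \<omega> \<longlongrightarrow> traj \<omega> r) (at r within {0..})"
    using traj_continuous by (auto simp: continuous_on_def)
  then show ?thesis by (rule tendsto_mono[OF at_le, rotated]) (use \<open>0 \<le> r\<close> in auto)
qed

lemma running_right_continuous: "0 \<le> r \<Longrightarrow> (running i \<omega> \<longlongrightarrow> running i \<omega> r) (at_right r)"
proof -
  assume r: "0 \<le> r"
  have "isCont (\<lambda>(z, q). lagrangian (H i) (torus_proj z) q) (traj \<omega> r, - \<xi> \<omega> r)"
    using lagrangian_lift_continuous[OF ham, of i] by (simp add: continuous_on_eq_continuous_at)
  moreover have "((\<lambda>s. (traj \<omega> s, - \<xi> \<omega> s)) \<longlongrightarrow> (traj \<omega> r, - \<xi> \<omega> r)) (at_right r)"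
    by (intro tendsto_intros traj_right_limit control_right_continuous \<omega> r)
  ultimately have "((\<lambda>s. (\<lambda>(z, q). lagrangian (H i) (torus_proj z) q) (traj \<omega> s, - \<xi> \<omega> s)) \<longlongrightarrow>
      (\<lambda>(z, q). lagrangian (H i) (torus_proj z) q) (traj \<omega> r, - \<xi> \<omega> r)) (at_right r)"
    by (rule isCont_tendsto_compose)
  then have "((\<lambda>s. lagrangian (H i) (torus_proj (traj \<omega> s)) (- \<xi> \<omega> s)) \<longlongrightarrow>
      lagrangian (H i) (torus_proj (traj \<omega> r)) (- \<xi> \<omega> r)) (at_right r)" by simp
  then show ?thesis unfolding running_def by (intro tendsto_intros)
qed

lemma action_increment:
  "0 \<le> s \<Longrightarrow> s \<le> t \<Longrightarrow> action \<omega> t - action \<omega> s = (LINT r:{s..t}|lborel. running (\<omega> r) \<omega> r)"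
  unfolding action_def
  by (rule set_integral_increment[OF running_borel(2)[OF \<omega>]]) (use cost_bounded \<omega> in auto)

lemma action_bounded: "0 \<le> t \<Longrightarrow> \<bar>action \<omega> t\<bar> \<le> cost_bound * t"
  using set_integral_bounded_norm[OF running_borel(2)[OF \<omega>], of cost_bound 0 t] cost_bounded \<omega> unfolding action_def by simp

lemma payoff_right_continuous:
  assumes "0 \<le> t"
  shows "(payoff \<omega> \<longlongrightarrow> payoff \<omega> t) (at_right t)"
  unfolding payoff_def
proof (rule tendsto_add)
  have "\<forall>\<^sub>F s in at_right t. \<omega> s = \<omega> t" using \<omega> assms by (simp add: index_paths_iff)
  then have "\<forall>\<^sub>F s in at_right t. U (\<omega> s) (traj \<omega> s) = U (\<omega> t) (traj \<omega> s)"
    by (rule eventually_mono) simp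
  moreover have "((\<lambda>s. U (\<omega> t) (traj \<omega> s)) \<longlongrightarrow> U (\<omega> t) (traj \<omega> t)) (at_right t)"
    using U_continuous traj_right_limit[OF assms]
    by (intro isCont_tendsto_compose[of _ "U (\<omega> t)"]) (auto simp: continuous_on_eq_continuous_at)
  ultimately show "((\<lambda>s. U (\<omega> s) (traj \<omega> s)) \<longlongrightarrow> U (\<omega> t) (traj \<omega> t)) (at_right t)"
    by (simp only: tendsto_cong)
  have "continuous_on {0..} (action \<omega>)" unfolding action_def
    by (rule set_integral_continuous[OF running_borel(2)[OF \<omega>]]) (use cost_bounded \<omega> in auto)
  then have "(action \<omega> \<longlongrightarrow> action \<omega> t) (at t within {0..})" using assms by (auto simp: continuous_on_def)
  then show "(action \<omega> \<longlongrightarrow> action \<omega> t) (at_right t)"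
    by (rule tendsto_mono[OF at_le, rotated]) (use assms in auto)
qed

lemma payoff_bounded: "0 \<le> t \<Longrightarrow> \<bar>payoff \<omega> t\<bar> \<le> u_bound + cost_bound * t"
  using action_bounded[of t] u_bounded(2)[of "\<omega> t" "traj \<omega> t"] unfolding payoff_def by linarith

end

text \<open>For \<open>t > 0\<close> the control on \<open>{0..t}\<close> is determined by the path on \<open>{0..t}\<close>; at \<open>t = 0\<close>, where nonanticipation
  gives nothing, the trajectory is constant.\<close>

lemma traj_adapted:
  assumes "0 \<le> t"
  shows "(\<lambda>\<omega>. traj \<omega> t) \<in> borel_measurable (index_filtration t)"
proof (rule adapted_if_nonanticipating[OF _ assms])
  show "(\<lambda>\<omega>. traj \<omega> t) \<in> borel_measurable index_algebra" by measurable
  fix \<omega>1 \<omega>2 :: "real \<Rightarrow> 'm"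
  assume *: "\<omega>1 \<in> index_paths" "\<omega>2 \<in> index_paths" "\<And>s. 0 \<le> s \<Longrightarrow> s \<le> t \<Longrightarrow> \<omega>1 s = \<omega>2 s"
  show "traj \<omega>1 t = traj \<omega>2 t"
  proof (cases "t = 0")
    case True
    have "(LINT s:{0..0}|lborel. \<xi> \<omega> s) = 0" if "\<omega> \<in> index_paths" for \<omega>
      using set_integral_bounded_norm[OF path_section_measurable[OF control_measurable] control_bounded, of \<omega> 0 0] that by simp
    with *(1,2) show ?thesis by (simp add: traj_def True)
  next
    case False
    then have "\<xi> \<omega>1 s = \<xi> \<omega>2 s" if "s \<in> {0..t}" for s
      using control_nonanticipating[of t \<omega>1 \<omega>2 s] * assms that by auto
    then show ?thesis unfolding traj_def set_lebesgue_integral_def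
      by (auto intro!: Bochner_Integration.integral_cong simp: indicator_def)
  qed
qed

end

section \<open>The mean change of the payoff over a short time\<close>

context controlled_system
begin

text \<open>The entries of \<open>\<Lambda>\<^sup>k\<close> are at most the \<open>k\<close>-th power of this number, by \<open>matrix_power_entry_bound\<close>.\<close>

definition coupling_size :: real where
  "coupling_size = (\<Sum>i\<in>UNIV. \<Sum>j\<in>UNIV. \<bar>\<Lambda> $ i $ j\<bar>)"

text \<open>The term with the squared number of indices absorbs the quadratic remainders of all transition entries.\<close>

definition jump_rate :: real where
  "jump_rate = coupling_size * (1 + (real CARD('m))\<^sup>2)"

definition jumped :: "real \<Rightarrow> real \<Rightarrow> (real \<Rightarrow> 'm) \<Rightarrow> real" where
  "jumped s r \<omega> = (if \<omega> r \<noteq> \<omega> s then 1 else 0)"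

lemma coupling_size_nonneg: "0 \<le> coupling_size"
  unfolding coupling_size_def by (intro sum_nonneg) auto

lemma coupling_row_bound:
  assumes "\<And>j. \<bar>d j\<bar> \<le> K"
  shows "\<bar>\<Sum>j\<in>UNIV. \<Lambda> $ i $ j * d j\<bar> \<le> coupling_size * K"
proof -
  have "(\<Sum>j\<in>UNIV. \<bar>\<Lambda> $ i $ j\<bar>) \<le> coupling_size"
    unfolding coupling_size_def
    by (rule member_le_sum[of i UNIV "\<lambda>i. \<Sum>j\<in>UNIV. \<bar>\<Lambda> $ i $ j\<bar>"]) (auto intro: sum_nonneg)
  moreover have "0 \<le> K" using assms[of undefined] by linarith
  moreover have "\<bar>\<Sum>j\<in>UNIV. \<Lambda> $ i $ j * d j\<bar> \<le> (\<Sum>j\<in>UNIV. \<bar>\<Lambda> $ i $ j\<bar> * K)"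
    by (rule order.trans[OF sum_abs]) (auto simp: abs_mult intro!: sum_mono mult_left_mono assms)
  ultimately show ?thesis
    using mult_right_mono[of "\<Sum>j\<in>UNIV. \<bar>\<Lambda> $ i $ j\<bar>" coupling_size K]
    by (simp add: sum_distrib_right[symmetric])
qed

lemma jump_rate_nonneg: "0 \<le> jump_rate"
  unfolding jump_rate_def using coupling_size_nonneg by simp

lemma R_nonneg: "0 \<le> R"
proof -
  obtain \<omega> :: "real \<Rightarrow> 'm" where "\<omega> \<in> index_paths" using not_empty by (auto simp: space_P)
  then show ?thesis using control_bounded[of \<omega> 0] norm_ge_zero order.trans by blast
qed

lemma integrable_bounded:
  fixes f :: "(real \<Rightarrow> 'm) \<Rightarrow> real"
  assumes "f \<in> borel_measurable P" "\<And>\<omega>. \<omega> \<in> index_paths \<Longrightarrow> \<bar>f \<omega>\<bar> \<le> K"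
  shows "integrable P f"
  using assms by (intro integrable_const_bound[where B = K]) (auto simp: space_P)

lemma expectation_bounded:
  fixes f :: "(real \<Rightarrow> 'm) \<Rightarrow> real"
  assumes "f \<in> borel_measurable P" "\<And>\<omega>. \<omega> \<in> index_paths \<Longrightarrow> \<bar>f \<omega>\<bar> \<le> K"
  shows "\<bar>expectation f\<bar> \<le> K"
proof -
  have int: "integrable P f" by (rule integrable_bounded[OF assms])
  have "expectation f \<le> expectation (\<lambda>_. K)"
    by (rule integral_mono[OF int]) (use assms(2) in \<open>auto simp: space_P abs_le_iff\<close>)
  moreover have "expectation (\<lambda>_. - K) \<le> expectation f"
    by (rule integral_mono[OF _ int]) (use assms(2) in \<open>force simp: space_P abs_le_iff\<close>)+
  ultimately show ?thesis by (simp add: prob_space abs_le_iff)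
qed

lemma process_at_measurable [measurable]:
  "(\<lambda>\<omega>. \<omega> s) \<in> measurable index_algebra (count_space (UNIV :: 'm set))"
  using measurable_compose[OF measurable_Pair1' process_meas] measurable_Pair2'[of s borel index_algebra]
    measurable_compose[OF _ process_meas, of "\<lambda>\<omega>. (\<omega>, s)" index_algebra] by simp

lemma transition_expansion:
  assumes "s < t" "(t - s) * coupling_size \<le> 1"
  shows "\<bar>matrix_exp (- (t - s) *\<^sub>R \<Lambda>) $ i $ j - (if i = j then 1 else 0) + (t - s) * \<Lambda> $ i $ j\<bar>
      \<le> ((t - s) * coupling_size)\<^sup>2"
proof -
  define A where "A = - (t - s) *\<^sub>R \<Lambda>"
  have A: "A $ i $ j = - ((t - s) * \<Lambda> $ i $ j)" for i j by (simp add: A_def algebra_simps)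
  have S: "(\<Sum>i\<in>UNIV. \<Sum>j\<in>UNIV. \<bar>A $ i $ j\<bar>) = (t - s) * coupling_size"
    using assms(1) by (simp add: A coupling_size_def sum_distrib_left abs_mult)
  have "\<bar>matrix_exp A $ i $ j - mat 1 $ i $ j - A $ i $ j\<bar> \<le> ((t - s) * coupling_size)\<^sup>2"
    using matrix_exp_expansion[of A i j] assms(2) unfolding S by simp
  then show ?thesis unfolding A_def[symmetric] A by (simp add: mat_def)
qed

lemma two_point_expansion:
  fixes f :: "'m \<Rightarrow> 'm \<Rightarrow> real"
  shows "(\<Sum>i\<in>UNIV. \<Sum>j\<in>UNIV. f i j * (if k = i \<and> l = j then 1 else 0)) = f k l"
proof -
  have "(\<Sum>j\<in>UNIV. f i j * (if k = i \<and> l = j then 1 else 0)) = (if k = i then f i l else 0)" for i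
    by (auto simp: if_distrib[of "\<lambda>x. _ * x"] cong: if_cong)
  then show ?thesis by simp
qed

lemma double_sum_add_const:
  fixes f :: "'m \<Rightarrow> 'm \<Rightarrow> real"
  shows "(\<Sum>i\<in>UNIV. \<Sum>j\<in>UNIV. f i j + c) = (\<Sum>i\<in>UNIV. \<Sum>j\<in>UNIV. f i j) + (real CARD('m))\<^sup>2 * c"
  by (simp add: sum.distrib power2_eq_square)

lemma expectation_double_sum:
  fixes f :: "'m \<Rightarrow> 'm \<Rightarrow> (real \<Rightarrow> 'm) \<Rightarrow> real"
  assumes "\<And>i j. integrable P (f i j)"
  shows "expectation (\<lambda>\<omega>. \<Sum>i\<in>UNIV. \<Sum>j\<in>UNIV. f i j \<omega>) = (\<Sum>i\<in>UNIV. \<Sum>j\<in>UNIV. expectation (f i j))"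
  using assms by (simp add: Bochner_Integration.integral_sum)

lemma jumped_measurable [measurable]: "(\<lambda>(\<omega>, r). jumped s r \<omega>) \<in> borel_measurable path_time_space"
  unfolding jumped_def by measurable

lemma jumped_bounded: "0 \<le> jumped s r \<omega>" "\<bar>jumped s r \<omega>\<bar> \<le> 1"
  by (auto simp: jumped_def)

text \<open>The off-diagonal transition probabilities are of the order of the elapsed time.\<close>

lemma jump_probability:
  assumes "0 \<le> s" "s \<le> r" "(r - s) * coupling_size \<le> 1"
  shows "expectation (jumped s r) \<le> jump_rate * (r - s)"
proof (cases "r = s")
  case True
  then show ?thesis by (simp add: jumped_def[abs_def])
next
  case False
  then have sr: "s < r" using assms by simp
  define h where "h = r - s"
  have hc: "0 \<le> h * coupling_size" "h * coupling_size \<le> 1" "0 < h"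
    using assms coupling_size_nonneg sr by (auto simp: h_def)
  let ?f = "\<lambda>i j \<omega>. if \<omega> s = i \<and> \<omega> r = j then 1 else (0::real)"
  let ?g = "\<lambda>i \<omega>. if \<omega> s = i then 1 else (0::real)"
  let ?e = "\<lambda>i j. matrix_exp (- (r - s) *\<^sub>R \<Lambda>) $ i $ j"
  have int: "integrable P (\<lambda>\<omega>. (if i = j then 0 else 1) * ?f i j \<omega>)" for i j
    by (rule integrable_bounded[where K = 1]) auto
  have J: "jumped s r = (\<lambda>\<omega>. \<Sum>i\<in>UNIV. \<Sum>j\<in>UNIV. (if i = j then 0 else 1) * ?f i j \<omega>)"
    unfolding two_point_expansion by (auto simp: jumped_def fun_eq_iff)
  have "expectation (jumped s r) = (\<Sum>i\<in>UNIV. \<Sum>j\<in>UNIV. expectation (\<lambda>\<omega>. (if i = j then 0 else 1) * ?f i j \<omega>))"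
    unfolding J by (rule expectation_double_sum[OF int])
  also have "\<dots> \<le> (\<Sum>i\<in>UNIV. \<Sum>j\<in>UNIV. h * \<bar>\<Lambda> $ i $ j\<bar> + (h * coupling_size)\<^sup>2)"
  proof (intro sum_mono)
    fix i j :: 'm
    have E: "expectation (\<lambda>\<omega>. 1 * ?f i j \<omega>) = ?e i j * expectation (\<lambda>\<omega>. 1 * ?g i \<omega>)"
      by (rule path_law_markov[OF law assms(1) sr, where K = 1]) auto
    have g: "0 \<le> expectation (?g i)" "expectation (?g i) \<le> 1"
      using expectation_bounded[of "?g i" 1] by (auto intro!: integral_nonneg_AE simp: abs_le_iff)
    show "expectation (\<lambda>\<omega>. (if i = j then 0 else 1) * ?f i j \<omega>) \<le> h * \<bar>\<Lambda> $ i $ j\<bar> + (h * coupling_size)\<^sup>2"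
    proof (cases "i = j")
      case False
      have "\<bar>?e i j + h * \<Lambda> $ i $ j\<bar> \<le> (h * coupling_size)\<^sup>2"
        using transition_expansion[OF sr assms(3), of i j] False by (simp add: h_def)
      moreover have "- (h * \<Lambda> $ i $ j) \<le> h * \<bar>\<Lambda> $ i $ j\<bar>"
        using hc(3) by (metis abs_ge_minus_self abs_mult abs_of_pos)
      ultimately have "?e i j \<le> h * \<bar>\<Lambda> $ i $ j\<bar> + (h * coupling_size)\<^sup>2"
        by (simp only: abs_le_iff) linarith
      then have "?e i j * expectation (?g i) \<le> (h * \<bar>\<Lambda> $ i $ j\<bar> + (h * coupling_size)\<^sup>2) * expectation (?g i)"
        using g by (intro mult_right_mono)
      also have "\<dots> \<le> (h * \<bar>\<Lambda> $ i $ j\<bar> + (h * coupling_size)\<^sup>2) * 1"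
        using g hc(3) by (intro mult_left_mono) auto
      finally show ?thesis using E False by simp
    qed (use hc(3) in auto)
  qed
  also have "\<dots> = h * coupling_size + (real CARD('m))\<^sup>2 * (h * coupling_size)\<^sup>2"
    unfolding double_sum_add_const by (simp add: coupling_size_def sum_distrib_left)
  also have "(h * coupling_size)\<^sup>2 \<le> h * coupling_size"
    using mult_left_mono[OF hc(2) hc(1)] by (simp add: power2_eq_square)
  finally show ?thesis by (simp add: jump_rate_def h_def algebra_simps mult_left_mono)
qed

text \<open>The expected time spent away from the initial index is of second order, by Fubini's theorem.\<close>

lemma expected_occupation:
  assumes "0 \<le> s" "s \<le> t" "(t - s) * coupling_size \<le> 1"
  shows "expectation (\<lambda>\<omega>. LINT r:{s..t}|lborel. jumped s r \<omega>) \<le> jump_rate * (t - s)\<^sup>2"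
proof -
  interpret pair: pair_sigma_finite P lborel
    by unfold_locales
  have meas: "(\<lambda>x. jumped s (snd x) (fst x)) \<in> borel_measurable (P \<Otimes>\<^sub>M lborel)"
    by measurable
  have "integrable (P \<Otimes>\<^sub>M lborel) (\<lambda>x. indicator (space P \<times> {s..t}) x *\<^sub>R jumped s (snd x) (fst x))"
    using meas jumped_bounded assms(2)
    by (intro integrableI_bounded_set_indicator[where B = 1])
       (auto simp: lborel.emeasure_pair_measure_Times emeasure_space_1)
  then have "integrable (P \<Otimes>\<^sub>M lborel) (\<lambda>(\<omega>, r). indicator {s..t} r *\<^sub>R jumped s r \<omega>)"
    by (rule Bochner_Integration.integrable_cong[THEN iffD1, rotated 2])
       (auto simp: space_pair_measure indicator_def)
  from pair.Fubini_integral[OF this]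
  have "expectation (\<lambda>\<omega>. LINT r:{s..t}|lborel. jumped s r \<omega>) = (LINT r|lborel. expectation (\<lambda>\<omega>. indicator {s..t} r *\<^sub>R jumped s r \<omega>))"
    by (simp add: set_lebesgue_integral_def)
  also have "\<dots> = (LINT r:{s..t}|lborel. expectation (jumped s r))"
    by (simp add: set_lebesgue_integral_def)
  also have "\<dots> \<le> (LINT r:{s..t}|lborel. jump_rate * (t - s))"
  proof (rule set_integral_mono)
    have "(\<lambda>r. expectation (jumped s r)) \<in> borel_measurable borel"
      by measurable
    moreover have "norm (expectation (jumped s r)) \<le> 1" for r
      using expectation_bounded[of "jumped s r" 1] jumped_bounded by simp
    ultimately show "set_integrable lborel {s..t} (\<lambda>r. expectation (jumped s r))"
      by (rule set_integrable_bounded_Icc)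
    show "set_integrable lborel {s..t} (\<lambda>r. jump_rate * (t - s))"
      by (rule set_integrable_bounded_Icc[where K = "\<bar>jump_rate * (t - s)\<bar>"]) auto
    fix r assume r: "r \<in> {s..t}"
    then have "(r - s) * coupling_size \<le> 1"
      using assms coupling_size_nonneg mult_right_mono[of "r - s" "t - s" coupling_size] by auto
    then have "expectation (jumped s r) \<le> jump_rate * (r - s)"
      using r assms by (intro jump_probability) auto
    also have "\<dots> \<le> jump_rate * (t - s)" using r jump_rate_nonneg by (intro mult_left_mono) auto
    finally show "expectation (jumped s r) \<le> jump_rate * (t - s)" .
  qed
  also have "\<dots> = jump_rate * (t - s)\<^sup>2"
    using assms(2) by (simp add: set_lebesgue_integral_def power2_eq_square)
  finally show ?thesis .
qed

text \<open>As the rows of \<open>\<Lambda>\<close> sum to zero, the mean decrease of \<open>c\<close> in one transition is, to first order, the coupling term.\<close>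

lemma sum_coupling_differences:
  "(\<Sum>j\<in>UNIV. - (h * \<Lambda> $ i $ j) * (c i - c j)) = h * (\<Sum>j\<in>UNIV. \<Lambda> $ i $ j * c j)"
proof -
  have "(\<Sum>j\<in>UNIV. - (h * \<Lambda> $ i $ j) * (c i - c j)) =
      h * (\<Sum>j\<in>UNIV. \<Lambda> $ i $ j * c j) - h * c i * (\<Sum>j\<in>UNIV. \<Lambda> $ i $ j)"
    by (simp add: sum_distrib_left sum_subtractf[symmetric] algebra_simps)
  then show ?thesis by (simp add: row_sums)
qed

text \<open>The mean effect of the switches over a short time, with the trajectory frozen at its \<open>\<F>\<^sub>s\<close>-measurable
  position. To first order it is the coupling term \<open>\<Lambda>\<^sup>i \<cdot> u\<close>, which will cancel the one in \<open>path_step_frozen\<close>.\<close>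

lemma expected_switching:
  assumes st: "0 \<le> s" "s < t" "(t - s) * coupling_size \<le> 1" and A: "A \<in> sets (index_filtration s)"
  shows "expectation (\<lambda>\<omega>. indicator A \<omega> * (U (\<omega> s) (traj \<omega> s) - U (\<omega> t) (traj \<omega> s)))
    \<le> (t - s) * expectation (\<lambda>\<omega>. indicator A \<omega> * (\<Lambda> $ \<omega> s \<bullet> u (torus_proj (traj \<omega> s))))
      + (real CARD('m))\<^sup>2 * (2 * u_bound * ((t - s) * coupling_size)\<^sup>2)"
proof -
  define h where "h = t - s"
  let ?f = "\<lambda>i j \<omega>. if \<omega> s = i \<and> \<omega> t = j then 1 else (0::real)"
  let ?g = "\<lambda>i \<omega>. if \<omega> s = i then 1 else (0::real)"
  let ?e = "\<lambda>i j. matrix_exp (- (t - s) *\<^sub>R \<Lambda>) $ i $ j"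
  define X where "X i j \<omega> = indicator A \<omega> * (U i (traj \<omega> s) - U j (traj \<omega> s))" for i j \<omega>
  have XF: "X i j \<in> borel_measurable (index_filtration s)" for i j
    using A traj_adapted[OF st(1)] unfolding X_def by measurable
  have X [measurable]: "X i j \<in> borel_measurable index_algebra" for i j
    by (rule measurable_from_subalg[OF subalgebra_index_filtration XF])
  have Xb: "\<bar>X i j \<omega>\<bar> \<le> 2 * u_bound" for i j \<omega>
    using u_bounded(1) u_bounded(2)[of i "traj \<omega> s"] u_bounded(2)[of j "traj \<omega> s"] unfolding X_def
    by (auto simp: indicator_def)
  have int: "integrable P (\<lambda>\<omega>. X i j \<omega> * ?f i j \<omega>)" "integrable P (\<lambda>\<omega>. X i j \<omega> * ?g i \<omega>)" for i j
    by (rule integrable_bounded[where K = "2 * u_bound"]; use Xb[of i j] u_bounded(1) in auto)+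
  have W: "(\<lambda>\<omega>. indicator A \<omega> * (U (\<omega> s) (traj \<omega> s) - U (\<omega> t) (traj \<omega> s))) =
      (\<lambda>\<omega>. \<Sum>i\<in>UNIV. \<Sum>j\<in>UNIV. X i j \<omega> * ?f i j \<omega>)"
    unfolding two_point_expansion by (simp add: X_def)
  have "expectation (\<lambda>\<omega>. indicator A \<omega> * (U (\<omega> s) (traj \<omega> s) - U (\<omega> t) (traj \<omega> s)))
      = (\<Sum>i\<in>UNIV. \<Sum>j\<in>UNIV. expectation (\<lambda>\<omega>. X i j \<omega> * ?f i j \<omega>))"
    unfolding W by (rule expectation_double_sum[OF int(1)])
  also have "\<dots> \<le> (\<Sum>i\<in>UNIV. \<Sum>j\<in>UNIV. - (h * \<Lambda> $ i $ j) * expectation (\<lambda>\<omega>. X i j \<omega> * ?g i \<omega>) + 2 * u_bound * (h * coupling_size)\<^sup>2)"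
  proof (intro sum_mono)
    fix i j :: 'm
    have E: "expectation (\<lambda>\<omega>. X i j \<omega> * ?f i j \<omega>) = ?e i j * expectation (\<lambda>\<omega>. X i j \<omega> * ?g i \<omega>)"
      by (rule path_law_markov[OF law st(1,2) XF Xb])
    let ?x = "expectation (\<lambda>\<omega>. X i j \<omega> * ?g i \<omega>)"
    have x: "\<bar>?x\<bar> \<le> 2 * u_bound"
      by (rule expectation_bounded) (use Xb[of i j] u_bounded(1) in auto)
    show "expectation (\<lambda>\<omega>. X i j \<omega> * ?f i j \<omega>) \<le> - (h * \<Lambda> $ i $ j) * ?x + 2 * u_bound * (h * coupling_size)\<^sup>2"
    proof (cases "i = j")
      case True
      then have "X i j = (\<lambda>_. 0)" by (simp add: X_def[abs_def])
      then show ?thesis using u_bounded(1) by simp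
    next
      case False
      have near: "\<bar>?e i j + h * \<Lambda> $ i $ j\<bar> \<le> (h * coupling_size)\<^sup>2"
        using transition_expansion[OF st(2,3), of i j] False by (simp add: h_def)
      have "?e i j * ?x - (- (h * \<Lambda> $ i $ j) * ?x) = (?e i j + h * \<Lambda> $ i $ j) * ?x" by (simp add: algebra_simps)
      also have "\<dots> \<le> \<bar>?e i j + h * \<Lambda> $ i $ j\<bar> * \<bar>?x\<bar>" by (rule order.trans[OF abs_ge_self]) (simp add: abs_mult)
      also have "\<bar>?e i j + h * \<Lambda> $ i $ j\<bar> * \<bar>?x\<bar> \<le> (h * coupling_size)\<^sup>2 * (2 * u_bound)"
        by (rule mult_mono[OF near x]) auto
      also have "\<dots> = 2 * u_bound * (h * coupling_size)\<^sup>2" by (simp only: mult.commute)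
      finally show ?thesis unfolding E by linarith
    qed
  qed
  also have "\<dots> = (\<Sum>i\<in>UNIV. \<Sum>j\<in>UNIV. - (h * \<Lambda> $ i $ j) * expectation (\<lambda>\<omega>. X i j \<omega> * ?g i \<omega>))
      + (real CARD('m))\<^sup>2 * (2 * u_bound * (h * coupling_size)\<^sup>2)"
    by (rule double_sum_add_const)
  also have "(\<Sum>i\<in>UNIV. \<Sum>j\<in>UNIV. - (h * \<Lambda> $ i $ j) * expectation (\<lambda>\<omega>. X i j \<omega> * ?g i \<omega>))
      = expectation (\<lambda>\<omega>. \<Sum>i\<in>UNIV. \<Sum>j\<in>UNIV. - (h * \<Lambda> $ i $ j) * (X i j \<omega> * ?g i \<omega>))"
  proof -
    have "integrable P (\<lambda>\<omega>. - (h * \<Lambda> $ i $ j) * (X i j \<omega> * ?g i \<omega>))" for i j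
      using int(2) by (rule integrable_mult_right)
    from expectation_double_sum[OF this] show ?thesis by (simp only: integral_mult_right_zero)
  qed
  also have "(\<lambda>\<omega>. \<Sum>i\<in>UNIV. \<Sum>j\<in>UNIV. - (h * \<Lambda> $ i $ j) * (X i j \<omega> * ?g i \<omega>))
      = (\<lambda>\<omega>. h * (indicator A \<omega> * (\<Lambda> $ \<omega> s \<bullet> u (torus_proj (traj \<omega> s)))))"
  proof
    fix \<omega> :: "real \<Rightarrow> 'm"
    have inner: "(\<Sum>j\<in>UNIV. - (h * \<Lambda> $ i $ j) * (X i j \<omega> * ?g i \<omega>)) =
       (if \<omega> s = i then indicator A \<omega> * (\<Sum>j\<in>UNIV. - (h * \<Lambda> $ i $ j) * (U i (traj \<omega> s) - U j (traj \<omega> s))) else 0)" for i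
      by (auto simp: X_def sum_distrib_left mult_ac)
    show "(\<Sum>i\<in>UNIV. \<Sum>j\<in>UNIV. - (h * \<Lambda> $ i $ j) * (X i j \<omega> * ?g i \<omega>))
        = h * (indicator A \<omega> * (\<Lambda> $ \<omega> s \<bullet> u (torus_proj (traj \<omega> s))))"
      unfolding inner sum_coupling_differences[of h _ "\<lambda>j. U j (traj \<omega> s)"]
      by (simp add: inner_vec_def U_def mult_ac)
  qed
  finally show ?thesis by (simp add: h_def)
qed

text \<open>The estimate along the trajectory with the index frozen at \<open>i\<close>, the coupling term being evaluated at the
  left endpoint. Over the step the trajectory moves by at most \<open>R (t - s)\<close>, so this costs the modulus \<open>\<eta>\<close>.\<close>

lemma path_step_frozen:
  assumes \<omega>: "\<omega> \<in> index_paths" and st: "0 \<le> s" "s \<le> t"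
    and \<eta>: "\<And>j z z'. norm (z - z') \<le> R * (t - s) \<Longrightarrow> \<bar>U j z - U j z'\<bar> \<le> \<eta>"
  shows "U i (traj \<omega> s) - U i (traj \<omega> t) \<le> (LINT r:{s..t}|lborel. running i \<omega> r)
      - (t - s) * (\<Lambda> $ i \<bullet> u (torus_proj (traj \<omega> s))) + (t - s) * (coupling_size * \<eta>)"
proof -
  let ?c = "\<lambda>r. \<Lambda> $ i \<bullet> u (torus_proj (traj \<omega> r))"
  let ?f = "\<lambda>r. running i \<omega> r - ?c r"
  have c_eq: "?c r = (\<Sum>j\<in>UNIV. \<Lambda> $ i $ j * U j (traj \<omega> r))" for r
    by (simp add: inner_vec_def U_def)
  have trajm: "traj \<omega> \<in> borel_measurable borel"
    by (rule path_section_measurable[OF traj_measurable \<omega>])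
  have cm: "?c \<in> borel_measurable borel"
    unfolding c_eq using measurable_compose[OF trajm U_borel] by measurable
  have fm: "?f \<in> borel_measurable borel"
    using running_borel(1)[OF \<omega>, of i] cm by measurable
  have cb: "\<bar>?c r\<bar> \<le> coupling_size * u_bound" for r
    unfolding c_eq by (rule coupling_row_bound) (rule u_bounded)
  have fb: "norm (?f r) \<le> cost_bound + coupling_size * u_bound" for r
    using cb[of r] cost_bounded(2)[OF \<omega>, of i r] by (auto simp: abs_le_iff)
  have frc: "(?f \<longlongrightarrow> ?f r) (at_right r)" if "0 \<le> r" for r
  proof -
    have "isCont (U j) (traj \<omega> r)" for j
      using U_continuous by (simp add: continuous_on_eq_continuous_at)
    then show ?thesis unfolding c_eq
      by (intro tendsto_intros running_right_continuous \<omega> that isCont_tendsto_compose[of _ "U _"] traj_right_limit)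
  qed
  have "u (torus_proj (traj \<omega> s)) $ i - u (torus_proj (traj \<omega> t)) $ i \<le>
      (LINT r:{s..t}|lborel. ?f r) - (LINT r:{s..s}|lborel. ?f r)"
  proof (rule subsolution_along_curve[OF ham sub st(2), where \<xi> = "\<xi> \<omega>" and R = R])
    show "continuous_on {s..t} (traj \<omega>)"
      by (rule continuous_on_subset[OF traj_continuous[OF \<omega>]]) (use st in auto)
    show "continuous_on {s..t} (\<lambda>x. LINT r:{s..x}|lborel. ?f r)"
      by (rule continuous_on_subset[OF set_integral_continuous[OF fm fb]]) auto
    fix r assume r: "s \<le> r" "r < t"
    show "(traj \<omega> has_vector_derivative \<xi> \<omega> r) (at r within {r..t})"
      by (rule traj_right_derivative[OF \<omega>]) (use r st in auto)
    show "norm (\<xi> \<omega> r) \<le> R" by (rule control_bounded[OF \<omega>])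
    have "((\<lambda>x. LINT r:{s..x}|lborel. ?f r) has_real_derivative ?f r) (at r within {r..t})"
      unfolding has_real_derivative_iff_has_vector_derivative
      by (rule set_integral_right_derivative[OF fm fb r frc]) (use r st in auto)
    then show "((\<lambda>x. LINT r:{s..x}|lborel. ?f r) has_real_derivative
        (lagrangian (H i) (torus_proj (traj \<omega> r)) (- \<xi> \<omega> r) + \<alpha> - \<Lambda> $ i \<bullet> u (torus_proj (traj \<omega> r)))) (at r within {r..t})"
      by (simp add: running_def)
  qed
  also have "(LINT r:{s..s}|lborel. ?f r) = 0"
    using set_integral_bounded_norm[OF fm fb, of s s] by simp
  also have "(LINT r:{s..t}|lborel. ?f r) \<le> (LINT r:{s..t}|lborel. running i \<omega> r + (coupling_size * \<eta> - ?c s))"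
  proof (rule set_integral_mono)
    show "set_integrable lborel {s..t} ?f" by (rule set_integrable_bounded_Icc[OF fm fb])
    have "(\<lambda>r. running i \<omega> r + (coupling_size * \<eta> - ?c s)) \<in> borel_measurable borel"
      using running_borel(1)[OF \<omega>, of i] by measurable
    moreover have "norm (running i \<omega> r + (coupling_size * \<eta> - ?c s)) \<le> cost_bound + \<bar>coupling_size * \<eta> - ?c s\<bar>" for r
      using cost_bounded(2)[OF \<omega>, of i r] by (auto simp: abs_le_iff)
    ultimately show "set_integrable lborel {s..t} (\<lambda>r. running i \<omega> r + (coupling_size * \<eta> - ?c s))"
      by (rule set_integrable_bounded_Icc)
    fix r assume r: "r \<in> {s..t}"
    have "\<bar>U j (traj \<omega> s) - U j (traj \<omega> r)\<bar> \<le> \<eta>" for j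
    proof (rule \<eta>)
      have "norm (traj \<omega> r - traj \<omega> s) \<le> R * (r - s)" using traj_increment[OF \<omega>, of s r] r st by auto
      also have "\<dots> \<le> R * (t - s)"
        using r R_nonneg by (intro mult_left_mono) auto
      finally show "norm (traj \<omega> s - traj \<omega> r) \<le> R * (t - s)" by (simp add: norm_minus_commute)
    qed
    then have "\<bar>\<Sum>j\<in>UNIV. \<Lambda> $ i $ j * (U j (traj \<omega> s) - U j (traj \<omega> r))\<bar> \<le> coupling_size * \<eta>" by (rule coupling_row_bound)
    moreover have "(\<Sum>j\<in>UNIV. \<Lambda> $ i $ j * (U j (traj \<omega> s) - U j (traj \<omega> r))) = ?c s - ?c r"
      unfolding c_eq by (simp add: right_diff_distrib sum_subtractf)
    ultimately show "?f r \<le> running i \<omega> r + (coupling_size * \<eta> - ?c s)" by (simp add: abs_le_iff)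
  qed
  also have "\<dots> = (LINT r:{s..t}|lborel. running i \<omega> r) + (LINT r:{s..t}|lborel. coupling_size * \<eta> - ?c s)"
    by (rule set_integral_add(2))
       (use set_integrable_bounded_Icc[OF running_borel(1)[OF \<omega>], of i cost_bound] cost_bounded(2)[OF \<omega>, of i]
          set_integrable_bounded_Icc[of "\<lambda>_. coupling_size * \<eta> - ?c s" "\<bar>coupling_size * \<eta> - ?c s\<bar>"] in auto)
  also have "(LINT r:{s..t}|lborel. coupling_size * \<eta> - ?c s) = (t - s) * (coupling_size * \<eta> - ?c s)"
    using st by (simp add: set_lebesgue_integral_def)
  finally show ?thesis by (simp add: U_def algebra_simps)
qed

text \<open>The running costs for the frozen and for the actual index differ only after a jump.\<close>

lemma running_frozen:
  assumes \<omega>: "\<omega> \<in> index_paths" and st: "0 \<le> s" "s \<le> t"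
  shows "(LINT r:{s..t}|lborel. running (\<omega> s) \<omega> r) \<le> action \<omega> t - action \<omega> s
     + 2 * cost_bound * (LINT r:{s..t}|lborel. jumped s r \<omega>)"
proof -
  have jm: "(\<lambda>r. jumped s r \<omega>) \<in> borel_measurable borel"
    by (rule path_section_measurable[OF jumped_measurable \<omega>])
  have ji: "set_integrable lborel {s..t} (\<lambda>r. 2 * cost_bound * jumped s r \<omega>)"
    using set_integrable_bounded_Icc[OF jm, of 1] jumped_bounded by (intro set_integrable_mult_right) auto
  have ri: "set_integrable lborel {s..t} (\<lambda>r. running (\<omega> r) \<omega> r)"
    using set_integrable_bounded_Icc[OF running_borel(2)[OF \<omega>], of cost_bound] cost_bounded(2)[OF \<omega>] by auto
  have "(LINT r:{s..t}|lborel. running (\<omega> s) \<omega> r) \<le> (LINT r:{s..t}|lborel. running (\<omega> r) \<omega> r + 2 * cost_bound * jumped s r \<omega>)"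
  proof (rule set_integral_mono)
    show "set_integrable lborel {s..t} (running (\<omega> s) \<omega>)"
      using set_integrable_bounded_Icc[OF running_borel(1)[OF \<omega>], of "\<omega> s" cost_bound] cost_bounded(2)[OF \<omega>] by auto
    show "set_integrable lborel {s..t} (\<lambda>r. running (\<omega> r) \<omega> r + 2 * cost_bound * jumped s r \<omega>)"
      by (rule set_integral_add(1)[OF ri ji])
    show "running (\<omega> s) \<omega> r \<le> running (\<omega> r) \<omega> r + 2 * cost_bound * jumped s r \<omega>" for r
      using cost_bounded(2)[OF \<omega>, of "\<omega> s" r] cost_bounded(2)[OF \<omega>, of "\<omega> r" r] by (auto simp: jumped_def)
  qed
  also have "\<dots> = (LINT r:{s..t}|lborel. running (\<omega> r) \<omega> r) + (LINT r:{s..t}|lborel. 2 * cost_bound * jumped s r \<omega>)"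
    by (rule set_integral_add(2)[OF ri ji])
  finally show ?thesis using action_increment[OF \<omega> st] by simp
qed

text \<open>Collects the errors of a single step: moving the coupling term to the left endpoint, replacing
  \<open>u(y(t))\<close> by \<open>u(y(s))\<close> on a jump, freezing the index in the running cost, and the second-order terms of
  the transition matrix.\<close>

definition step_constant :: real where
  "step_constant = coupling_size + 2 * jump_rate + 2 * cost_bound * jump_rate
     + (real CARD('m))\<^sup>2 * (2 * u_bound * coupling_size\<^sup>2)"

text \<open>The payoff is almost a submartingale over a short step: the expected decrease is of smaller order than
  the length of the step. The decrease splits into the motion with the index frozen, controlled pathwise, and
  the switch at the final position. The latter is compared with the switch at the initial position, since only
  \<open>traj \<omega> s\<close> is measurable with respect to the past; the error occurs only when a jump happens, which
  gains a factor \<open>t - s\<close>. The coupling terms of the two parts cancel in expectation.\<close>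

lemma one_step:
  assumes st: "0 \<le> s" "s < t" "(t - s) * coupling_size \<le> 1" and A: "A \<in> sets (index_filtration s)"
    and \<eta>: "\<And>j z z'. norm (z - z') \<le> R * (t - s) \<Longrightarrow> \<bar>U j z - U j z'\<bar> \<le> \<eta>"
  shows "expectation (\<lambda>\<omega>. indicator A \<omega> * (payoff \<omega> s - payoff \<omega> t)) \<le> (t - s) * (step_constant * (\<eta> + (t - s)))"
proof -
  define h where "h = t - s"
  have h: "0 < h" using st by (simp add: h_def)
  have \<eta>0: "0 \<le> \<eta>"
    using \<eta>[of 0 0 undefined] h R_nonneg by (simp add: h_def)
  let ?Q = "\<lambda>\<omega>. \<Lambda> $ \<omega> s \<bullet> u (torus_proj (traj \<omega> s))"
  let ?W = "\<lambda>\<omega>. U (\<omega> s) (traj \<omega> s) - U (\<omega> t) (traj \<omega> s)"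
  let ?N = "\<lambda>\<omega>. LINT r:{s..t}|lborel. jumped s r \<omega>"
  have Q_eq: "?Q \<omega> = (\<Sum>j\<in>UNIV. \<Lambda> $ \<omega> s $ j * U j (traj \<omega> s))" for \<omega>
    by (simp add: inner_vec_def U_def)
  have [measurable]: "A \<in> sets index_algebra"
    using A subalgebra_index_filtration[of s] by (auto simp: subalgebra_def)
  have meas [measurable]: "?Q \<in> borel_measurable index_algebra" "?W \<in> borel_measurable index_algebra"
      "?N \<in> borel_measurable index_algebra"
  proof -
    have [measurable]: "(\<lambda>\<omega>. U (\<omega> r) (traj \<omega> s)) \<in> borel_measurable index_algebra" for r
      by (rule measurable_compose_countable[where f = "\<lambda>i \<omega>. U i (traj \<omega> s)" and g = "\<lambda>\<omega>. \<omega> r"]) measurable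
    show "?W \<in> borel_measurable index_algebra" by measurable
    show "?Q \<in> borel_measurable index_algebra" unfolding Q_eq
      by (rule measurable_compose_countable[where f = "\<lambda>i \<omega>. \<Sum>j\<in>UNIV. \<Lambda> $ i $ j * U j (traj \<omega> s)" and g = "\<lambda>\<omega>. \<omega> s"]) measurable
    show "?N \<in> borel_measurable index_algebra"
      unfolding set_lebesgue_integral_def by measurable
  qed
  have Nb: "0 \<le> ?N \<omega>" "?N \<omega> \<le> h" if "\<omega> \<in> index_paths" for \<omega>
  proof -
    have jm: "(\<lambda>r. jumped s r \<omega>) \<in> borel_measurable borel"
      by (rule path_section_measurable[OF jumped_measurable that])
    show "0 \<le> ?N \<omega>" unfolding set_lebesgue_integral_def
      by (intro integral_nonneg_AE AE_I2) (auto simp: jumped_bounded)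
    show "?N \<omega> \<le> h" using set_integral_bounded_norm[OF jm, of 1 s t] jumped_bounded st by (auto simp: h_def)
  qed
  have Qb: "\<bar>?Q \<omega>\<bar> \<le> coupling_size * u_bound" for \<omega>
    unfolding Q_eq by (rule coupling_row_bound) (rule u_bounded)
  have path: "indicator A \<omega> * (payoff \<omega> s - payoff \<omega> t) \<le> indicator A \<omega> * ?W \<omega> - h * (indicator A \<omega> * ?Q \<omega>)
      + h * (coupling_size * \<eta>) + 2 * cost_bound * ?N \<omega> + 2 * \<eta> * jumped s t \<omega>" if \<omega>: "\<omega> \<in> index_paths" for \<omega>
  proof -
    have "norm (traj \<omega> t - traj \<omega> s) \<le> R * (t - s)" by (rule traj_increment[OF \<omega>]) (use st in auto)
    then have mv: "\<bar>U j (traj \<omega> t) - U j (traj \<omega> s)\<bar> \<le> \<eta>" for j by (rule \<eta>)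
    have "U (\<omega> s) (traj \<omega> t) - U (\<omega> t) (traj \<omega> t) \<le> ?W \<omega> + 2 * \<eta> * jumped s t \<omega>"
      using mv[of "\<omega> s"] mv[of "\<omega> t"] by (cases "\<omega> t = \<omega> s") (auto simp: jumped_def abs_le_iff)
    moreover have "U (\<omega> s) (traj \<omega> s) - U (\<omega> s) (traj \<omega> t) \<le> (LINT r:{s..t}|lborel. running (\<omega> s) \<omega> r)
      - h * ?Q \<omega> + h * (coupling_size * \<eta>)"
      unfolding h_def by (rule path_step_frozen[OF \<omega> st(1) less_imp_le[OF st(2)] \<eta>])
    moreover have "(LINT r:{s..t}|lborel. running (\<omega> s) \<omega> r) \<le> action \<omega> t - action \<omega> s + 2 * cost_bound * ?N \<omega>"
      by (rule running_frozen[OF \<omega> st(1) less_imp_le[OF st(2)]])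
    ultimately have "payoff \<omega> s - payoff \<omega> t \<le> ?W \<omega> - h * ?Q \<omega> + h * (coupling_size * \<eta>) + 2 * cost_bound * ?N \<omega> + 2 * \<eta> * jumped s t \<omega>"
      unfolding payoff_def by linarith
    moreover have "0 \<le> h * (coupling_size * \<eta>)" "0 \<le> 2 * cost_bound * ?N \<omega>" "0 \<le> 2 * \<eta> * jumped s t \<omega>"
      using h \<eta>0 coupling_size_nonneg cost_bounded(1) Nb(1)[OF \<omega>] jumped_bounded by auto
    ultimately show ?thesis by (cases "\<omega> \<in> A") auto
  qed
  have iW: "integrable P (\<lambda>\<omega>. indicator A \<omega> * ?W \<omega>)"
  proof (rule integrable_bounded[where K = "2 * u_bound"])
    show "\<bar>indicator A \<omega> * ?W \<omega>\<bar> \<le> 2 * u_bound" for \<omega>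
      using u_bounded(1) u_bounded(2)[of "\<omega> s" "traj \<omega> s"] u_bounded(2)[of "\<omega> t" "traj \<omega> s"] by (auto simp: indicator_def)
  qed measurable
  have iQ: "integrable P (\<lambda>\<omega>. indicator A \<omega> * ?Q \<omega>)"
    by (rule integrable_bounded[where K = "coupling_size * u_bound"])
       (use Qb coupling_size_nonneg u_bounded(1) in \<open>auto simp: indicator_def\<close>)
  have iN: "integrable P ?N"
    by (rule integrable_bounded[where K = h]) (use Nb in auto)
  have iJ: "integrable P (jumped s t)"
    by (rule integrable_bounded[where K = 1]) (use jumped_bounded in auto)
  have iZ: "integrable P (\<lambda>\<omega>. indicator A \<omega> * (payoff \<omega> s - payoff \<omega> t))"
  proof (rule integrable_bounded)
    fix \<omega> :: "real \<Rightarrow> 'm" assume "\<omega> \<in> index_paths"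
    then show "\<bar>indicator A \<omega> * (payoff \<omega> s - payoff \<omega> t)\<bar> \<le> (u_bound + cost_bound * s) + (u_bound + cost_bound * t)"
      using payoff_bounded[of \<omega> s] payoff_bounded[of \<omega> t] st u_bounded(1) cost_bounded(1) by (auto simp: indicator_def abs_le_iff)
  qed measurable
  have "expectation (\<lambda>\<omega>. indicator A \<omega> * (payoff \<omega> s - payoff \<omega> t)) \<le>
     expectation (\<lambda>\<omega>. indicator A \<omega> * ?W \<omega> - h * (indicator A \<omega> * ?Q \<omega>)
      + h * (coupling_size * \<eta>) + 2 * cost_bound * ?N \<omega> + 2 * \<eta> * jumped s t \<omega>)"
    by (rule integral_mono[OF iZ]) (use iW iQ iN iJ path in \<open>auto simp: space_P\<close>)
  also have "\<dots> = expectation (\<lambda>\<omega>. indicator A \<omega> * ?W \<omega>) - h * expectation (\<lambda>\<omega>. indicator A \<omega> * ?Q \<omega>)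
      + h * (coupling_size * \<eta>) + 2 * cost_bound * expectation ?N + 2 * \<eta> * expectation (jumped s t)"
    using iW iQ iN iJ by (simp add: prob_space)
  also have "\<dots> \<le> (real CARD('m))\<^sup>2 * (2 * u_bound * (h * coupling_size)\<^sup>2) + h * (coupling_size * \<eta>)
      + 2 * cost_bound * (jump_rate * h\<^sup>2) + 2 * \<eta> * (jump_rate * h)"
  proof -
    have "2 * cost_bound * expectation ?N \<le> 2 * cost_bound * (jump_rate * h\<^sup>2)"
      unfolding h_def using cost_bounded(1) st by (intro mult_left_mono expected_occupation) auto
    moreover have "2 * \<eta> * expectation (jumped s t) \<le> 2 * \<eta> * (jump_rate * h)"
      unfolding h_def using \<eta>0 st by (intro mult_left_mono jump_probability) auto
    ultimately show ?thesis
      using expected_switching[OF st(1-3) A] unfolding h_def by linarith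
  qed
  also have "\<dots> \<le> h * (step_constant * (\<eta> + h))"
  proof -
    let ?k = "(real CARD('m))\<^sup>2 * (2 * u_bound * coupling_size\<^sup>2)"
    have k: "0 \<le> ?k" "0 \<le> coupling_size" "0 \<le> jump_rate" "0 \<le> 2 * cost_bound * jump_rate"
      using u_bounded(1) cost_bounded(1) coupling_size_nonneg jump_rate_nonneg by auto
    have "step_constant * (\<eta> + h) = ?k * h + coupling_size * \<eta> + 2 * cost_bound * jump_rate * h + 2 * \<eta> * jump_rate
        + (?k * \<eta> + coupling_size * h + 2 * cost_bound * jump_rate * \<eta> + 2 * h * jump_rate)"
      by (simp add: step_constant_def algebra_simps)
    moreover have "0 \<le> ?k * \<eta> + coupling_size * h + 2 * cost_bound * jump_rate * \<eta> + 2 * h * jump_rate"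
      using k \<eta>0 h u_bounded(1) cost_bounded(1) by (intro add_nonneg_nonneg mult_nonneg_nonneg) auto
    ultimately have "?k * h + coupling_size * \<eta> + 2 * cost_bound * jump_rate * h + 2 * \<eta> * jump_rate \<le> step_constant * (\<eta> + h)"
      by linarith
    from mult_left_mono[OF this, of h] h show ?thesis
      by (simp add: power2_eq_square algebra_simps)
  qed
  finally show ?thesis by (simp add: h_def)
qed

end

section \<open>Optional stopping\<close>

lemma stopped_telescope:
  fixes f :: "nat \<Rightarrow> real"
  shows "(\<Sum>k<N. if k < m then f k - f (Suc k) else 0) = f 0 - f (min m N)"
proof (induction N)
  case (Suc N)
  show ?case
  proof (cases "N < m")
    case True
    then have "min m N = N" "min m (Suc N) = Suc N" by auto
    then show ?thesis using Suc True by simp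
  next
    case False
    then have "min m N = m" "min m (Suc N) = m" by auto
    then show ?thesis using Suc False by simp
  qed
qed simp

context controlled_system
begin

lemma step_constant_nonneg: "0 \<le> step_constant"
  using u_bounded(1) cost_bounded(1) coupling_size_nonneg jump_rate_nonneg unfolding step_constant_def
  by (intro mult_nonneg_nonneg add_nonneg_nonneg) auto

text \<open>Optional stopping on the grid of mesh \<open>h\<close>, for the stopping time rounded up to the grid. The step from
  \<open>k h\<close> to \<open>(k + 1) h\<close> is taken on the event \<open>k h < \<tau>\<close>, which belongs to \<open>\<F>\<^bsub>kh\<^esub>\<close>. There are at most
  \<open>(T + 1) / h\<close> steps, so the one-step errors add up to a bound that vanishes with \<open>h\<close>.\<close>

lemma grid_stopping_bound:
  assumes \<tau>: "\<tau> \<in> borel_measurable index_algebra" "stopping_time index_filtration \<tau>"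
    and \<tau>b: "\<And>\<omega>. \<omega> \<in> index_paths \<Longrightarrow> 0 \<le> \<tau> \<omega> \<and> \<tau> \<omega> \<le> T" "0 \<le> T"
    and h: "h = 1 / real (Suc n)" "h * coupling_size \<le> 1"
    and \<eta>: "\<And>j z z'. norm (z - z') \<le> R * h \<Longrightarrow> \<bar>U j z - U j z'\<bar> \<le> \<eta>"
  shows "expectation (\<lambda>\<omega>. payoff \<omega> 0 - payoff \<omega> (real (nat \<lceil>\<tau> \<omega> * real (Suc n)\<rceil>) * h)) \<le> (T + 1) * (step_constant * (\<eta> + h))"
proof -
  define m where "m \<omega> = nat \<lceil>\<tau> \<omega> * real (Suc n)\<rceil>" for \<omega>
  define N where "N = nat \<lceil>T * real (Suc n)\<rceil>"
  have h0: "0 < h" "h \<le> 1" "real (Suc n) * h = 1" by (auto simp: h(1) field_simps)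
  have mN: "m \<omega> \<le> N" if "\<omega> \<in> index_paths" for \<omega>
    unfolding m_def N_def using \<tau>b(1)[OF that] by (intro nat_mono ceiling_mono mult_right_mono) auto
  have lt_m: "k < m \<omega> \<longleftrightarrow> real k * h < \<tau> \<omega>" for k \<omega>
  proof -
    have "k < m \<omega> \<longleftrightarrow> real k < \<tau> \<omega> * real (Suc n)"
      unfolding m_def by (simp add: zless_nat_eq_int_zless less_ceiling_iff del: of_nat_Suc)
    also have "\<dots> \<longleftrightarrow> real k / real (Suc n) < \<tau> \<omega>" by (simp add: pos_divide_less_eq del: of_nat_Suc)
    finally show ?thesis by (simp add: h(1))
  qed
  define A where "A k = {\<omega> \<in> index_paths. \<not> \<tau> \<omega> \<le> real k * h}" for k :: nat
  have A: "A k \<in> sets (index_filtration (real k * h))" for k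
  proof -
    have "Measurable.pred (index_filtration (real k * h)) (\<lambda>\<omega>. \<tau> \<omega> \<le> real k * h)"
      using \<tau>(2) by (simp add: stopping_time_def)
    then have "{\<omega> \<in> space (index_filtration (real k * h)). \<not> \<tau> \<omega> \<le> real k * h} \<in> sets (index_filtration (real k * h))"
      by measurable
    then show ?thesis by (simp add: A_def space_index_filtration)
  qed
  have AM [measurable]: "A k \<in> sets index_algebra" for k
    using A[of k] subalgebra_index_filtration[of "real k * h"] by (auto simp: subalgebra_def)
  let ?D = "\<lambda>k \<omega>. indicator (A k) \<omega> * (payoff \<omega> (real k * h) - payoff \<omega> (real (Suc k) * h))"
  have tele: "payoff \<omega> 0 - payoff \<omega> (real (m \<omega>) * h) = (\<Sum>k<N. ?D k \<omega>)" if "\<omega> \<in> index_paths" for \<omega>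
  proof -
    have "?D k \<omega> = (if k < m \<omega> then payoff \<omega> (real k * h) - payoff \<omega> (real (Suc k) * h) else 0)" for k
      using that by (simp add: lt_m A_def indicator_def del: of_nat_Suc)
    then show ?thesis
      using stopped_telescope[of "m \<omega>" "\<lambda>k. payoff \<omega> (real k * h)" N] mN[OF that] by (simp del: of_nat_Suc)
  qed
  have int: "integrable P (?D k)" for k
  proof (rule integrable_bounded)
    fix \<omega> :: "real \<Rightarrow> 'm" assume "\<omega> \<in> index_paths"
    then show "\<bar>?D k \<omega>\<bar> \<le> (u_bound + cost_bound * (real k * h)) + (u_bound + cost_bound * (real (Suc k) * h))"
      using payoff_bounded[of \<omega> "real k * h"] payoff_bounded[of \<omega> "real (Suc k) * h"] h0 u_bounded(1) cost_bounded(1)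
      by (auto simp: indicator_def abs_le_iff simp del: of_nat_Suc)
  qed measurable
  have "expectation (\<lambda>\<omega>. payoff \<omega> 0 - payoff \<omega> (real (m \<omega>) * h)) = expectation (\<lambda>\<omega>. \<Sum>k<N. ?D k \<omega>)"
    by (rule Bochner_Integration.integral_cong) (auto simp: space_P tele)
  also have "\<dots> = (\<Sum>k<N. expectation (?D k))"
    by (rule Bochner_Integration.integral_sum) (rule int)
  also have "\<dots> \<le> (\<Sum>k<N. h * (step_constant * (\<eta> + h)))"
  proof (rule sum_mono)
    fix k
    have diff: "real (Suc k) * h - real k * h = h" by (simp add: algebra_simps)
    have "expectation (?D k) \<le> (real (Suc k) * h - real k * h) * (step_constant * (\<eta> + (real (Suc k) * h - real k * h)))"
      by (rule one_step[OF _ _ _ A]) (use h0 h(2) \<eta> in \<open>simp_all add: diff algebra_simps\<close>)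
    then show "expectation (?D k) \<le> h * (step_constant * (\<eta> + h))" unfolding diff .
  qed
  also have "\<dots> = (real N * h) * (step_constant * (\<eta> + h))" by simp
  also have "\<dots> \<le> (T + 1) * (step_constant * (\<eta> + h))"
  proof (rule mult_right_mono)
    have "real N \<le> T * real (Suc n) + 1" unfolding N_def using \<tau>b(2) by (simp del: of_nat_Suc)
    then have "real N * h \<le> (T * real (Suc n) + 1) * h" using h0 by (intro mult_right_mono) auto
    also have "\<dots> = T * (real (Suc n) * h) + h" by (simp only: distrib_right mult_1 mult.assoc)
    also have "\<dots> \<le> T + 1" unfolding h0(3) using h0(2) by simp
    finally show "real N * h \<le> T + 1" .
    have "0 \<le> \<eta>" using \<eta>[of 0 0 undefined] h0 R_nonneg by simp
    then show "0 \<le> step_constant * (\<eta> + h)"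
      using step_constant_nonneg h0 by simp
  qed
  finally show ?thesis by (simp add: m_def)
qed

lemma payoff_at_measurable:
  assumes "\<sigma> \<in> borel_measurable index_algebra"
  shows "(\<lambda>\<omega>. payoff \<omega> (\<sigma> \<omega>)) \<in> borel_measurable index_algebra"
  using assms by measurable

text \<open>The stopping times rounded up to finer and finer grids decrease to \<open>\<tau>\<close>, and the payoff is bounded and
  right-continuous, so the expectations converge.\<close>

lemma optional_stopping:
  assumes \<tau>: "\<tau> \<in> borel_measurable index_algebra" "stopping_time index_filtration \<tau>"
    and \<tau>b: "\<And>\<omega>. \<omega> \<in> index_paths \<Longrightarrow> 0 \<le> \<tau> \<omega> \<and> \<tau> \<omega> \<le> T" "0 \<le> T"
  shows "integrable P (\<lambda>\<omega>. payoff \<omega> (\<tau> \<omega>))" "expectation (\<lambda>\<omega>. payoff \<omega> 0) \<le> expectation (\<lambda>\<omega>. payoff \<omega> (\<tau> \<omega>))"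
proof -
  define h where "h n = 1 / real (Suc n)" for n
  define \<sigma> where "\<sigma> n \<omega> = real (nat \<lceil>\<tau> \<omega> * real (Suc n)\<rceil>) * h n" for n \<omega>
  have h0: "0 < h n" "h n \<le> 1" "real (Suc n) * h n = 1" for n by (auto simp: h_def field_simps)
  have hlim: "h \<longlonglongrightarrow> 0"
    using LIMSEQ_inverse_real_of_nat by (simp add: h_def[abs_def] divide_inverse)
  have \<sigma>: "\<tau> \<omega> \<le> \<sigma> n \<omega>" "\<sigma> n \<omega> \<le> \<tau> \<omega> + h n" if "\<omega> \<in> index_paths" for n \<omega>
  proof -
    have "\<tau> \<omega> * real (Suc n) \<le> real (nat \<lceil>\<tau> \<omega> * real (Suc n)\<rceil>)"
      "real (nat \<lceil>\<tau> \<omega> * real (Suc n)\<rceil>) \<le> \<tau> \<omega> * real (Suc n) + 1"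
      using \<tau>b(1)[OF that] by (simp_all add: real_nat_ceiling_ge del: of_nat_Suc)
    from mult_right_mono[OF this(1), of "h n"] mult_right_mono[OF this(2), of "h n"] h0[of n]
    have "\<tau> \<omega> * (real (Suc n) * h n) \<le> \<sigma> n \<omega>" "\<sigma> n \<omega> \<le> \<tau> \<omega> * (real (Suc n) * h n) + h n"
      by (simp_all add: \<sigma>_def mult.assoc distrib_right del: of_nat_Suc)
    then show "\<tau> \<omega> \<le> \<sigma> n \<omega>" "\<sigma> n \<omega> \<le> \<tau> \<omega> + h n" using h0(3)[of n] by (simp_all del: of_nat_Suc)
  qed
  have \<sigma>meas: "\<sigma> n \<in> borel_measurable index_algebra" for n
    unfolding \<sigma>_def using \<tau>(1) by measurable
  have bd: "\<bar>payoff \<omega> t\<bar> \<le> u_bound + cost_bound * (T + 1)" if "\<omega> \<in> index_paths" "0 \<le> t" "t \<le> T + 1" for \<omega> t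
    using payoff_bounded[OF that(1,2)] mult_left_mono[OF that(3) cost_bounded(1)] by linarith
  have int: "integrable P (\<lambda>\<omega>. payoff \<omega> (\<rho> \<omega>))"
    if "\<rho> \<in> borel_measurable index_algebra" "\<And>\<omega>. \<omega> \<in> index_paths \<Longrightarrow> 0 \<le> \<rho> \<omega> \<and> \<rho> \<omega> \<le> T + 1" for \<rho>
    by (rule integrable_bounded[where K = "u_bound + cost_bound * (T + 1)"])
       (use that bd payoff_at_measurable[OF that(1)] in \<open>auto simp: measurable_cong_sets[OF sets_P refl]\<close>)
  show intZ: "integrable P (\<lambda>\<omega>. payoff \<omega> (\<tau> \<omega>))"
    by (rule int[OF \<tau>(1)]) (use \<tau>b in force)
  have \<sigma>b: "0 \<le> \<sigma> n \<omega> \<and> \<sigma> n \<omega> \<le> T + 1" if "\<omega> \<in> index_paths" for n \<omega>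
    using \<sigma>[OF that, of n] \<tau>b(1)[OF that] h0(2)[of n] by linarith
  have int0: "integrable P (\<lambda>\<omega>. payoff \<omega> 0)" by (rule int) (use \<tau>b(2) in auto)
  have lim: "(\<lambda>n. expectation (\<lambda>\<omega>. payoff \<omega> 0 - payoff \<omega> (\<sigma> n \<omega>))) \<longlonglongrightarrow> expectation (\<lambda>\<omega>. payoff \<omega> 0 - payoff \<omega> (\<tau> \<omega>))"
  proof (rule integral_dominated_convergence[where w = "\<lambda>_. 2 * (u_bound + cost_bound * (T + 1))"])
    show "(\<lambda>\<omega>. payoff \<omega> 0 - payoff \<omega> (\<tau> \<omega>)) \<in> borel_measurable P"
      using int0 intZ by measurable
    show "(\<lambda>\<omega>. payoff \<omega> 0 - payoff \<omega> (\<sigma> n \<omega>)) \<in> borel_measurable P" for n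
      using int0 int[OF \<sigma>meas \<sigma>b, of n] by measurable
    show "AE \<omega> in P. (\<lambda>n. payoff \<omega> 0 - payoff \<omega> (\<sigma> n \<omega>)) \<longlonglongrightarrow> payoff \<omega> 0 - payoff \<omega> (\<tau> \<omega>)"
    proof (rule AE_I2)
      fix \<omega> assume "\<omega> \<in> space P"
      then have \<omega>: "\<omega> \<in> index_paths" by (simp add: space_P)
      have "(\<lambda>n. \<sigma> n \<omega>) \<longlonglongrightarrow> \<tau> \<omega>"
      proof (rule tendsto_sandwich[of "\<lambda>n. \<tau> \<omega>" _ _ "\<lambda>n. \<tau> \<omega> + h n"])
        show "(\<lambda>n. \<tau> \<omega> + h n) \<longlonglongrightarrow> \<tau> \<omega>" using tendsto_add[OF tendsto_const hlim, of "\<tau> \<omega>"] by simp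
      qed (use \<sigma>[OF \<omega>] in auto)
      moreover have "continuous (at (\<tau> \<omega>) within {\<tau> \<omega>..}) (payoff \<omega>)"
        unfolding continuous_within at_within_Ici_at_right using \<tau>b(1)[OF \<omega>] by (intro payoff_right_continuous[OF \<omega>]) auto
      ultimately have "(\<lambda>n. payoff \<omega> (\<sigma> n \<omega>)) \<longlonglongrightarrow> payoff \<omega> (\<tau> \<omega>)"
        by (intro continuous_within_tendsto_compose'[of "\<tau> \<omega>" "{\<tau> \<omega>..}" "payoff \<omega>"]) (use \<sigma>[OF \<omega>] in auto)
      then show "(\<lambda>n. payoff \<omega> 0 - payoff \<omega> (\<sigma> n \<omega>)) \<longlonglongrightarrow> payoff \<omega> 0 - payoff \<omega> (\<tau> \<omega>)" by (intro tendsto_intros)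
    qed
    show "AE \<omega> in P. norm (payoff \<omega> 0 - payoff \<omega> (\<sigma> n \<omega>)) \<le> 2 * (u_bound + cost_bound * (T + 1))" for n
    proof (rule AE_I2)
      fix \<omega> assume "\<omega> \<in> space P"
      then have \<omega>: "\<omega> \<in> index_paths" by (simp add: space_P)
      then show "norm (payoff \<omega> 0 - payoff \<omega> (\<sigma> n \<omega>)) \<le> 2 * (u_bound + cost_bound * (T + 1))"
        using bd[OF \<omega>, of 0] bd[OF \<omega>, of "\<sigma> n \<omega>"] \<sigma>b[OF \<omega>, of n] \<tau>b(2) by (simp add: abs_le_iff)
    qed
  qed simp
  have "expectation (\<lambda>\<omega>. payoff \<omega> 0 - payoff \<omega> (\<tau> \<omega>)) \<le> 0"
  proof (rule field_le_epsilon)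
    fix e :: real assume e: "e > 0"
    define C where "C = (T + 1) * step_constant"
    have C: "0 \<le> C" using step_constant_nonneg \<tau>b(2) by (simp add: C_def)
    (* Both the modulus of continuity and the mesh will be below \<eta>, which gives the bound 2 C \<eta> < e. *)
    define \<eta> where "\<eta> = e / (2 * (C + 1))"
    have \<eta>: "0 < \<eta>" using e C by (simp add: \<eta>_def)
    obtain d where d: "d > 0" "\<And>i z z'. norm (z - z') < d \<Longrightarrow> \<bar>U i z - U i z'\<bar> < \<eta>"
      using subsolution_components_modulus[OF sub \<eta>] unfolding U_def by blast
    have "(\<lambda>n. R * h n) \<longlonglongrightarrow> R * 0" "(\<lambda>n. h n * coupling_size) \<longlonglongrightarrow> 0 * coupling_size"
      by (intro tendsto_intros hlim)+
    then have "\<forall>\<^sub>F n in sequentially. R * h n < d" "\<forall>\<^sub>F n in sequentially. h n * coupling_size < 1"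
      using order_tendstoD(2)[of _ "R * 0" sequentially d] order_tendstoD(2)[of _ "0 * coupling_size" sequentially 1] d(1)
      by simp_all
    moreover have "\<forall>\<^sub>F n in sequentially. h n < \<eta>" using order_tendstoD(2)[OF hlim \<eta>] .
    ultimately have "\<forall>\<^sub>F n in sequentially. expectation (\<lambda>\<omega>. payoff \<omega> 0 - payoff \<omega> (\<sigma> n \<omega>)) \<le> C * (\<eta> + \<eta>)"
    proof eventually_elim
      case (elim n)
      have "expectation (\<lambda>\<omega>. payoff \<omega> 0 - payoff \<omega> (\<sigma> n \<omega>)) \<le> (T + 1) * (step_constant * (\<eta> + h n))"
        unfolding \<sigma>_def
        by (rule grid_stopping_bound[OF \<tau> \<tau>b]) (use elim d(2) in \<open>auto simp: h_def intro: less_imp_le\<close>)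
      also have "\<dots> = C * (\<eta> + h n)" by (simp add: C_def)
      also have "\<dots> \<le> C * (\<eta> + \<eta>)" using elim C by (intro mult_left_mono) auto
      finally show ?case .
    qed
    then have "expectation (\<lambda>\<omega>. payoff \<omega> 0 - payoff \<omega> (\<tau> \<omega>)) \<le> C * (\<eta> + \<eta>)"
      by (rule tendsto_upperbound[OF lim]) simp
    also have "\<dots> \<le> (C + 1) * (\<eta> + \<eta>)" using \<eta> by (intro mult_right_mono) auto
    also have "\<dots> = 2 * (C + 1) * \<eta>" by (simp add: algebra_simps)
    also have "\<dots> = e" using C by (simp add: \<eta>_def)
    finally show "expectation (\<lambda>\<omega>. payoff \<omega> 0 - payoff \<omega> (\<tau> \<omega>)) \<le> 0 + e" by simp
  qed
  then show "expectation (\<lambda>\<omega>. payoff \<omega> 0) \<le> expectation (\<lambda>\<omega>. payoff \<omega> (\<tau> \<omega>))"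
    using int0 intZ by simp
qed

lemma controlled_inequality:
  assumes \<tau>: "\<tau> \<in> borel_measurable index_algebra" "stopping_time index_filtration \<tau>"
    and \<tau>b: "\<And>\<omega>. \<omega> \<in> index_paths \<Longrightarrow> 0 \<le> \<tau> \<omega> \<and> \<tau> \<omega> \<le> T" "0 \<le> T"
  shows "expectation (\<lambda>\<omega>. U (\<omega> 0) z0 - U (\<omega> (\<tau> \<omega>)) (traj \<omega> (\<tau> \<omega>))) \<le> expectation (\<lambda>\<omega>. action \<omega> (\<tau> \<omega>))"
proof -
  have Z0: "payoff \<omega> 0 = U (\<omega> 0) z0" if "\<omega> \<in> index_paths" for \<omega>
  proof -
    have "traj \<omega> 0 = z0"
      using set_integral_bounded_norm[OF path_section_measurable[OF control_measurable] control_bounded, of \<omega> 0 0] that by (simp add: traj_def)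
    moreover have "action \<omega> 0 = 0" using action_bounded[OF that, of 0] by simp
    ultimately show ?thesis by (simp add: payoff_def)
  qed
  have iA: "integrable P (\<lambda>\<omega>. action \<omega> (\<tau> \<omega>))"
  proof (rule integrable_bounded[where K = "cost_bound * T"])
    show "(\<lambda>\<omega>. action \<omega> (\<tau> \<omega>)) \<in> borel_measurable P" using \<tau>(1) by measurable
    fix \<omega> :: "real \<Rightarrow> 'm" assume \<omega>: "\<omega> \<in> index_paths"
    have "\<bar>action \<omega> (\<tau> \<omega>)\<bar> \<le> cost_bound * \<tau> \<omega>" by (rule action_bounded[OF \<omega>]) (use \<tau>b(1)[OF \<omega>] in auto)
    also have "\<dots> \<le> cost_bound * T" using \<tau>b(1)[OF \<omega>] cost_bounded(1) by (intro mult_left_mono) auto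
    finally show "\<bar>action \<omega> (\<tau> \<omega>)\<bar> \<le> cost_bound * T" .
  qed
  have iU: "integrable P (\<lambda>\<omega>. U (\<omega> (\<rho> \<omega>)) (traj \<omega> (\<rho> \<omega>)))" if "\<rho> \<in> borel_measurable index_algebra" for \<rho>
  proof (rule integrable_bounded[where K = u_bound])
    show "(\<lambda>\<omega>. U (\<omega> (\<rho> \<omega>)) (traj \<omega> (\<rho> \<omega>))) \<in> borel_measurable P" using that by measurable
  qed (rule u_bounded)
  have i0: "integrable P (\<lambda>\<omega>. U (\<omega> 0) z0)"
  proof (rule integrable_bounded[where K = u_bound])
    have "(\<lambda>\<omega>. U (\<omega> 0) z0) \<in> borel_measurable index_algebra"
      by (rule measurable_compose_countable[where f = "\<lambda>i \<omega>. U i z0" and g = "\<lambda>\<omega>. \<omega> 0"]) measurable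
    then show "(\<lambda>\<omega>. U (\<omega> 0) z0) \<in> borel_measurable P" by measurable
  qed (rule u_bounded)
  have "expectation (\<lambda>\<omega>. U (\<omega> 0) z0) = expectation (\<lambda>\<omega>. payoff \<omega> 0)"
    by (rule Bochner_Integration.integral_cong) (auto simp: space_P Z0)
  also have "\<dots> \<le> expectation (\<lambda>\<omega>. payoff \<omega> (\<tau> \<omega>))" by (rule optional_stopping(2)[OF \<tau> \<tau>b])
  also have "\<dots> = expectation (\<lambda>\<omega>. U (\<omega> (\<tau> \<omega>)) (traj \<omega> (\<tau> \<omega>))) + expectation (\<lambda>\<omega>. action \<omega> (\<tau> \<omega>))"
    unfolding payoff_def by (rule Bochner_Integration.integral_add[OF iU[OF \<tau>(1)] iA])
  finally show ?thesis using i0 iU[OF \<tau>(1)] by simp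
qed

end

section \<open>Controls\<close>

lemma control_jointly_measurable:
  fixes \<Xi> :: "(real \<Rightarrow> 'm::finite) \<Rightarrow> real \<Rightarrow> real ^ 'n::finite"
  assumes "\<Xi> \<in> measurable index_algebra (evaluation_algebra euclidean {0..})"
  shows "(\<lambda>(\<omega>, s). \<Xi> \<omega> s) \<in> borel_measurable path_time_space"
proof -
  have cad: "\<Xi> \<omega> \<in> cadlag_paths euclidean" if "\<omega> \<in> space index_algebra" for \<omega>
    using measurable_space[OF assms that] by (simp add: space_evaluation_algebra)
  have "(\<lambda>(\<omega>, s). \<Xi> \<omega> (max 0 s)) \<in> borel_measurable path_time_space"
  proof (rule right_continuous_jointly_measurable)
    show "(\<lambda>\<omega>. \<Xi> \<omega> s) \<in> borel_measurable index_algebra" if "0 \<le> s" for s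
      using measurable_compose[OF assms measurable_euclidean_evaluation[of s "{0..}"]] that by simp
    show "(\<Xi> \<omega> \<longlongrightarrow> \<Xi> \<omega> s) (at_right s)" if "\<omega> \<in> space index_algebra" "0 \<le> s" for \<omega> s
      using cad[OF that(1)] that(2) by (simp add: cadlag_paths_def)
  qed
  then have 1: "(\<lambda>(\<omega>, s). if s < 0 then undefined else \<Xi> \<omega> (max 0 s)) \<in> borel_measurable path_time_space"
    by (auto simp: split_beta intro!: measurable_If)
  have 2: "(case x of (\<omega>, s) \<Rightarrow> if s < 0 then undefined else \<Xi> \<omega> (max 0 s)) = (case x of (\<omega>, s) \<Rightarrow> \<Xi> \<omega> s)"
    if "x \<in> space path_time_space" for x
    using that cad by (auto simp: space_pair_measure cadlag_paths_def extensional_def)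
  show ?thesis by (rule measurable_cong[THEN iffD1, OF 2 1])
qed

text \<open>The definition provides the bound for some strictly positive initial distribution; absolute continuity
  passes it on to the given one.\<close>

lemma control_essentially_bounded:
  fixes \<Xi> :: "(real \<Rightarrow> 'm::finite) \<Rightarrow> real \<Rightarrow> real ^ 'n::finite"
  assumes laws: "\<And>b. b \<in> prob_vectors \<Longrightarrow> is_path_law \<Lambda> b (P b)"
    and ctrl: "control P \<Xi>" and a: "a \<in> prob_vectors" and T: "0 < T"
  shows "\<exists>R>0. AE \<omega> in P a. \<forall>s\<in>{0..T}. norm (\<Xi> \<omega> s) \<le> R"
proof -
  have \<Xi>: "\<Xi> \<in> measurable index_algebra (evaluation_algebra euclidean {0..})"
    using ctrl by (simp add: control_def)
  obtain R where R: "R > 0" "almost_surely P (\<lambda>\<omega>. (SUP s\<in>{0..T}. norm (\<Xi> \<omega> s)) < R)"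
    using ctrl T unfolding control_def by blast
  then obtain b where b: "b \<in> prob_vectors" "\<And>i. 0 < b $ i" "AE \<omega> in P b. (SUP s\<in>{0..T}. norm (\<Xi> \<omega> s)) < R"
    unfolding almost_surely_def by blast
  have ae: "AE \<omega> in P a. (SUP s\<in>{0..T}. norm (\<Xi> \<omega> s)) < R"
    by (rule path_law_AE_transfer[OF laws a b])
  have "AE \<omega> in P a. \<forall>s\<in>{0..T}. norm (\<Xi> \<omega> s) \<le> R"
    using ae AE_space
  proof eventually_elim
    case (elim \<omega>)
    then have "\<omega> \<in> space index_algebra" using path_law_sets(3)[OF laws[OF a]] by (simp add: space_index_algebra)
    from measurable_space[OF \<Xi> this] have "\<Xi> \<omega> \<in> cadlag_paths euclidean"
      by (simp add: space_evaluation_algebra)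
    then have "bounded (\<Xi> \<omega> ` {0..T})" by (rule bounded_cadlag)
    then have "bdd_above ((\<lambda>s. norm (\<Xi> \<omega> s)) ` {0..T})"
      unfolding bounded_iff bdd_above_def by auto
    then have "norm (\<Xi> \<omega> s) \<le> (SUP s\<in>{0..T}. norm (\<Xi> \<omega> s))" if "s \<in> {0..T}" for s
      using that by (intro cSUP_upper)
    then show ?case using elim(1) by force
  qed
  then show ?thesis using R(1) by blast
qed

theorem theorem4p1:
  fixes H :: "'m::finite \<Rightarrow> 'n::finite torus \<Rightarrow> real ^ 'n \<Rightarrow> real"
    and \<Lambda> :: "real ^ 'm ^ 'm"
    and P :: "real ^ 'm \<Rightarrow> (real \<Rightarrow> 'm) measure"
    and \<alpha> :: real
    and u :: "'n torus \<Rightarrow> real ^ 'm"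
    and \<tau> :: "(real \<Rightarrow> 'm) \<Rightarrow> real"
    and \<Xi> :: "(real \<Rightarrow> 'm) \<Rightarrow> real \<Rightarrow> real ^ 'n"
    and a :: "real ^ 'm"
    and x :: "'n torus"
  assumes "\<And>i. hamiltonian (H i)"
    and "coupling_matrix \<Lambda>"
    and "\<And>b. b \<in> prob_vectors \<Longrightarrow> is_path_law \<Lambda> b (P b)"
    and "critical_value H \<Lambda> \<le> \<alpha>"
    and "subsolution H \<Lambda> \<alpha> u"
    and "bounded_stopping_time \<tau>"
    and "control P \<Xi>"
    and "a \<in> prob_vectors"
  shows "(LINT \<omega>|P a. u x $ \<omega> 0 - u (x + torus_integral (\<Xi> \<omega>) (\<tau> \<omega>)) $ \<omega> (\<tau> \<omega>))
    \<le> (LINT \<omega>|P a. (LINT s:{0..\<tau> \<omega>}|lborel.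
          (lagrangian (H (\<omega> s)) (x + torus_integral (\<Xi> \<omega>) s) (- \<Xi> \<omega> s) + \<alpha>)))"
proof -
  obtain z0 where z0: "torus_proj z0 = x" using torus_proj_surj by blast
  obtain T0 where T0: "\<And>\<omega>. \<omega> \<in> index_paths \<Longrightarrow> \<tau> \<omega> \<le> T0"
    using assms(6) unfolding bounded_stopping_time_def by blast
  define T where "T = max T0 1"
  have T: "0 < T" by (simp add: T_def)
  have \<tau>: "\<tau> \<in> borel_measurable index_algebra" "stopping_time index_filtration \<tau>"
    "\<And>\<omega>. \<omega> \<in> index_paths \<Longrightarrow> 0 \<le> \<tau> \<omega> \<and> \<tau> \<omega> \<le> T"
    using assms(6) T0 unfolding bounded_stopping_time_def T_def by force+
  have \<Xi>m: "\<Xi> \<in> measurable index_algebra (evaluation_algebra euclidean {0..})"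
    using assms(7) by (simp add: control_def)
  have jm: "(\<lambda>(\<omega>, s). \<Xi> \<omega> s) \<in> borel_measurable path_time_space"
    by (rule control_jointly_measurable[OF \<Xi>m])
  obtain R where R: "R > 0" and ae: "AE \<omega> in P a. \<forall>s\<in>{0..T}. norm (\<Xi> \<omega> s) \<le> R"
    using control_essentially_bounded[OF assms(3,7,8) T] by blast
  (* Projecting the control on the ball of radius R makes the bound hold on every path while preserving
     right-continuity and nonanticipation, and changes nothing almost surely on {0..T}. *)
  define clip where "clip = closest_point (cball (0::real ^ 'n) R)"
  have clip_cont: "continuous_on UNIV clip"
    unfolding clip_def using R by (intro continuous_on_closest_point) auto
  have clip_bound: "norm (clip v) \<le> R" for v
    using closest_point_in_set[of "cball 0 R" v] R by (simp add: clip_def)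
  have clip_id: "clip v = v" if "norm v \<le> R" for v
    unfolding clip_def using that by (intro closest_point_self) simp
  define \<xi> where "\<xi> \<omega> s = clip (\<Xi> \<omega> s)" for \<omega> s
  have \<xi>m: "(\<lambda>(\<omega>, s). \<xi> \<omega> s) \<in> borel_measurable path_time_space"
    using measurable_compose[OF jm borel_measurable_continuous_onI[OF clip_cont]] by (simp add: \<xi>_def split_beta)
  interpret raw: controlled_path H \<Lambda> \<alpha> u \<Xi> z0
    by unfold_locales (use assms(1,5) jm in auto)
  interpret clipped: controlled_system H \<Lambda> \<alpha> u \<xi> z0 a "P a" R
  proof
    show "(\<Sum>j\<in>UNIV. \<Lambda> $ i $ j) = 0" for i using assms(2) by (simp add: coupling_matrix_def)
    show "is_path_law \<Lambda> a (P a)" by (rule assms(3)[OF assms(8)])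
    show "norm (\<xi> \<omega> s) \<le> R" for \<omega> s by (simp add: \<xi>_def clip_bound)
    fix \<omega> :: "real \<Rightarrow> 'm" and s :: real assume *: "\<omega> \<in> index_paths" "0 \<le> s"
    then have "\<Xi> \<omega> \<in> cadlag_paths euclidean"
      using measurable_space[OF \<Xi>m, of \<omega>] by (simp add: space_evaluation_algebra space_index_algebra)
    then have "(\<Xi> \<omega> \<longlongrightarrow> \<Xi> \<omega> s) (at_right s)" using *(2) by (simp add: cadlag_paths_def)
    then show "(\<xi> \<omega> \<longlongrightarrow> \<xi> \<omega> s) (at_right s)"
      unfolding \<xi>_def using clip_cont
      by (intro isCont_tendsto_compose[of _ clip]) (auto simp: continuous_on_eq_continuous_at)
  next
    fix t s :: real and \<omega>1 \<omega>2 :: "real \<Rightarrow> 'm"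
    assume *: "0 < t" "\<omega>1 \<in> index_paths" "\<omega>2 \<in> index_paths" "0 \<le> s" "s \<le> t"
      "\<And>s. 0 \<le> s \<Longrightarrow> s \<le> t \<Longrightarrow> \<omega>1 s = \<omega>2 s"
    then have "\<forall>s\<in>{0..t}. \<omega>1 s = \<omega>2 s" by simp
    then have "\<forall>s\<in>{0..t}. \<Xi> \<omega>1 s = \<Xi> \<omega>2 s"
      by (rule conjunct2[OF conjunct2[OF assms(7)[unfolded control_def]],
          THEN spec, THEN mp, OF *(1), THEN bspec, OF *(2), THEN bspec, OF *(3), THEN mp])
    then show "\<xi> \<omega>1 s = \<xi> \<omega>2 s" using * by (simp add: \<xi>_def)
  qed (use assms(1,5) \<xi>m in auto)
  have x_eq: "x + torus_integral (\<Xi> \<omega>) t = torus_proj (raw.traj \<omega> t)" for \<omega> t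
    by (simp add: raw.traj_def torus_integral_def torus_proj_add z0)
  have lhs: "u x $ \<omega> 0 - u (x + torus_integral (\<Xi> \<omega>) (\<tau> \<omega>)) $ \<omega> (\<tau> \<omega>) =
      raw.U (\<omega> 0) z0 - raw.U (\<omega> (\<tau> \<omega>)) (raw.traj \<omega> (\<tau> \<omega>))" for \<omega>
    by (simp add: raw.U_def x_eq z0)
  have rhs: "(LINT s:{0..\<tau> \<omega>}|lborel. (lagrangian (H (\<omega> s)) (x + torus_integral (\<Xi> \<omega>) s) (- \<Xi> \<omega> s) + \<alpha>))
      = raw.action \<omega> (\<tau> \<omega>)" for \<omega>
    by (simp add: raw.action_def raw.running_def x_eq)
  (* Both sides are integrals of functions that agree almost surely with their truncated versions. *)
  have same: "AE \<omega> in P a. raw.traj \<omega> (\<tau> \<omega>) = clipped.traj \<omega> (\<tau> \<omega>) \<and> raw.action \<omega> (\<tau> \<omega>) = clipped.action \<omega> (\<tau> \<omega>)"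
    using ae AE_space
  proof eventually_elim
    case (elim \<omega>)
    then have \<omega>: "\<omega> \<in> index_paths" by (simp add: clipped.space_P)
    have eq: "\<Xi> \<omega> s = \<xi> \<omega> s" if "s \<in> {0..T}" for s
      using elim(1) that by (simp add: \<xi>_def clip_id)
    have traj: "raw.traj \<omega> t = clipped.traj \<omega> t" if "t \<le> T" for t
      unfolding raw.traj_def clipped.traj_def
      by (intro arg_cong2[where f = "(+)"] set_lebesgue_integral_cong) (use eq that in auto)
    have "raw.running i \<omega> s = clipped.running i \<omega> s" if "s \<in> {0..T}" for i s
      using traj[of s] eq[OF that] that by (simp add: raw.running_def clipped.running_def)
    then have "raw.action \<omega> (\<tau> \<omega>) = clipped.action \<omega> (\<tau> \<omega>)"
      unfolding raw.action_def clipped.action_def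
      by (intro set_lebesgue_integral_cong) (use \<tau>(3)[OF \<omega>] in auto)
    then show ?case using traj \<tau>(3)[OF \<omega>] by simp
  qed
  note clipped.sets_P [measurable_cong]
  have m0: "(\<lambda>\<omega>. raw.U (\<omega> 0) z0) \<in> borel_measurable (P a)"
  proof -
    have "(\<lambda>\<omega>. raw.U (\<omega> 0) z0) \<in> borel_measurable index_algebra"
      by (rule measurable_compose_countable[where f = "\<lambda>i \<omega>. raw.U i z0" and g = "\<lambda>\<omega>. \<omega> 0"])
         (use clipped.process_at_measurable in auto)
    then show ?thesis by measurable
  qed
  have mraw: "(\<lambda>\<omega>. raw.U (\<omega> (\<tau> \<omega>)) (raw.traj \<omega> (\<tau> \<omega>))) \<in> borel_measurable (P a)"
      "(\<lambda>\<omega>. raw.action \<omega> (\<tau> \<omega>)) \<in> borel_measurable (P a)"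
    using \<tau>(1) by measurable
  have mclip: "(\<lambda>\<omega>. raw.U (\<omega> (\<tau> \<omega>)) (clipped.traj \<omega> (\<tau> \<omega>))) \<in> borel_measurable (P a)"
      "(\<lambda>\<omega>. clipped.action \<omega> (\<tau> \<omega>)) \<in> borel_measurable (P a)"
    using \<tau>(1) by measurable
  have "(LINT \<omega>|P a. raw.U (\<omega> 0) z0 - raw.U (\<omega> (\<tau> \<omega>)) (raw.traj \<omega> (\<tau> \<omega>)))
      = (LINT \<omega>|P a. raw.U (\<omega> 0) z0 - raw.U (\<omega> (\<tau> \<omega>)) (clipped.traj \<omega> (\<tau> \<omega>)))"
    by (rule integral_cong_AE) (use m0 mraw mclip same in auto)
  also have "\<dots> \<le> (LINT \<omega>|P a. clipped.action \<omega> (\<tau> \<omega>))"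
    by (rule clipped.controlled_inequality[OF \<tau>]) (use T in auto)
  also have "\<dots> = (LINT \<omega>|P a. raw.action \<omega> (\<tau> \<omega>))"
    by (rule integral_cong_AE) (use mraw mclip same in auto)
  finally show ?thesis by (simp only: lhs rhs)
qed

end
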